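(* Let $\rho$ be a given state of two qubits. The optimal trace-preserving LOCC protocol maximizing the fidelity of $\rho$ consists of a 1-LOCC protocol where one party applies a state-dependent filter; in case of success, the other party does nothing, and in case of failure, both parties make a pure separable state. The optimal filter and the maximal achievable fidelity $F^*$ can be found by solving the following convex semidefinite program: maximize over $4\times 4$ matrices $X$ $$F^*=\frac12-\mathrm{Tr}(X\rho^\Gamma)$$ under the constraints $$0\le X\le I_4,\qquad -\frac{I_4}{2}\le X^\Gamma\le\frac{I_4}{2}.$$ If $\rho$ is entangled, then $F^*>1/2$ and the optimal $X_{opt}$ will be of rank $1$, and the filter $A$ can be obtained by making the identification $$X_{opt}=(A\otimes I_2)|\psi\rangle\langle\psi|(A^\dagger\otimes I_2),\qquad |\psi\rangle=\frac{|00\rangle+|11\rangle}{\sqrt2}.$$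
   Context: A state of two qubits is a positive semidefinite operator of trace one on $\mathbb{C}^2\otimes\mathbb{C}^2$, each qubit being held by one of two parties; it is separable if it is a convex combination of product states and entangled otherwise. The fidelity (maximal singlet fraction) is $F(\rho)=\max_{|\phi\rangle}\langle\phi|\rho|\phi\rangle$, the maximum being over all maximally entangled unit vectors, i.e. $|\phi\rangle=(U\otimes V)(|00\rangle+|11\rangle)/\sqrt2$ with $U,V$ unitary. $F^*$ denotes the maximal fidelity $F(\Lambda(\rho))$ achievable by trace-preserving LOCC operations $\Lambda$ from two qubits to two qubits. LOCC operations are local quantum operations by the two parties assisted by classical communication; 1-LOCC means that the classical communication is one-way. A filter $A$ (a $2\times 2$ contraction) applied by one party is a two-outcome local operation whose success branch applies $A$ to that party's qubit; otherwise it fails. $M^\Gamma$ denotes the partial transpose of a $4\times4$ matrix $M$ with respect to the second qubit. Matrix inequalities are in the positive semidefinite order, and $I_n$ is the $n\times n$ identity. *)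

theory Defs
  imports Complex_Main
    "Jordan_Normal_Form.Schur_Decomposition"
    "Jordan_Normal_Form.DL_Rank"
begin

section \<open>Matrices\<close>

text \<open>Kronecker product. With \<open>a, b\<close> the dimensions of the two factors, the product basis vector
  \<open>|i>|j>\<close> has index \<open>i * b + j\<close>; for two qubits, \<open>|ij>\<close> has index \<open>2 * i + j\<close>.\<close>

definition tensor_mat :: "complex mat \<Rightarrow> complex mat \<Rightarrow> complex mat" (infixl "\<otimes>\<^sub>m" 70) where
  "A \<otimes>\<^sub>m B = mat (dim_row A * dim_row B) (dim_col A * dim_col B)
     (\<lambda>(i, j). A $$ (i div dim_row B, j div dim_col B) * B $$ (i mod dim_row B, j mod dim_col B))"

definition mat_trace :: "complex mat \<Rightarrow> complex" where
  "mat_trace M = (\<Sum>i<dim_row M. M $$ (i, i))"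

text \<open>The order on \<^typ>\<open>complex\<close> is such that \<open>0 \<le> z\<close> includes \<open>z\<close> being real,
  so Hermiticity is part of the following condition.\<close>

definition psd :: "nat \<Rightarrow> complex mat \<Rightarrow> bool" where
  "psd n M \<longleftrightarrow> M \<in> carrier_mat n n \<and> (\<forall>v \<in> carrier_vec n. 0 \<le> (M *\<^sub>v v) \<bullet>c v)"

definition loewner_le :: "nat \<Rightarrow> complex mat \<Rightarrow> complex mat \<Rightarrow> bool" where
  "loewner_le n A B \<longleftrightarrow> psd n (B - A)"

definition unitary_mat :: "nat \<Rightarrow> complex mat \<Rightarrow> bool" where
  "unitary_mat n U \<longleftrightarrow> U \<in> carrier_mat n n \<and> mat_adjoint U * U = 1\<^sub>m n"

definition unit_vector :: "nat \<Rightarrow> complex vec \<Rightarrow> bool" where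
  "unit_vector n v \<longleftrightarrow> v \<in> carrier_vec n \<and> v \<bullet>c v = 1"

definition ket_bra :: "complex vec \<Rightarrow> complex mat" where
  "ket_bra v = mat (dim_vec v) (dim_vec v) (\<lambda>(i, j). v $ i * cnj (v $ j))"

definition partial_transpose :: "complex mat \<Rightarrow> complex mat" where
  "partial_transpose M =
     mat 4 4 (\<lambda>(i, j). M $$ (2 * (i div 2) + j mod 2, 2 * (j div 2) + i mod 2))"

definition sum_mats :: "nat \<Rightarrow> nat \<Rightarrow> complex mat list \<Rightarrow> complex mat" where
  "sum_mats n m Ms = foldr (+) Ms (0\<^sub>m n m)"


section \<open>States and fidelity\<close>

definition density :: "nat \<Rightarrow> complex mat \<Rightarrow> bool" where
  "density n \<rho> \<longleftrightarrow> psd n \<rho> \<and> mat_trace \<rho> = 1"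

abbreviation two_qubit_state :: "complex mat \<Rightarrow> bool" where
  "two_qubit_state \<equiv> density 4"

definition separable :: "complex mat \<Rightarrow> bool" where
  "separable \<rho> \<longleftrightarrow> (\<exists>(n :: nat) (p :: nat \<Rightarrow> real) \<sigma> \<tau>.
     (\<forall>i<n. 0 \<le> p i \<and> density 2 (\<sigma> i) \<and> density 2 (\<tau> i)) \<and> (\<Sum>i<n. p i) = 1 \<and>
     \<rho> = sum_mats 4 4 (map (\<lambda>i. complex_of_real (p i) \<cdot>\<^sub>m (\<sigma> i \<otimes>\<^sub>m \<tau> i)) [0..<n]))"

definition entangled :: "complex mat \<Rightarrow> bool" where
  "entangled \<rho> \<longleftrightarrow> two_qubit_state \<rho> \<and> \<not> separable \<rho>"

definition bell :: "complex vec" where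
  "bell = vec 4 (\<lambda>i. if i = 0 \<or> i = 3 then 1 / complex_of_real (sqrt 2) else 0)"

definition max_entangled :: "complex vec \<Rightarrow> bool" where
  "max_entangled \<phi> \<longleftrightarrow> (\<exists>U V. unitary_mat 2 U \<and> unitary_mat 2 V \<and> \<phi> = (U \<otimes>\<^sub>m V) *\<^sub>v bell)"

definition fidelity :: "complex mat \<Rightarrow> real" where
  "fidelity \<rho> = Sup {Re ((\<rho> *\<^sub>v \<phi>) \<bullet>c \<phi>) | \<phi>. max_entangled \<phi>}"


section \<open>Trace-preserving LOCC operations\<close>

datatype party = Alice | Bob

fun other :: "party \<Rightarrow> party" where
  "other Alice = Bob"
| "other Bob = Alice"

definition kraus_map :: "nat \<Rightarrow> complex mat list \<Rightarrow> complex mat \<Rightarrow> complex mat" where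
  "kraus_map n Ks M = sum_mats n n (map (\<lambda>K. K * M * mat_adjoint K) Ks)"

text \<open>An outcome \<open>(d, Ks)\<close> of a local measurement is the completely positive map with Kraus
  operators \<open>Ks\<close> and output dimension \<open>d\<close>. An instrument on a system of dimension \<open>a\<close> is a list of
  outcomes whose maps sum to a trace-preserving one; an instrument with a single outcome
  is a channel.\<close>

type_synonym outcome = "nat \<times> complex mat list"

definition instrument :: "nat \<Rightarrow> outcome list \<Rightarrow> bool" where
  "instrument a E \<longleftrightarrow>
     (\<forall>(d, Ks) \<in> set E. \<forall>K \<in> set Ks. K \<in> carrier_mat d a) \<and>
     sum_mats a a (map (\<lambda>K. mat_adjoint K * K) (concat (map snd E))) = 1\<^sub>m a"

definition local_mat :: "party \<Rightarrow> nat \<Rightarrow> complex mat \<Rightarrow> complex mat" where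
  "local_mat p c K = (case p of Alice \<Rightarrow> K \<otimes>\<^sub>m 1\<^sub>m c | Bob \<Rightarrow> 1\<^sub>m c \<otimes>\<^sub>m K)"

text \<open>Party \<open>p\<close> obtains the given outcome; \<open>c\<close> is the dimension of the system of the other party.\<close>

definition apply_local :: "party \<Rightarrow> nat \<Rightarrow> outcome \<Rightarrow> complex mat \<Rightarrow> complex mat" where
  "apply_local p c e = kraus_map (fst e * c) (map (local_mat p c) (snd e))"

text \<open>\<open>locc a' b' a b \<Lambda>\<close>: \<open>\<Lambda>\<close> is implemented by a protocol with finitely many rounds on a system of
  dimensions \<open>a, b\<close>, ending in dimensions \<open>a', b'\<close>. In each round one party measures and announces
  the outcome, on which the rest of the protocol depends. Local dimensions may change on the way,
  so local ancillas are covered, and shared randomness is the case of Kraus operators proportional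
  to the identity.\<close>

inductive locc ::
  "nat \<Rightarrow> nat \<Rightarrow> nat \<Rightarrow> nat \<Rightarrow> (complex mat \<Rightarrow> complex mat) \<Rightarrow> bool" for a' b' :: nat where
  finish: "locc a' b' a' b' (\<lambda>M. M)"
| alice: "instrument a E \<Longrightarrow> (\<forall>i<length E. locc a' b' (fst (E ! i)) b (F i)) \<Longrightarrow>
    locc a' b' a b (\<lambda>M. sum_mats (a' * b') (a' * b')
      (map (\<lambda>i. F i (apply_local Alice b (E ! i) M)) [0..<length E]))"
| bob: "instrument b E \<Longrightarrow> (\<forall>i<length E. locc a' b' a (fst (E ! i)) (F i)) \<Longrightarrow>
    locc a' b' a b (\<lambda>M. sum_mats (a' * b') (a' * b')
      (map (\<lambda>i. F i (apply_local Bob a (E ! i) M)) [0..<length E]))"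

abbreviation locc_two_qubits :: "(complex mat \<Rightarrow> complex mat) \<Rightarrow> bool" where
  "locc_two_qubits \<equiv> locc 2 2 2 2"

definition max_fidelity :: "complex mat \<Rightarrow> real" where
  "max_fidelity \<rho> = Sup {fidelity (\<Lambda> \<rho>) | \<Lambda>. locc_two_qubits \<Lambda>}"

definition optimal_locc :: "complex mat \<Rightarrow> (complex mat \<Rightarrow> complex mat) \<Rightarrow> bool" where
  "optimal_locc \<rho> \<Lambda> \<longleftrightarrow> locc_two_qubits \<Lambda> \<and>
     (\<forall>\<Lambda>'. locc_two_qubits \<Lambda>' \<longrightarrow> fidelity (\<Lambda>' \<rho>) \<le> fidelity (\<Lambda> \<rho>))"

text \<open>Party \<open>p\<close> applies the instrument \<open>E\<close> and announces the outcome \<open>i\<close>; the other party then applies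
  the channel with Kraus operators \<open>Ds ! i\<close>.\<close>

definition one_way_map ::
  "party \<Rightarrow> outcome list \<Rightarrow> complex mat list list \<Rightarrow> complex mat \<Rightarrow> complex mat" where
  "one_way_map p E Ds M = sum_mats 4 4
     (map (\<lambda>i. apply_local (other p) 2 (2, Ds ! i) (apply_local p 2 (E ! i) M)) [0..<length E])"

definition one_way_locc :: "(complex mat \<Rightarrow> complex mat) \<Rightarrow> bool" where
  "one_way_locc \<Lambda> \<longleftrightarrow> (\<exists>p E Ds. instrument 2 E \<and> (\<forall>e \<in> set E. fst e = 2) \<and>
     length Ds = length E \<and> (\<forall>D \<in> set Ds. instrument 2 [(2, D)]) \<and> \<Lambda> = one_way_map p E Ds)"


section \<open>Filter protocols\<close>

definition is_filter :: "complex mat \<Rightarrow> bool" where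
  "is_filter A \<longleftrightarrow> A \<in> carrier_mat 2 2 \<and> loewner_le 2 (mat_adjoint A * A) (1\<^sub>m 2)"

text \<open>Kraus operators \<open>|u><0|, |u><1|\<close> of the channel that prepares \<open>u\<close>.\<close>

definition prepare :: "complex vec \<Rightarrow> complex mat list" where
  "prepare u = map (\<lambda>k. mat 2 2 (\<lambda>(i, j). if j = k then u $ i else 0)) [0..<2]"

text \<open>Party \<open>p\<close> applies the filter \<open>A\<close>, with failure operator \<open>B\<close>. On success nothing else happens;
  on failure \<open>p\<close> prepares the pure state \<open>u\<close> and, being told so, the other party prepares \<open>v\<close>.\<close>

definition filter_protocol :: "party \<Rightarrow> complex mat \<Rightarrow> (complex mat \<Rightarrow> complex mat) \<Rightarrow> bool" where
  "filter_protocol p A \<Lambda> \<longleftrightarrow> is_filter A \<and>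
     (\<exists>B u v. B \<in> carrier_mat 2 2 \<and> mat_adjoint A * A + mat_adjoint B * B = 1\<^sub>m 2 \<and>
        unit_vector 2 u \<and> unit_vector 2 v \<and>
        \<Lambda> = one_way_map p [(2, [A]), (2, map (\<lambda>K. K * B) (prepare u))] [[1\<^sub>m 2], prepare v])"


section \<open>The semidefinite program\<close>

definition sdp_feasible :: "complex mat \<Rightarrow> bool" where
  "sdp_feasible X \<longleftrightarrow> X \<in> carrier_mat 4 4 \<and>
     loewner_le 4 (0\<^sub>m 4 4) X \<and> loewner_le 4 X (1\<^sub>m 4) \<and>
     loewner_le 4 (- ((1 / 2) \<cdot>\<^sub>m 1\<^sub>m 4)) (partial_transpose X) \<and>
     loewner_le 4 (partial_transpose X) ((1 / 2) \<cdot>\<^sub>m 1\<^sub>m 4)"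

text \<open>For Hermitian \<open>X\<close> and \<open>\<rho>\<close> the trace is real.\<close>

definition sdp_value :: "complex mat \<Rightarrow> complex mat \<Rightarrow> real" where
  "sdp_value \<rho> X = 1 / 2 - Re (mat_trace (X * partial_transpose \<rho>))"

definition sdp_optimal :: "complex mat \<Rightarrow> complex mat \<Rightarrow> bool" where
  "sdp_optimal \<rho> X \<longleftrightarrow> sdp_feasible X \<and>
     (\<forall>Y. sdp_feasible Y \<longrightarrow> sdp_value \<rho> Y \<le> sdp_value \<rho> X)"

text \<open>The identification of a filter with an SDP solution. Since \<open>(A \<otimes> I) bell = (I \<otimes> A\<^sup>T) bell\<close> and the
  partial transpose is taken on the second qubit, the \<open>A\<close> read off here is the filter to be applied
  by the second party (the first party would have to use the adjoint of \<open>A\<close>).\<close>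

definition filter_of_solution :: "complex mat \<Rightarrow> complex mat \<Rightarrow> bool" where
  "filter_of_solution X A \<longleftrightarrow> A \<in> carrier_mat 2 2 \<and>
     X = (A \<otimes>\<^sub>m 1\<^sub>m 2) * ket_bra bell * (mat_adjoint A \<otimes>\<^sub>m 1\<^sub>m 2)"

end

theory Submission
  imports Defs "HOL-Analysis.Topology_Euclidean_Space"
begin

text \<open>
  In the Heisenberg picture, an LOCC operation followed by the projection onto a maximally entangled
  vector is an operator \<open>Y \<ge> 0\<close> with \<open>Y\<^sup>\<Gamma> \<le> I / 2\<close>. Then \<open>X = I / 2 - Y\<^sup>\<Gamma>\<close> is feasible and its value is the
  fidelity reached, so the semidefinite program bounds \<open>F\<^sup>*\<close>.

  Conversely, every two-dimensional subspace contains a product vector, so a feasible \<open>X\<close> is a sum of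
  one \<open>|y><y|\<close> and of terms \<open>|p><p|\<close> with \<open>p = e \<otimes> f\<close> a product vector. Dropping the latter keeps \<open>X\<close>
  feasible and does not lower the value, as \<open><p|\<rho>\<^sup>\<Gamma>|p> = <p'|\<rho>|p'> \<ge> 0\<close> for \<open>p'\<close> the product of \<open>e\<close> and the
  conjugate of \<open>f\<close>. The remaining rank-one points are the filters, that is the contractions \<open>A\<close>, and
  the filter protocol, tested against the singlet, attains their value.

  If \<open>\<rho>\<close> is entangled, then \<open>\<rho>\<^sup>\<Gamma>\<close> has a negative direction by the Peres--Horodecki criterion, hence
  \<open>F\<^sup>* > 1 / 2\<close>. A product term \<open>p\<close> in an optimal \<open>X\<close> would satisfy \<open>\<rho> p' = 0\<close>; in Schmidt bases of \<open>A\<close>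
  this, together with stationarity of the value at \<open>A = diag (1, s)\<close> and \<open>\<rho> \<ge> 0\<close>, forces the value to be
  at most \<open>1 / 2\<close>. So \<open>X\<close> has rank one.

  For the Peres--Horodecki criterion, subtract a multiple of \<open>|00><00|\<close> until \<open>\<rho>\<close> or \<open>\<rho>\<^sup>\<Gamma>\<close> is singular. A
  product vector in the kernel leaves an explicit separable state. Any other kernel vector becomes the
  singlet after an invertible local filter; then \<open>\<rho>\<^sup>\<Gamma>\<close> is a sum of \<open>|h><h|\<close> with Hermitian \<open>2 \<times> 2\<close>
  matrices \<open>h\<close> whose determinants add up to 0, and rotating pairs of them makes every determinant 0.
\<close>

unbundle no vec_syntax
hide_const (open) Finite_Cartesian_Product.vec Finite_Cartesian_Product.mat Finite_Cartesian_Product.row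
hide_type (open) Finite_Cartesian_Product.vec

section \<open>Positive kernels\<close>

text \<open>The bound 1/2 is the operator norm of the partially transposed projector onto a
  maximally entangled vector. It survives every round because partial transposition turns local
  Kraus operators into local Kraus operators (Bob's become conjugated) that still satisfy the
  completeness relation.

  The delicate claim is rank one, since the optimal points of a semidefinite program may form a
  whole face, and a product residue of zero cost has to be excluded. Let \<open>q\<close> be the
  minimum of the form of \<open>\<rho>\<^sup>\<Gamma>\<close> over contractions. That
  \<open>q < 0\<close> enters twice: scaling up a minimizer would lower the value, so its operator
  norm is 1 and its Schmidt form is diag (1, s); and a residue is refuted by deriving
  \<open>q \<ge> 0\<close>. First-order conditions are available only along perturbations that
  enlarge the operator norm at most to second order. For \<open>s < 1\<close> the entry
  \<open>s\<close> and the entry below the diagonal are such directions, and with a kernel vector of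
  \<open>\<rho>\<close> they fix enough entries. For \<open>s = 1\<close> the constraint is
  saturated on so many vectors that it leaves no room for a residue at all.\<close>

definition sesq :: "('a::finite \<Rightarrow> 'a \<Rightarrow> complex) \<Rightarrow> ('a \<Rightarrow> complex) \<Rightarrow> ('a \<Rightarrow> complex) \<Rightarrow> complex" where
  "sesq K x y = (\<Sum>p\<in>UNIV. \<Sum>q\<in>UNIV. cnj (x p) * K p q * y q)"

definition pos :: "('a::finite \<Rightarrow> 'a \<Rightarrow> complex) \<Rightarrow> bool" where
  "pos K \<longleftrightarrow> (\<forall>x. 0 \<le> sesq K x x)"

definition single :: "'a \<Rightarrow> 'a \<Rightarrow> complex" where
  "single p q = (if q = p then 1 else 0)"

definition norm2 :: "('a::finite \<Rightarrow> complex) \<Rightarrow> real" where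
  "norm2 x = (\<Sum>p\<in>UNIV. (cmod (x p))\<^sup>2)"

definition cdot :: "('a::finite \<Rightarrow> complex) \<Rightarrow> ('a \<Rightarrow> complex) \<Rightarrow> complex" where
  "cdot x y = (\<Sum>p\<in>UNIV. cnj (x p) * y p)"

definition outer :: "('a \<Rightarrow> complex) \<Rightarrow> 'a \<Rightarrow> 'a \<Rightarrow> complex" where
  "outer x p q = x p * cnj (x q)"

lemma sesq_add_right: "sesq K x (\<lambda>p. y p + z p) = sesq K x y + sesq K x z"
  by (simp add: sesq_def algebra_simps sum.distrib)

lemma sesq_add_left: "sesq K (\<lambda>p. y p + z p) x = sesq K y x + sesq K z x"
  by (simp add: sesq_def algebra_simps sum.distrib)

lemma sesq_scale_right: "sesq K x (\<lambda>p. c * y p) = c * sesq K x y"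
  by (simp add: sesq_def algebra_simps sum_distrib_left)

lemma sesq_scale_left: "sesq K (\<lambda>p. c * y p) x = cnj c * sesq K y x"
  by (simp add: sesq_def algebra_simps sum_distrib_left)

lemma sesq_zero: "sesq (\<lambda>p q. 0) x y = 0"
  by (simp add: sesq_def)

lemma sesq_plus: "sesq (\<lambda>p q. K p q + L p q) x y = sesq K x y + sesq L x y"
  by (simp add: sesq_def algebra_simps sum.distrib)

lemma sesq_minus: "sesq (\<lambda>p q. K p q - L p q) x y = sesq K x y - sesq L x y"
  by (simp add: sesq_def algebra_simps sum_subtractf)

lemma sesq_scale: "sesq (\<lambda>p q. c * K p q) x y = c * sesq K x y"
  by (simp add: sesq_def algebra_simps sum_distrib_left)

lemma sesq_sum_list: "sesq (\<lambda>p q. \<Sum>v\<leftarrow>vs. F v p q) x y = (\<Sum>v\<leftarrow>vs. sesq (F v) x y)"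
  by (induction vs) (simp_all add: sesq_zero sesq_plus)

lemma norm2_nonneg [simp]: "0 \<le> norm2 x"
  by (simp add: norm2_def sum_nonneg)

lemma norm2_eq_0_iff: "norm2 x = 0 \<longleftrightarrow> (\<forall>p. x p = 0)"
  by (auto simp: norm2_def sum_nonneg_eq_0_iff)

lemma cdot_self: "cdot x x = complex_of_real (norm2 x)"
  unfolding cdot_def norm2_def of_real_sum complex_norm_square by (simp add: mult.commute)

lemma norm2_scale: "norm2 (\<lambda>p. c * x p) = (cmod c)\<^sup>2 * norm2 x"
  by (simp add: norm2_def norm_mult power_mult_distrib sum_distrib_left)

lemma sesq_outer: "sesq (outer x) y z = cdot y x * cdot x z"
  by (simp add: sesq_def outer_def cdot_def sum_product mult.assoc)

lemma cnj_cdot: "cnj (cdot x y) = cdot y x"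
  by (simp add: cdot_def mult.commute)

lemma sesq_outer_self: "sesq (outer x) y y = complex_of_real ((cmod (cdot y x))\<^sup>2)"
  unfolding sesq_outer complex_norm_square cnj_cdot by simp

lemma sesq_one: "sesq (\<lambda>p q. if p = q then c else 0) x y = c * cdot x y"
proof -
  have "(\<Sum>q\<in>UNIV. cnj (x p) * (if p = q then c else 0) * y q) = c * (cnj (x p) * y p)" for p
  proof -
    have "(\<Sum>q\<in>UNIV. cnj (x p) * (if p = q then c else 0) * y q)
        = (\<Sum>q\<in>UNIV. if p = q then c * (cnj (x p) * y q) else 0)"
      by (intro sum.cong) auto
    then show ?thesis by simp
  qed
  then show ?thesis by (simp add: sesq_def cdot_def sum_distrib_left)
qed

lemma sum_single: "(\<Sum>q\<in>UNIV. f q * single p q) = f (p::'a::finite)"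
proof -
  have "(\<Sum>q\<in>UNIV. f q * single p q) = (\<Sum>q\<in>UNIV. if q = p then f q else 0)"
    by (intro sum.cong) (auto simp: single_def)
  then show ?thesis by simp
qed

lemma cnj_single [simp]: "cnj (single p q) = single p q"
  by (simp add: single_def)

lemma sesq_single_right: "sesq K x (single q) = (\<Sum>p\<in>UNIV. cnj (x p) * K p q)"
  by (simp add: sesq_def sum_single)

lemma sesq_single_left: "sesq K (single p) y = (\<Sum>q\<in>UNIV. K p q * y q)"
proof -
  have "sesq K (single p) y = (\<Sum>q\<in>UNIV. \<Sum>r\<in>UNIV. (K r q * y q) * single p r)"
    unfolding sesq_def by (subst sum.swap) (simp add: mult_ac)
  then show ?thesis by (simp only: sum_single)
qed

lemma sesq_single: "sesq K (single p) (single q) = K p q"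
  by (simp add: sesq_single_left sum_single)

lemma posD: "pos K \<Longrightarrow> 0 \<le> sesq K x x"
  by (simp add: pos_def)

lemma posD_Re: "pos K \<Longrightarrow> 0 \<le> Re (sesq K x x)"
  using posD[of K x] by (simp add: less_eq_complex_def)

lemma posD_Im: "pos K \<Longrightarrow> Im (sesq K x x) = 0"
  using posD[of K x] by (simp add: less_eq_complex_def)

lemma sesq_expand:
  "sesq K (\<lambda>p. x p + c * y p) (\<lambda>p. x p + c * y p)
     = sesq K x x + c * sesq K x y + cnj c * sesq K y x + c * cnj c * sesq K y y"
  by (simp add: sesq_add_left sesq_add_right sesq_scale_left sesq_scale_right algebra_simps)

text \<open>Positivity speaks of diagonal values only. Those at \<open>x + y\<close> and
  \<open>x + \<i> y\<close> are real, and polarization turns this into the two halves of the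
  symmetry.\<close>

lemma pos_hermitian:
  assumes "pos K"
  shows "sesq K y x = cnj (sesq K x y)"
proof -
  have "Im (sesq K x x + c * sesq K x y + cnj c * sesq K y x + c * cnj c * sesq K y y) = 0" for c
    using posD_Im[OF assms, of "\<lambda>p. x p + c * y p"] unfolding sesq_expand .
  from this[of 1] this[of \<i>]
  have "Im (sesq K x y) + Im (sesq K y x) = 0" "Re (sesq K x y) - Re (sesq K y x) = 0"
    using posD_Im[OF assms, of x] posD_Im[OF assms, of y] by simp_all
  then show ?thesis by (simp add: complex_eq_iff)
qed

lemma pos_hermitian_entry: "pos K \<Longrightarrow> K q p = cnj (K p q)"
  using pos_hermitian[of K "single q" "single p"] by (simp add: sesq_single)

lemma pos_Cauchy_Schwarz:
  assumes "pos K"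
  shows "(cmod (sesq K x y))\<^sup>2 \<le> Re (sesq K x x) * Re (sesq K y y)"
proof -
  define a where "a = sesq K x y"
  define b where "b = Re (sesq K y y)"
  define d where "d = Re (sesq K x x)"
  have b: "sesq K y y = complex_of_real b" and b0: "0 \<le> b"
    using posD[OF assms, of y] by (auto simp: b_def complex_eq_iff less_eq_complex_def)
  have aa: "Re (a * cnj a) = (cmod a)\<^sup>2"
    by (metis complex_norm_square Re_complex_of_real)
  have key: "0 \<le> d + 2 * Re (c * a) + (cmod c)\<^sup>2 * b" for c
  proof -
    have "0 \<le> Re (sesq K x x + c * sesq K x y + cnj c * sesq K y x + c * cnj c * sesq K y y)"
      using posD_Re[OF assms, of "\<lambda>p. x p + c * y p"] unfolding sesq_expand .
    moreover have "cnj c * sesq K y x = cnj (c * a)"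
      by (simp add: pos_hermitian[OF assms, of y x] a_def)
    moreover have "c * cnj c * sesq K y y = complex_of_real ((cmod c)\<^sup>2 * b)"
      by (simp only: b of_real_mult complex_norm_square)
    ultimately show ?thesis by (simp add: a_def d_def)
  qed
  show ?thesis
  proof (cases "b = 0")
    case True
    have "a = 0"
    proof (rule ccontr)
      assume "a \<noteq> 0"
      \<comment> \<open>With \<open>b = 0\<close> and \<open>c = - t * cnj a\<close> the expression
        in \<open>key\<close> becomes \<open>d - 2 * (d + 1)\<close>, which is negative; the summand
        1 covers \<open>d = 0\<close>.\<close>
      define t where "t = (d + 1) / (cmod a)\<^sup>2"
      have "Re (complex_of_real (- t) * cnj a * a) = - t * (cmod a)\<^sup>2"
        using aa by (simp add: mult.assoc mult.commute[of "cnj a" a])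
      also have "\<dots> = - (d + 1)" using \<open>a \<noteq> 0\<close> by (simp add: t_def)
      finally have "0 \<le> d + 2 * (- (d + 1))"
        using key[of "complex_of_real (- t) * cnj a"] True by simp
      moreover have "0 \<le> d" using posD_Re[OF assms] by (simp add: d_def)
      ultimately show False by simp
    qed
    then show ?thesis using True by (simp add: a_def b_def)
  next
    case False
    then have bp: "0 < b" using b0 by simp
    have "Re (complex_of_real (- (1 / b)) * cnj a * a) = - ((cmod a)\<^sup>2 / b)"
      using aa by (simp add: mult.assoc mult.commute[of "cnj a" a])
    moreover have "(cmod (complex_of_real (- (1 / b)) * cnj a))\<^sup>2 * b = (cmod a)\<^sup>2 / b"
      using bp by (simp add: norm_mult power_mult_distrib power2_eq_square norm_divide)
    ultimately have "0 \<le> d + 2 * (- ((cmod a)\<^sup>2 / b)) + (cmod a)\<^sup>2 / b"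
      using key[of "complex_of_real (- (1 / b)) * cnj a"] by (simp only:)
    then have "(cmod a)\<^sup>2 \<le> d * b" using bp by (simp add: field_simps)
    then show ?thesis by (simp add: a_def b_def d_def)
  qed
qed

lemma pos_null:
  assumes "pos K" "Re (sesq K x x) = 0"
  shows "sesq K y x = 0" "sesq K x y = 0"
  using pos_Cauchy_Schwarz[OF assms(1), of y x] pos_Cauchy_Schwarz[OF assms(1), of x y] assms(2) by auto

lemma pos_outer: "pos (outer x)"
  unfolding pos_def sesq_outer_self by (simp add: less_eq_complex_def)

lemma pos_add: "pos K \<Longrightarrow> pos L \<Longrightarrow> pos (\<lambda>p q. K p q + L p q)"
  unfolding pos_def sesq_plus by (simp add: less_eq_complex_def)

lemma pos_sum_list: "(\<And>v. v \<in> set vs \<Longrightarrow> pos (F v)) \<Longrightarrow> pos (\<lambda>p q. \<Sum>v\<leftarrow>vs. F v p q)"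
proof (induction vs)
  case Nil
  then show ?case by (simp add: pos_def sesq_zero)
next
  case (Cons a vs)
  then show ?case using pos_add[of "F a" "\<lambda>p q. \<Sum>v\<leftarrow>vs. F v p q"] by simp
qed

lemma norm2_Cauchy_Schwarz: "(cmod (cdot x y))\<^sup>2 \<le> norm2 x * norm2 y"
proof -
  let ?K = "\<lambda>p q :: 'a. if p = q then 1 else 0 :: complex"
  have s: "sesq ?K u v = cdot u v" for u v using sesq_one[of 1 u v] by simp
  have "pos ?K" by (simp add: pos_def s cdot_self less_eq_complex_def)
  from pos_Cauchy_Schwarz[OF this, of x y] show ?thesis by (simp add: s cdot_self)
qed

section \<open>Schur complements and Cholesky factorization\<close>

definition pivot :: "('a \<Rightarrow> 'a \<Rightarrow> complex) \<Rightarrow> 'a \<Rightarrow> 'a \<Rightarrow> complex" where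
  "pivot K a p = K p a / complex_of_real (sqrt (Re (K a a)))"

definition schur :: "('a \<Rightarrow> 'a \<Rightarrow> complex) \<Rightarrow> 'a \<Rightarrow> 'a \<Rightarrow> 'a \<Rightarrow> complex" where
  "schur K a p q = K p q - outer (pivot K a) p q"

lemma pos_diag:
  assumes "pos K"
  shows "K a a = complex_of_real (Re (K a a))" "0 \<le> Re (K a a)"
  using posD[OF assms, of "single a"] by (auto simp: sesq_single less_eq_complex_def complex_eq_iff)

lemma pos_zero_pivot:
  assumes "pos K" "K a a = 0"
  shows "K a q = 0" "K q a = 0"
  using pos_null[OF assms(1), of "single a" "single q"] assms(2) by (simp_all add: sesq_single)

lemma outer_pivot:
  assumes "pos K"
  shows "outer (pivot K a) p q = K p a * K a q / K a a"
proof -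
  define r where "r = Re (K a a)"
  have r: "K a a = complex_of_real r" "0 \<le> r" using pos_diag[OF assms, of a] by (auto simp: r_def)
  have "complex_of_real (sqrt r) * complex_of_real (sqrt r) = complex_of_real r"
    using r(2) by (metis of_real_mult real_sqrt_mult_self abs_of_nonneg)
  then show ?thesis
    using pos_hermitian_entry[OF assms, of a q] by (simp add: outer_def pivot_def flip: r_def r(1))
qed

lemma schur_pivot_row:
  assumes "pos K"
  shows "schur K a a q = 0" "schur K a q a = 0"
  using pos_zero_pivot[OF assms, of a q]
  by (cases "K a a = 0"; simp add: schur_def outer_pivot[OF assms])+

text \<open>Removing the pivot lowers the form at \<open>x\<close> by the squared overlap of
  \<open>x\<close> with the basis vector \<open>a\<close>, divided by \<open>K a a\<close>.
  Cauchy--Schwarz says exactly that the form can afford this.\<close>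

lemma pos_schur:
  fixes K :: "'a::finite \<Rightarrow> 'a \<Rightarrow> complex"
  assumes "pos K"
  shows "pos (schur K a)"
  unfolding pos_def
proof
  fix x
  define r where "r = Re (K a a)"
  have r: "sesq K (single a) (single a) = complex_of_real r" "0 \<le> r"
    using pos_diag[OF assms, of a] by (auto simp: r_def sesq_single)
  have eq: "schur K a = (\<lambda>p q. K p q - outer (pivot K a) p q)" by (intro ext) (simp add: schur_def)
  have "cdot x (pivot K a) = sesq K x (single a) / complex_of_real (sqrt r)"
    by (simp add: cdot_def pivot_def sesq_single_right sum_divide_distrib r_def)
  then have "(cmod (cdot x (pivot K a)))\<^sup>2 = (cmod (sesq K x (single a)))\<^sup>2 / r"
    using r(2) by (simp add: norm_divide power_divide)
  also have "\<dots> \<le> Re (sesq K x x)"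
    using pos_Cauchy_Schwarz[OF assms, of x "single a"] r posD_Re[OF assms, of x]
    by (cases "r = 0") (simp_all add: field_simps)
  finally show "0 \<le> sesq (schur K a) x x"
    using posD_Im[OF assms, of x] by (simp add: eq sesq_minus sesq_outer_self less_eq_complex_def)
qed

text \<open>Iterated Schur complements (Cholesky). A vanishing pivot contributes the zero vector, as \<open>x / 0 = 0\<close>.\<close>

lemma pos_decomp_on:
  fixes K :: "'a::finite \<Rightarrow> 'a \<Rightarrow> complex"
  assumes "finite A" "pos K" "\<And>p q. p \<notin> A \<Longrightarrow> K p q = 0"
  shows "\<exists>vs. length vs = card A \<and> (\<forall>p q. K p q = (\<Sum>v\<leftarrow>vs. outer v p q)) \<and>
           ((\<forall>p q. Im (K p q) = 0) \<longrightarrow> (\<forall>v\<in>set vs. \<forall>p. Im (v p) = 0))"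
  using assms
proof (induction A arbitrary: K rule: finite_induct)
  case empty
  then show ?case by (intro exI[of _ "[]"]) auto
next
  case (insert a A)
  have "schur K a p q = 0" if "p \<notin> A" for p q
    using that insert.prems(2)[of p] schur_pivot_row(1)[OF insert.prems(1), of a q]
    by (cases "p = a") (auto simp: schur_def outer_pivot[OF insert.prems(1)])
  from insert.IH[OF pos_schur[OF insert.prems(1)] this] obtain vs where vs:
    "length vs = card A" "\<forall>p q. schur K a p q = (\<Sum>v\<leftarrow>vs. outer v p q)"
    "(\<forall>p q. Im (schur K a p q) = 0) \<longrightarrow> (\<forall>v\<in>set vs. \<forall>p. Im (v p) = 0)" by blast
  have re: "(\<forall>p. Im (pivot K a p) = 0) \<and> (\<forall>p q. Im (schur K a p q) = 0)" if "\<forall>p q. Im (K p q) = 0"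
  proof
    show "\<forall>p. Im (pivot K a p) = 0" using that by (simp add: pivot_def)
    then show "\<forall>p q. Im (schur K a p q) = 0" using that by (simp add: schur_def outer_def)
  qed
  show ?case
  proof (intro exI[of _ "pivot K a # vs"] conjI allI impI)
    show "length (pivot K a # vs) = card (insert a A)" using vs(1) insert.hyps by simp
    show "K p q = (\<Sum>v\<leftarrow>pivot K a # vs. outer v p q)" for p q
      using vs(2)[rule_format, of p q] by (simp add: schur_def diff_eq_eq add.commute)
    show "\<forall>v\<in>set (pivot K a # vs). \<forall>p. Im (v p) = 0" if "\<forall>p q. Im (K p q) = 0"
      using re[OF that] vs(3) by simp
  qed
qed

lemma pos_decomp:
  fixes K :: "'a::finite \<Rightarrow> 'a \<Rightarrow> complex"
  assumes "pos K"
  shows "\<exists>vs. length vs = CARD('a) \<and> (\<forall>p q. K p q = (\<Sum>v\<leftarrow>vs. outer v p q)) \<and>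
           ((\<forall>p q. Im (K p q) = 0) \<longrightarrow> (\<forall>v\<in>set vs. \<forall>p. Im (v p) = 0))"
  by (rule pos_decomp_on) (simp_all add: assms)


section \<open>Two-qubit kernels and the partial transpose\<close>

text \<open>The basis vector \<open>|ij>\<close> has the index \<open>(i, j)\<close> of type \<^typ>\<open>bool \<times> bool\<close>. A vector \<open>x\<close>
  also stands for the \<open>2 \<times> 2\<close> matrix with entries \<open>x (i, j)\<close>, and \<open>contraction x\<close> bounds its
  operator norm by 1, in a form that is symmetric under transposition.\<close>

type_synonym qq = "bool \<times> bool"

definition pt :: "(qq \<Rightarrow> qq \<Rightarrow> complex) \<Rightarrow> qq \<Rightarrow> qq \<Rightarrow> complex" where
  "pt K p q = K (fst p, snd q) (fst q, snd p)"

definition prodv :: "(bool \<Rightarrow> complex) \<Rightarrow> (bool \<Rightarrow> complex) \<Rightarrow> qq \<Rightarrow> complex" where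
  "prodv e f p = e (fst p) * f (snd p)"

definition cnjv :: "('a \<Rightarrow> complex) \<Rightarrow> 'a \<Rightarrow> complex" where
  "cnjv f i = cnj (f i)"

definition tr2 :: "('a::finite \<Rightarrow> 'a \<Rightarrow> complex) \<Rightarrow> ('a \<Rightarrow> 'a \<Rightarrow> complex) \<Rightarrow> complex" where
  "tr2 K L = (\<Sum>p\<in>UNIV. \<Sum>q\<in>UNIV. K p q * L q p)"

definition gap :: "('a::finite \<Rightarrow> 'a \<Rightarrow> complex) \<Rightarrow> 'a \<Rightarrow> 'a \<Rightarrow> complex" where
  "gap X p q = (if p = q then 1 / 2 else 0) - X p q"

text \<open>Two of the four constraints; the others follow by \<open>feas_le_one\<close> and
  \<open>feas_pt_ge\<close>. The same predicate describes the observables obtained by pulling a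
  maximally entangled projector back through a protocol.\<close>

definition feas :: "(qq \<Rightarrow> qq \<Rightarrow> complex) \<Rightarrow> bool" where
  "feas X \<longleftrightarrow> pos X \<and> pos (gap (pt X))"

text \<open>Bilinear, without conjugation, so that transposing the matrix merely exchanges the two
  arguments.\<close>

definition amp :: "(qq \<Rightarrow> complex) \<Rightarrow> (bool \<Rightarrow> complex) \<Rightarrow> (bool \<Rightarrow> complex) \<Rightarrow> complex" where
  "amp x e f = (\<Sum>i\<in>UNIV. \<Sum>j\<in>UNIV. e i * x (i, j) * f j)"

definition contraction :: "(qq \<Rightarrow> complex) \<Rightarrow> bool" where
  "contraction x \<longleftrightarrow> (\<forall>e f. (cmod (amp x e f))\<^sup>2 \<le> norm2 e * norm2 f)"

definition det2 :: "(qq \<Rightarrow> complex) \<Rightarrow> complex" where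
  "det2 x = x (False, False) * x (True, True) - x (False, True) * x (True, False)"

lemma qq_cases:
  obtains "p = (False, False)" | "p = (False, True)" | "p = (True, False)" | "p = (True, True)"
  by (cases p) auto

lemma sum_qq: "(\<Sum>p\<in>UNIV. f p) = (\<Sum>i\<in>UNIV. \<Sum>j\<in>UNIV. f (i :: 'a::finite, j :: 'b::finite))"
  by (simp add: sum.cartesian_product flip: UNIV_Times_UNIV)

lemma pt_pt [simp]: "pt (pt K) = K"
  by (intro ext) (simp add: pt_def)

lemma cnjv_cnjv [simp]: "cnjv (cnjv f) = f"
  by (simp add: cnjv_def[abs_def])

lemma norm2_cnjv [simp]: "norm2 (cnjv f) = norm2 f"
  by (simp add: norm2_def cnjv_def)

lemma norm2_prodv: "norm2 (prodv e f) = norm2 e * norm2 f"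
  by (simp add: norm2_def prodv_def sum_qq sum_product norm_mult power_mult_distrib)

lemma pt_sum_list: "pt (\<lambda>p q. \<Sum>v\<leftarrow>vs. F v p q) = (\<lambda>p q. \<Sum>v\<leftarrow>vs. pt (F v) p q)"
  by (intro ext) (simp add: pt_def)

text \<open>On product vectors the partial transpose exchanges the second factors of bra and ket and
  conjugates them. Statements about transposed kernels are reduced to original ones through this
  rule.\<close>

lemma sesq_pt_prodv: "sesq (pt K) (prodv e f) (prodv g h) = sesq K (prodv e (cnjv h)) (prodv g (cnjv f))"
  by (simp add: sesq_def pt_def prodv_def cnjv_def sum_qq UNIV_bool algebra_simps)

lemma pt_outer_prodv: "pt (outer (prodv e f)) = outer (prodv e (cnjv f))"
  by (intro ext) (simp add: pt_def outer_def prodv_def cnjv_def)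

lemma tr2_pt: "tr2 (pt K) L = tr2 K (pt L)"
  by (simp add: tr2_def pt_def sum_qq UNIV_bool)

lemma tr2_outer: "tr2 (outer x) L = sesq L x x"
  unfolding tr2_def sesq_def outer_def by (subst sum.swap) (simp add: mult_ac)

lemma tr2_plus: "tr2 (\<lambda>p q. K p q + L p q) M = tr2 K M + tr2 L M"
  by (simp add: tr2_def algebra_simps sum.distrib)

lemma tr2_sum_list: "tr2 (\<lambda>p q. \<Sum>v\<leftarrow>vs. F v p q) M = (\<Sum>v\<leftarrow>vs. tr2 (F v) M)"
  by (induction vs) (simp_all add: tr2_plus, simp add: tr2_def)

lemma sesq_gap: "sesq (gap X) x x = complex_of_real (norm2 x / 2) - sesq X x x"
proof -
  have "gap X = (\<lambda>p q. (if p = q then 1 / 2 else 0) - X p q)" by (intro ext) (simp add: gap_def)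
  then show ?thesis by (simp add: sesq_minus sesq_one cdot_self)
qed

lemma cdot_prodv: "cdot (prodv e f) x = amp x (cnjv e) (cnjv f)"
  by (simp add: cdot_def prodv_def amp_def sum_qq cnjv_def UNIV_bool algebra_simps)

section \<open>Splitting off product vectors\<close>

lemma product_of_det2_0:
  assumes "det2 x = 0"
  obtains e f where "x = prodv e f"
proof (cases "x (False, False) = 0 \<and> x (False, True) = 0")
  case True
  show ?thesis
  proof (rule that)
    show "x = prodv (\<lambda>i. if i then 1 else 0) (\<lambda>j. x (True, j))"
      using True by (auto simp: prodv_def fun_eq_iff) (metis (full_types))
  qed
next
  case False
  then obtain j where j: "x (False, j) \<noteq> 0" by (metis (full_types))
  have "x p = prodv (\<lambda>i. x (i, j) / x (False, j)) (\<lambda>k. x (False, k)) p" for p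
  proof (cases p)
    case (Pair i k)
    then show ?thesis using assms j
      by (cases i; cases j; cases k) (auto simp: prodv_def det2_def field_simps)
  qed
  then have "x = prodv (\<lambda>i. x (i, j) / x (False, j)) (\<lambda>k. x (False, k))" by (rule ext)
  then show ?thesis by (rule that)
qed

lemma quadratic_root:
  fixes a b c :: complex
  assumes "a \<noteq> 0"
  obtains z where "a * z\<^sup>2 + b * z + c = 0"
proof
  define z where "z = (- b + csqrt (b\<^sup>2 - 4 * a * c)) / (2 * a)"
  have "(2 * a * z + b)\<^sup>2 = b\<^sup>2 - 4 * a * c" using assms by (simp add: z_def)
  then have "4 * a * (a * z\<^sup>2 + b * z + c) = 0" by (simp add: power2_eq_square algebra_simps)
  then show "a * ((- b + csqrt (b\<^sup>2 - 4 * a * c)) / (2 * a))\<^sup>2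
      + b * ((- b + csqrt (b\<^sup>2 - 4 * a * c)) / (2 * a)) + c = 0"
    using assms by (simp add: z_def)
qed

text \<open>A suitable combination of two vectors is a product vector, because its determinant is a
  binary quadratic form over the complex numbers.\<close>

lemma split_product:
  obtains y e f where "\<And>p q. outer x1 p q + outer x2 p q = outer y p q + outer (prodv e f) p q"
proof -
  obtain c s :: complex where cs: "(cmod c)\<^sup>2 + (cmod s)\<^sup>2 = 1" "det2 (\<lambda>p. c * x1 p + s * x2 p) = 0"
  proof -
    have "\<exists>c s. c \<noteq> 0 \<and> det2 (\<lambda>p. s * x1 p + c * x2 p) = 0 \<or> s \<noteq> 0 \<and> det2 (\<lambda>p. s * x1 p + c * x2 p) = 0"
    proof (cases "det2 x2 = 0")
      case True
      then show ?thesis by (intro exI[of _ 1] exI[of _ 0]) simp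
    next
      case False
      \<comment> \<open>The coefficient of \<open>z\<close> is the polarization of the determinant,
        so the quadratic polynomial is the determinant of \<open>x1 + z x2\<close>.\<close>
      then obtain z where "det2 x2 * z\<^sup>2 + (x1 (False, False) * x2 (True, True) + x2 (False, False) * x1 (True, True)
          - x1 (False, True) * x2 (True, False) - x2 (False, True) * x1 (True, False)) * z + det2 x1 = 0"
        using quadratic_root by metis
      then have "det2 (\<lambda>p. 1 * x1 p + z * x2 p) = 0"
        by (simp add: det2_def power2_eq_square algebra_simps)
      then show ?thesis by (intro exI[of _ z] exI[of _ 1]) simp
    qed
    then obtain c s where *: "c \<noteq> 0 \<or> s \<noteq> 0" "det2 (\<lambda>p. c * x1 p + s * x2 p) = 0" by blast
    define n where "n = sqrt ((cmod c)\<^sup>2 + (cmod s)\<^sup>2)"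
    have n: "n\<^sup>2 = (cmod c)\<^sup>2 + (cmod s)\<^sup>2" "n \<noteq> 0"
      using *(1) sum_power2_eq_zero_iff[of "cmod c" "cmod s"] by (auto simp: n_def)
    show ?thesis
    proof (rule that)
      show "(cmod (c / complex_of_real n))\<^sup>2 + (cmod (s / complex_of_real n))\<^sup>2 = 1"
        using n *(1) by (simp add: norm_divide power_divide flip: add_divide_distrib)
      have "det2 (\<lambda>p. c / complex_of_real n * x1 p + s / complex_of_real n * x2 p)
          = det2 (\<lambda>p. c * x1 p + s * x2 p) / (complex_of_real n * complex_of_real n)"
        using n(2) by (simp add: det2_def field_simps)
      then show "det2 (\<lambda>p. c / complex_of_real n * x1 p + s / complex_of_real n * x2 p) = 0"
        using *(2) by simp
    qed
  qed
  obtain e f where ef: "(\<lambda>p. c * x1 p + s * x2 p) = prodv e f"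
    using product_of_det2_0[OF cs(2)] by blast
  have one: "c * cnj c + s * cnj s = 1"
  proof -
    have "c * cnj c + s * cnj s = complex_of_real ((cmod c)\<^sup>2 + (cmod s)\<^sup>2)"
      by (simp only: of_real_add complex_norm_square)
    then show ?thesis using cs(1) by simp
  qed
  show ?thesis
  proof (rule that)
    fix p q
    \<comment> \<open>The row \<open>(- cnj s, cnj c)\<close> completes \<open>(c, s)\<close> to a
      unitary matrix, and a unitary mixture of \<open>x1\<close> and \<open>x2\<close> leaves the
      sum of their projectors unchanged.\<close>
    have "outer (\<lambda>p. - cnj s * x1 p + cnj c * x2 p) p q + outer (\<lambda>p. c * x1 p + s * x2 p) p q
        = (c * cnj c + s * cnj s) * (outer x1 p q + outer x2 p q)"
      by (simp add: outer_def algebra_simps)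
    then show "outer x1 p q + outer x2 p q
        = outer (\<lambda>p. - cnj s * x1 p + cnj c * x2 p) p q + outer (prodv e f) p q"
      by (simp add: one ef)
  qed
qed

lemma outer_list_split:
  "\<exists>y efs. \<forall>p q. (\<Sum>v\<leftarrow>vs. outer v p q) = outer y p q + (\<Sum>(e, f)\<leftarrow>efs. outer (prodv e f) p q)"
proof (induction vs)
  case Nil
  show ?case by (intro exI[of _ "\<lambda>_. 0"] exI[of _ "[]"]) (simp add: outer_def)
next
  case (Cons v vs)
  then obtain y efs where
    IH: "\<forall>p q. (\<Sum>v\<leftarrow>vs. outer v p q) = outer y p q + (\<Sum>(e, f)\<leftarrow>efs. outer (prodv e f) p q)" by blast
  obtain y' e f where "\<And>p q. outer v p q + outer y p q = outer y' p q + outer (prodv e f) p q"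
    using split_product[of v y] by blast
  then show ?case using IH
    by (intro exI[of _ y'] exI[of _ "(e, f) # efs"]) (simp add: add.assoc[symmetric])
qed

lemma pos_split:
  assumes "pos K"
  obtains y efs where "K = (\<lambda>p q. outer y p q + (\<Sum>(e, f)\<leftarrow>efs. outer (prodv e f) p q))"
proof -
  obtain vs where vs: "\<forall>p q. K p q = (\<Sum>v\<leftarrow>vs. outer v p q)" using pos_decomp[OF assms] by blast
  obtain y efs where
    "\<forall>p q. (\<Sum>v\<leftarrow>vs. outer v p q) = outer y p q + (\<Sum>(e, f)\<leftarrow>efs. outer (prodv e f) p q)"
    using outer_list_split[of vs] by blast
  with vs show ?thesis by (intro that[of y efs]) (simp add: fun_eq_iff)
qed

text \<open>Cauchy--Schwarz for the decomposition \<open>|0> f\<^sub>0 + |1> f\<^sub>1\<close> shows that the remaining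
  constraints of the semidefinite program are implied.\<close>

definition slice :: "bool \<Rightarrow> (qq \<Rightarrow> complex) \<Rightarrow> bool \<Rightarrow> complex" where
  "slice i x j = x (i, j)"

lemma slices: "x = (\<lambda>p. prodv (single False) (slice False x) p + prodv (single True) (slice True x) p)"
  by (auto simp: fun_eq_iff prodv_def single_def slice_def)

lemma norm2_single [simp]: "norm2 (single p) = 1"
proof -
  have "norm2 (single p) = (\<Sum>q\<in>UNIV. if q = p then 1 else 0)"
    unfolding norm2_def by (intro sum.cong) (auto simp: single_def)
  then show ?thesis by simp
qed

lemma norm2_slices: "norm2 x = norm2 (slice False x) + norm2 (slice True x)"
  by (simp add: norm2_def sum_qq UNIV_bool slice_def)

lemma feas_product_bound:
  assumes "feas X"
  shows "Re (sesq X (prodv e f) (prodv e f)) \<le> norm2 e * norm2 f / 2"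
proof -
  have "0 \<le> Re (sesq (gap (pt X)) (prodv e (cnjv f)) (prodv e (cnjv f)))"
    using assms by (intro posD_Re) (simp add: feas_def)
  then show ?thesis by (simp add: sesq_gap sesq_pt_prodv norm2_prodv)
qed

text \<open>Cauchy--Schwarz bounds the off-diagonal value by the geometric mean of the diagonal
  ones. The arithmetic mean dominates it and is controlled by
  \<open>feas_product_bound\<close>.\<close>

lemma feas_cross_bound:
  assumes "feas X"
  shows "2 * cmod (sesq X (prodv e f) (prodv g h)) \<le> norm2 e * norm2 f / 2 + norm2 g * norm2 h / 2"
proof -
  define a where "a = Re (sesq X (prodv e f) (prodv e f))"
  define b where "b = Re (sesq X (prodv g h) (prodv g h))"
  define c where "c = cmod (sesq X (prodv e f) (prodv g h))"
  have "pos X" using assms by (simp add: feas_def)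
  then have *: "0 \<le> a" "0 \<le> b" "c\<^sup>2 \<le> a * b"
    using posD_Re pos_Cauchy_Schwarz unfolding a_def b_def c_def by blast+
  have "(2 * c)\<^sup>2 \<le> (a + b)\<^sup>2"
  proof -
    have "(a + b)\<^sup>2 = (a - b)\<^sup>2 + 4 * (a * b)" by (simp add: power2_eq_square algebra_simps)
    moreover have "(2 * c)\<^sup>2 = 4 * c\<^sup>2" by (simp add: power_mult_distrib)
    ultimately show ?thesis using *(3) zero_le_power2[of "a - b"] by linarith
  qed
  then have "2 * c \<le> a + b" using * by (intro power2_le_imp_le[of "2 * c"]) auto
  then show ?thesis
    using feas_product_bound[OF assms, of e f] feas_product_bound[OF assms, of g h]
    by (simp add: a_def b_def c_def)
qed

text \<open>Both slices give product vectors. The diagonal terms contribute at most half of the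
  squared norm and the cross terms the other half, hence the constant 1.\<close>

lemma feas_le_one:
  assumes "feas X"
  shows "Re (sesq X x x) \<le> norm2 x"
proof -
  define u where "u = prodv (single False) (slice False x)"
  define v where "v = prodv (single True) (slice True x)"
  have her: "sesq X v u = cnj (sesq X u v)"
    using assms by (intro pos_hermitian) (simp add: feas_def)
  have x: "x = (\<lambda>p. u p + v p)" unfolding u_def v_def by (rule slices)
  have "sesq X x x = sesq X u u + sesq X u v + sesq X v u + sesq X v v"
    by (subst (1 2) x) (simp add: sesq_add_left sesq_add_right)
  then have "Re (sesq X x x) = Re (sesq X u u) + 2 * Re (sesq X u v) + Re (sesq X v v)"
    by (simp add: her)
  also have "\<dots> \<le> Re (sesq X u u) + 2 * cmod (sesq X u v) + Re (sesq X v v)"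
    using complex_Re_le_cmod[of "sesq X u v"] by linarith
  also have "\<dots> \<le> norm2 x"
    using feas_cross_bound[OF assms, of "single False" "slice False x" "single True" "slice True x"]
      feas_product_bound[OF assms, of "single False" "slice False x"]
      feas_product_bound[OF assms, of "single True" "slice True x"]
    by (simp add: u_def v_def norm2_slices)
  finally show ?thesis .
qed

text \<open>Under the partial transpose the diagonal terms of the two slices stay nonnegative. Only
  the cross term can be negative; it is a cross term of \<open>X\<close> with the slices
  exchanged.\<close>

lemma feas_pt_ge:
  assumes "feas X"
  shows "- (norm2 x / 2) \<le> Re (sesq (pt X) x x)"
proof -
  define u where "u = prodv (single False) (slice False x)"
  define v where "v = prodv (single True) (slice True x)"
  have X: "pos X" using assms by (simp add: feas_def)
  have uu: "sesq (pt X) u u = sesq X (prodv (single False) (cnjv (slice False x))) (prodv (single False) (cnjv (slice False x)))"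
   and vv: "sesq (pt X) v v = sesq X (prodv (single True) (cnjv (slice True x))) (prodv (single True) (cnjv (slice True x)))"
   and uv: "sesq (pt X) u v = sesq X (prodv (single False) (cnjv (slice True x))) (prodv (single True) (cnjv (slice False x)))"
    by (simp_all add: u_def v_def sesq_pt_prodv)
  have vu: "sesq (pt X) v u = cnj (sesq (pt X) u v)"
    unfolding uv by (subst pos_hermitian[OF X, symmetric]) (simp add: u_def v_def sesq_pt_prodv)
  have x: "x = (\<lambda>p. u p + v p)" unfolding u_def v_def by (rule slices)
  have "sesq (pt X) x x = sesq (pt X) u u + sesq (pt X) u v + sesq (pt X) v u + sesq (pt X) v v"
    by (subst (1 2) x) (simp add: sesq_add_left sesq_add_right)
  then have "Re (sesq (pt X) x x) = Re (sesq (pt X) u u) + 2 * Re (sesq (pt X) u v) + Re (sesq (pt X) v v)"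
    by (simp add: vu)
  moreover have "0 \<le> Re (sesq (pt X) u u)" "0 \<le> Re (sesq (pt X) v v)"
    unfolding uu vv using posD_Re[OF X] by blast+
  moreover have "- cmod (sesq (pt X) u v) \<le> Re (sesq (pt X) u v)"
    using abs_Re_le_cmod[of "sesq (pt X) u v"] by linarith
  moreover have "2 * cmod (sesq (pt X) u v) \<le> norm2 x / 2"
    using feas_cross_bound[OF assms, of "single False" "cnjv (slice True x)" "single True" "cnjv (slice False x)"]
    by (simp add: uv norm2_slices field_simps)
  ultimately show ?thesis by linarith
qed

text \<open>The map from \<open>X\<close> to \<open>I / 2 - X\<^sup>\<Gamma>\<close> is an
  involution that exchanges the two conditions. It links pulled-back observables with points of the
  program.\<close>

lemma feas_dual:
  assumes "feas X"
  shows "feas (gap (pt X))"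
proof -
  have "pt (gap (pt X)) = gap X"
    by (intro ext) (auto simp: pt_def gap_def prod_eq_iff)
  moreover have "gap (gap X) = X" by (intro ext) (simp add: gap_def)
  ultimately show ?thesis using assms by (simp add: feas_def)
qed

section \<open>Rank-one feasible points are contractions\<close>

text \<open>The Hilbert--Schmidt norm dominates the operator norm, so any nonzero vector can be
  scaled into the set of contractions.\<close>

lemma amp_Cauchy_Schwarz: "(cmod (amp x e f))\<^sup>2 \<le> norm2 x * (norm2 e * norm2 f)"
  using norm2_Cauchy_Schwarz[of "prodv (cnjv e) (cnjv f)" x]
  by (simp add: cdot_prodv norm2_prodv mult.commute)

lemma amp_scale: "amp (\<lambda>p. c * x p) e f = c * amp x e f"
  by (simp add: amp_def sum_distrib_left algebra_simps)

text \<open>Taking for \<open>e\<close> the conjugate of the image of \<open>f\<close> converts the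
  bilinear bound into the usual bound on images.\<close>

lemma contraction_row:
  assumes "contraction x"
  shows "norm2 (\<lambda>i. \<Sum>j\<in>UNIV. x (i, j) * f j) \<le> norm2 f"
proof -
  define g where "g i = (\<Sum>j\<in>UNIV. x (i, j) * f j)" for i
  have "amp x (cnjv g) f = cdot g g"
    by (simp add: amp_def cdot_def g_def cnjv_def sum_distrib_left mult.assoc)
  then have "(norm2 g)\<^sup>2 \<le> norm2 g * norm2 f"
    using assms[unfolded contraction_def, rule_format, of "cnjv g" f] by (simp add: cdot_self)
  then have "norm2 g \<le> norm2 f"
    by (cases "norm2 g = 0") (auto simp: power2_eq_square order_less_le)
  then show ?thesis by (simp add: g_def[abs_def])
qed

definition transp :: "(qq \<Rightarrow> complex) \<Rightarrow> qq \<Rightarrow> complex" where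
  "transp x p = x (snd p, fst p)"

lemma amp_transp: "amp (transp x) e f = amp x f e"
  by (simp add: amp_def transp_def UNIV_bool algebra_simps)

lemma contraction_transp: "contraction x \<Longrightarrow> contraction (transp x)"
  unfolding contraction_def amp_transp by (metis mult.commute)

lemma contraction_cnjv: 
  assumes "contraction x"
  shows "contraction (cnjv x)"
  unfolding contraction_def
proof (intro allI)
  fix e f
  have "amp (cnjv x) e f = cnj (amp x (cnjv e) (cnjv f))"
    by (simp add: amp_def cnjv_def)
  then show "(cmod (amp (cnjv x) e f))\<^sup>2 \<le> norm2 e * norm2 f"
    using assms[unfolded contraction_def, rule_format, of "cnjv e" "cnjv f"] by simp
qed

text \<open>With \<open>N = x\<^sup>\<dagger> z\<close>, the form of \<open>(xx\<^sup>\<dagger>)\<^sup>\<Gamma>\<close> at \<open>z\<close> is the pairing of \<open>N\<close> with its own adjoint.\<close>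

lemma sesq_pt_outer:
  "sesq (pt (outer x)) z z = (\<Sum>j\<in>UNIV. \<Sum>l\<in>UNIV. cnj (\<Sum>i\<in>UNIV. cnj (x (i, l)) * z (i, j)) * (\<Sum>i\<in>UNIV. cnj (x (i, j)) * z (i, l)))"
  by (simp add: sesq_def pt_def outer_def sum_qq UNIV_bool algebra_simps)

text \<open>The inequality between geometric and arithmetic means, applied to \<open>N j l\<close>
  and \<open>N l j\<close>, leaves the Hilbert--Schmidt norm of \<open>N\<close>, which is bounded
  column by column because the adjoint of \<open>x\<close> is a contraction too.\<close>

lemma contraction_pt_bound:
  assumes "contraction x"
  shows "cmod (sesq (pt (outer x)) z z) \<le> norm2 z"
proof -
  define N where "N j l = (\<Sum>i\<in>UNIV. cnj (x (i, j)) * z (i, l))" for j l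
  have col: "(\<Sum>j\<in>UNIV. (cmod (N j l))\<^sup>2) \<le> (\<Sum>i\<in>UNIV. (cmod (z (i, l)))\<^sup>2)" for l
    using contraction_row[OF contraction_transp[OF contraction_cnjv[OF assms]], of "\<lambda>i. z (i, l)"]
    by (simp add: norm2_def N_def transp_def cnjv_def)
  have "cmod (sesq (pt (outer x)) z z) = cmod (\<Sum>j\<in>UNIV. \<Sum>l\<in>UNIV. cnj (N l j) * N j l)"
    by (simp add: sesq_pt_outer N_def)
  also have "\<dots> \<le> (\<Sum>j\<in>UNIV. \<Sum>l\<in>UNIV. cmod (cnj (N l j) * N j l))"
    by (intro sum_norm_le order_refl)
  also have "\<dots> \<le> (\<Sum>j\<in>UNIV. \<Sum>l\<in>UNIV. ((cmod (N l j))\<^sup>2 + (cmod (N j l))\<^sup>2) / 2)"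
  proof (intro sum_mono)
    fix j l
    have "0 \<le> (cmod (N l j) - cmod (N j l))\<^sup>2" by simp
    then show "cmod (cnj (N l j) * N j l) \<le> ((cmod (N l j))\<^sup>2 + (cmod (N j l))\<^sup>2) / 2"
      by (simp add: norm_mult power2_eq_square algebra_simps)
  qed
  also have "\<dots> = (\<Sum>l\<in>UNIV. \<Sum>j\<in>UNIV. (cmod (N j l))\<^sup>2)"
    by (simp add: UNIV_bool field_simps)
  also have "\<dots> \<le> (\<Sum>l\<in>UNIV. \<Sum>i\<in>UNIV. (cmod (z (i, l)))\<^sup>2)"
    by (intro sum_mono col)
  also have "\<dots> = norm2 z" by (simp add: norm2_def sum_qq UNIV_bool)
  finally show ?thesis .
qed

text \<open>Product vectors already detect the operator norm, which gives one direction; the other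
  is \<open>contraction_pt_bound\<close>. The factor \<open>1 / sqrt 2\<close> is the normalization
  of \<open>bell\<close>, so \<open>y\<close> itself will be the filter.\<close>

lemma feas_outer_iff:
  "feas (outer (\<lambda>p. y p / complex_of_real (sqrt 2))) \<longleftrightarrow> contraction y"
proof -
  let ?y = "\<lambda>p. y p / complex_of_real (sqrt 2)"
  have half: "outer ?y p q = 1 / 2 * outer y p q" for p q
  proof -
    have "complex_of_real (sqrt 2) * complex_of_real (sqrt 2) = 2"
      by (metis of_real_mult real_sqrt_mult_self abs_numeral of_real_numeral)
    then show ?thesis by (simp add: outer_def)
  qed
  have s: "sesq (pt (outer ?y)) z z = 1 / 2 * sesq (pt (outer y)) z z" for z
  proof -
    have "pt (outer ?y) = (\<lambda>p q. 1 / 2 * pt (outer y) p q)"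
      by (intro ext) (simp only: pt_def half)
    then show ?thesis by (simp only: sesq_scale)
  qed
  have im: "Im (sesq (pt (outer y)) z z) = 0" for z
  proof -
    have "sesq (pt (outer y)) z z = cnj (sesq (pt (outer y)) z z)"
      by (simp add: sesq_def pt_def outer_def sum_qq UNIV_bool algebra_simps)
    then show ?thesis by (simp add: complex_eq_iff)
  qed
  show ?thesis
  proof
    assume f: "feas (outer ?y)"
    show "contraction y"
      unfolding contraction_def
    proof (intro allI)
      fix e f :: "bool \<Rightarrow> complex"
      have "0 \<le> Re (sesq (gap (pt (outer ?y))) (prodv (cnjv e) f) (prodv (cnjv e) f))"
        using f by (intro posD_Re) (simp add: feas_def)
      moreover have "sesq (pt (outer y)) (prodv (cnjv e) f) (prodv (cnjv e) f) = complex_of_real ((cmod (amp y e f))\<^sup>2)"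
        by (simp add: sesq_pt_prodv sesq_outer_self cdot_prodv)
      ultimately show "(cmod (amp y e f))\<^sup>2 \<le> norm2 e * norm2 f"
        by (simp only: sesq_gap s) (simp add: norm2_prodv)
    qed
  next
    assume c: "contraction y"
    have "Re (sesq (pt (outer y)) z z) \<le> norm2 z" for z
      using contraction_pt_bound[OF c, of z] complex_Re_le_cmod order_trans by blast
    then have "pos (gap (pt (outer ?y)))"
      by (simp add: pos_def sesq_gap s less_eq_complex_def im)
    then show "feas (outer ?y)" by (simp add: feas_def pos_outer)
  qed
qed


section \<open>Uniqueness of the optimal solution\<close>

lemma linear_term_vanishes:
  fixes B D \<delta> :: real
  assumes "0 < \<delta>" "\<And>t. \<bar>t\<bar> \<le> \<delta> \<Longrightarrow> 0 \<le> 2 * t * B + t\<^sup>2 * D"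
  shows "B = 0"
proof (rule ccontr)
  assume B: "B \<noteq> 0"
  \<comment> \<open>Small enough for the linear term to beat the quadratic one; the summand 1 guards
    against \<open>D = 0\<close>.\<close>
  define \<epsilon> where "\<epsilon> = min \<delta> (\<bar>B\<bar> / (\<bar>D\<bar> + 1))"
  have e: "0 < \<epsilon>" "\<epsilon> \<le> \<delta>" using assms(1) B by (auto simp: \<epsilon>_def)
  have "\<epsilon> \<le> \<bar>B\<bar> / (\<bar>D\<bar> + 1)" by (simp add: \<epsilon>_def)
  then have "\<epsilon> * (\<bar>D\<bar> + 1) \<le> \<bar>B\<bar>" by (simp add: pos_le_divide_eq)
  then have eD: "\<epsilon> * \<bar>D\<bar> < 2 * \<bar>B\<bar>" using e B by (simp add: algebra_simps)
  have "0 \<le> 2 * (- sgn B * \<epsilon>) * B + (- sgn B * \<epsilon>)\<^sup>2 * D"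
    using B e by (intro assms(2)) (simp add: abs_mult)
  also have "\<dots> = \<epsilon> * (\<epsilon> * D - 2 * \<bar>B\<bar>)"
    using B by (simp add: power2_eq_square algebra_simps sgn_if)
  finally have "0 \<le> \<epsilon> * D - 2 * \<bar>B\<bar>" using e by (simp add: zero_le_mult_iff)
  then show False using eD e by (smt (verit) abs_ge_self mult_left_mono)
qed

text \<open>For real \<open>s\<close> between 0 and 1 this is the normal form, in Schmidt bases, of
  a matrix of operator norm 1.\<close>

definition diag2 :: "complex \<Rightarrow> qq \<Rightarrow> complex" where
  "diag2 s p = (if p = (False, False) then 1 else if p = (True, True) then s else 0)"

definition lower_bound :: "(qq \<Rightarrow> qq \<Rightarrow> complex) \<Rightarrow> real \<Rightarrow> bool" where
  "lower_bound S q \<longleftrightarrow> (\<forall>x. contraction x \<longrightarrow> q \<le> Re (sesq S x x))"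

lemma Re_sesq_scale: "Re (sesq K (\<lambda>p. c * x p) (\<lambda>p. c * x p)) = (cmod c)\<^sup>2 * Re (sesq K x x)"
proof -
  have "sesq K (\<lambda>p. c * x p) (\<lambda>p. c * x p) = complex_of_real ((cmod c)\<^sup>2) * sesq K x x"
    by (simp add: sesq_scale_left sesq_scale_right complex_norm_square mult_ac del: of_real_power)
  then show ?thesis by simp
qed

text \<open>\<open>N\<close> bounds the squared operator norm. The form is quadratic, so dividing
  \<open>x\<close> by \<open>sqrt N\<close> produces a contraction and divides the value by
  \<open>N\<close>.\<close>

lemma lower_boundD_scaled:
  assumes "lower_bound S q" "0 < N" "\<And>e f. (cmod (amp x e f))\<^sup>2 \<le> N * (norm2 e * norm2 f)"
  shows "N * q \<le> Re (sesq S x x)"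
proof -
  define c where "c = complex_of_real (1 / sqrt N)"
  have c: "(cmod c)\<^sup>2 = 1 / N"
    using assms(2) by (simp add: c_def norm_divide power_divide)
  have "contraction (\<lambda>p. c * x p)"
    using assms(2,3) by (simp add: contraction_def amp_scale norm_mult power_mult_distrib c field_simps)
  then have "q \<le> 1 / N * Re (sesq S x x)"
    using assms(1) unfolding lower_bound_def by (metis Re_sesq_scale c)
  then show ?thesis using assms(2) by (simp add: field_simps)
qed

lemma norm2_bool: "norm2 e = (cmod (e False))\<^sup>2 + (cmod (e True))\<^sup>2"
  by (simp add: norm2_def UNIV_bool)

lemma two_term_bound:
  fixes a b c d :: complex
  shows "(cmod (a * b + c * d))\<^sup>2 \<le> ((cmod a)\<^sup>2 + (cmod c)\<^sup>2) * ((cmod b)\<^sup>2 + (cmod d)\<^sup>2)"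
proof -
  have "cdot (\<lambda>i. if i then cnj c else cnj a) (\<lambda>i. if i then d else b) = a * b + c * d"
    by (simp add: cdot_def UNIV_bool)
  then show ?thesis
    using norm2_Cauchy_Schwarz[of "\<lambda>i. if i then cnj c else cnj a" "\<lambda>i. if i then d else b"]
    by (simp add: norm2_bool)
qed

text \<open>The entry \<open>r\<close> is moved along \<open>z\<close>, the gradient of the form in
  that entry, so the value changes by \<open>2 t |z|^2\<close> to first order. If the squared norm
  grows only by \<open>C t^2\<close>, rescaling costs nothing at first order and \<open>z\<close>
  must vanish.\<close>

lemma stationary:
  assumes herm: "\<And>x y. sesq S y x = cnj (sesq S x y)"
    and min: "lower_bound S (Re (sesq S y y))" and "0 < \<delta>" and C: "0 \<le> C"
    and le: "\<And>t e f. \<bar>t\<bar> \<le> \<delta> \<Longrightarrow>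
      (cmod (amp (\<lambda>p. y p + complex_of_real t * sesq S (single r) y * single r p) e f))\<^sup>2
        \<le> (1 + C * t\<^sup>2) * (norm2 e * norm2 f)"
  shows "sesq S (single r) y = 0"
proof -
  let ?q = "Re (sesq S y y)"
  define z where "z = sesq S (single r) y"
  define D where "D = (cmod z)\<^sup>2 * Re (S r r) - C * ?q"
  have "(cmod z)\<^sup>2 = 0"
  proof (rule linear_term_vanishes[OF \<open>0 < \<delta>\<close>])
    fix t :: real
    assume t: "\<bar>t\<bar> \<le> \<delta>"
    let ?x = "\<lambda>p. y p + (complex_of_real t * z) * single r p"
    have "0 < 1 + C * t\<^sup>2" using C by (simp add: add_pos_nonneg)
    then have "(1 + C * t\<^sup>2) * ?q \<le> Re (sesq S ?x ?x)"
      using lower_boundD_scaled[OF min] le[OF t] unfolding z_def by blast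
    also have "Re (sesq S ?x ?x) = ?q + 2 * t * (cmod z)\<^sup>2 + t\<^sup>2 * ((cmod z)\<^sup>2 * Re (S r r))"
    proof -
      have zz: "z * cnj z = complex_of_real ((cmod z)\<^sup>2)" by (simp only: complex_norm_square)
      have 1: "complex_of_real t * z * sesq S y (single r) = complex_of_real (t * (cmod z)\<^sup>2)"
        unfolding herm[of y "single r"] z_def[symmetric]
        by (simp add: mult.assoc zz del: of_real_power)
      have 2: "cnj (complex_of_real t * z) * sesq S (single r) y = complex_of_real (t * (cmod z)\<^sup>2)"
        using zz unfolding z_def[symmetric] by (simp add: mult.assoc mult.commute[of "cnj z"] del: of_real_power)
      have 3: "complex_of_real t * z * cnj (complex_of_real t * z) = complex_of_real (t\<^sup>2 * (cmod z)\<^sup>2)"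
        using zz by (simp add: power2_eq_square mult_ac del: of_real_power)
      show ?thesis
        unfolding sesq_expand 1 2 3 sesq_single by simp
    qed
    finally show "0 \<le> 2 * t * (cmod z)\<^sup>2 + t\<^sup>2 * D" by (simp add: D_def algebra_simps)
  qed
  then show ?thesis by (simp add: z_def)
qed

text \<open>For a matrix with first row (1, 0) the amplitude has this shape, with \<open>g\<close>
  the second row applied to \<open>f\<close>.\<close>

lemma lower_triangular_bound:
  "(cmod (e False * f False + e True * g))\<^sup>2 \<le> norm2 e * ((cmod (f False))\<^sup>2 + (cmod g)\<^sup>2)"
  using two_term_bound[of "e False" "f False" "e True" g] by (simp add: norm2_bool)

text \<open>As \<open>|s| < 1\<close>, the corner entry can move in every direction without leaving
  the unit ball, so the norm does not grow and \<open>C = 0\<close>. The step length is limited by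
  the room \<open>1 - |s|\<close>.\<close>

lemma stationary_corner:
  assumes herm: "\<And>x y. sesq S y x = cnj (sesq S x y)"
    and min: "lower_bound S (Re (sesq S (diag2 s) (diag2 s)))" and s: "cmod s < 1"
  shows "sesq S (single (True, True)) (diag2 s) = 0"
proof -
  define z where "z = sesq S (single (True, True)) (diag2 s)"
  show ?thesis
  proof (rule stationary[OF herm min, of "(1 - cmod s) / (cmod z + 1)" 0])
    show "0 < (1 - cmod s) / (cmod z + 1)" using s by (simp add: add_nonneg_pos)
    fix t :: real and e f
    assume t: "\<bar>t\<bar> \<le> (1 - cmod s) / (cmod z + 1)"
    have "\<bar>t\<bar> * cmod z \<le> \<bar>t\<bar> * (cmod z + 1)" by (intro mult_left_mono) auto
    also have "\<dots> \<le> 1 - cmod s" using t by (simp add: pos_le_divide_eq add_nonneg_pos)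
    finally have tz: "cmod (s + complex_of_real t * z) \<le> 1"
      using norm_triangle_ineq[of s "complex_of_real t * z"] by (simp add: norm_mult)
    let ?x = "\<lambda>p. diag2 s p + (complex_of_real t * z) * single (True, True) p"
    have "amp ?x e f = e False * f False + e True * ((s + complex_of_real t * z) * f True)"
      by (simp add: amp_def UNIV_bool diag2_def single_def algebra_simps)
    then have "(cmod (amp ?x e f))\<^sup>2 \<le> norm2 e * ((cmod (f False))\<^sup>2 + (cmod ((s + complex_of_real t * z) * f True))\<^sup>2)"
      by (metis lower_triangular_bound)
    also have "\<dots> \<le> norm2 e * norm2 f"
    proof -
      have "(cmod (s + complex_of_real t * z) * cmod (f True))\<^sup>2 \<le> (1 * cmod (f True))\<^sup>2"
        using tz by (intro power_mono mult_right_mono) auto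
      then show ?thesis by (intro mult_left_mono) (simp_all add: norm2_bool norm_mult)
    qed
    finally show "(cmod (amp (\<lambda>p. diag2 s p + complex_of_real t * sesq S (single (True, True)) (diag2 s) * single (True, True) p) e f))\<^sup>2
        \<le> (1 + 0 * t\<^sup>2) * (norm2 e * norm2 f)" by (simp add: z_def)
  qed simp
qed

text \<open>An entry below the diagonal changes the operator norm of \<open>diag (1, s)\<close> only to second order.\<close>

lemma stationary_lower:
  assumes herm: "\<And>x y. sesq S y x = cnj (sesq S x y)"
    and min: "lower_bound S (Re (sesq S (diag2 s) (diag2 s)))" and s: "cmod s < 1"
  shows "sesq S (single (True, False)) (diag2 s) = 0"
proof -
  define z where "z = sesq S (single (True, False)) (diag2 s)"
  define C where "C = (cmod z)\<^sup>2 / (1 - (cmod s)\<^sup>2)"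
  have s2: "(cmod s)\<^sup>2 < 1" using s by (simp add: power_less_one_iff)
  then have C: "0 \<le> C" by (simp add: C_def)
  show ?thesis
  proof (rule stationary[OF herm min, of 1 C])
    fix t :: real and e f
    let ?x = "\<lambda>p. diag2 s p + (complex_of_real t * z) * single (True, False) p"
    let ?w = "complex_of_real t * z * f False"
    \<comment> \<open>The row \<open>(r, s)\<close> has norm 1. Writing the perturbation
      \<open>w\<close> as \<open>r * (w / r)\<close>, Cauchy--Schwarz gives
      \<open>|w + s f|^2 \<le> |w / r|^2 + |f|^2\<close>, where the first term is quadratic in
      \<open>t\<close>.\<close>
    define r where "r = sqrt (1 - (cmod s)\<^sup>2)"
    have r: "r\<^sup>2 = 1 - (cmod s)\<^sup>2" "r \<noteq> 0" using s2 by (auto simp: r_def)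
    have "?w = complex_of_real r * (?w / complex_of_real r)" using r(2) by simp
    then have "(cmod (?w + s * f True))\<^sup>2
        \<le> ((cmod (complex_of_real r))\<^sup>2 + (cmod s)\<^sup>2) * ((cmod (?w / complex_of_real r))\<^sup>2 + (cmod (f True))\<^sup>2)"
      by (metis two_term_bound)
    also have "\<dots> = (cmod (?w / complex_of_real r))\<^sup>2 + (cmod (f True))\<^sup>2" using r(1) by simp
    also have "(cmod (?w / complex_of_real r))\<^sup>2 = C * t\<^sup>2 * (cmod (f False))\<^sup>2"
      using r(1) by (simp add: norm_mult norm_divide power_mult_distrib power_divide C_def)
    finally have *: "(cmod (?w + s * f True))\<^sup>2 \<le> C * t\<^sup>2 * (cmod (f False))\<^sup>2 + (cmod (f True))\<^sup>2" .
    have "amp ?x e f = e False * f False + e True * (?w + s * f True)"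
      by (simp add: amp_def UNIV_bool diag2_def single_def algebra_simps)
    then have "(cmod (amp ?x e f))\<^sup>2 \<le> norm2 e * ((cmod (f False))\<^sup>2 + (cmod (?w + s * f True))\<^sup>2)"
      by (metis lower_triangular_bound)
    also have "\<dots> \<le> norm2 e * ((1 + C * t\<^sup>2) * norm2 f)"
    proof (intro mult_left_mono)
      have "0 \<le> C * t\<^sup>2 * (cmod (f True))\<^sup>2" using C by simp
      then show "(cmod (f False))\<^sup>2 + (cmod (?w + s * f True))\<^sup>2 \<le> (1 + C * t\<^sup>2) * norm2 f"
        using * by (simp add: norm2_bool algebra_simps)
    qed simp
    finally show "(cmod (amp (\<lambda>p. diag2 s p + complex_of_real t * sesq S (single (True, False)) (diag2 s) * single (True, False) p) e f))\<^sup>2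
        \<le> (1 + C * t\<^sup>2) * (norm2 e * norm2 f)" by (simp add: z_def mult_ac)
  qed (use C in simp_all)
qed

section \<open>Kernel vectors against stationarity at the Schmidt form\<close>

lemma pos_pt_hermitian:
  assumes "pos K"
  shows "sesq (pt K) y x = cnj (sesq (pt K) x y)"
proof -
  have h: "pt K q p = cnj (pt K p q)" for p q
    unfolding pt_def by (rule pos_hermitian_entry[OF assms])
  have "sesq (pt K) y x = (\<Sum>p\<in>UNIV. \<Sum>q\<in>UNIV. cnj (y q) * pt K q p * x p)"
    unfolding sesq_def by (rule sum.swap)
  also have "\<dots> = (\<Sum>p\<in>UNIV. \<Sum>q\<in>UNIV. cnj (cnj (x p) * pt K p q * y q))"
    by (intro sum.cong refl) (subst h, simp add: mult_ac)
  also have "\<dots> = cnj (sesq (pt K) x y)" by (simp add: sesq_def)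
  finally show ?thesis .
qed

text \<open>Write a, b, c, d for the basis vectors 00, 01, 10, 11. The value is
  \<open>R a a + s^2 R d d + 2 s Re (R c b)\<close>, and stationarity turns it into
  \<open>R a a - s^2 R d d\<close>. The kernel vector ties the columns c and d together, and
  positivity of \<open>R\<close> then yields \<open>q \<ge> 0\<close>.\<close>

lemma no_kernel_row:
  assumes R: "pos R" and s: "0 \<le> s" "s < 1"
    and min: "lower_bound (pt R) q" and q: "q = Re (sesq (pt R) (diag2 (complex_of_real s)) (diag2 (complex_of_real s)))" "q < 0"
    and nz: "\<phi> False \<noteq> 0 \<or> \<phi> True \<noteq> 0"
    and ker: "Re (sesq R (prodv (single True) \<phi>) (prodv (single True) \<phi>)) = 0"
  shows False
proof -
  let ?a = "(False, False)" and ?b = "(False, True)" and ?c = "(True, False)" and ?d = "(True, True)"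
  let ?y = "diag2 (complex_of_real s)"
  note her = pos_hermitian_entry[OF R]
  have s': "cmod (complex_of_real s) < 1" using s by simp
  have rd: "R p p = complex_of_real (Re (R p p))" "0 \<le> Re (R p p)" for p
    using posD[OF R, of "single p"] by (auto simp: sesq_single less_eq_complex_def complex_eq_iff)
  have "sesq (pt R) (single ?d) ?y = 0" "sesq (pt R) (single ?c) ?y = 0"
    using stationary_corner[OF pos_pt_hermitian[OF R] _ s'] stationary_lower[OF pos_pt_hermitian[OF R] _ s'] min
    unfolding q(1) by blast+
  then have st: "R ?c ?b = - complex_of_real s * R ?d ?d" "R ?c ?a = - complex_of_real s * R ?d ?c"
    by (simp_all add: sesq_single_left sum_qq UNIV_bool diag2_def pt_def eq_neg_iff_add_eq_0 add.commute mult.commute)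
  have qv: "q = Re (R ?a ?a) + s\<^sup>2 * Re (R ?d ?d) + 2 * s * Re (R ?c ?b)"
    using her[of ?b ?c] by (simp add: q(1) sesq_def sum_qq UNIV_bool diag2_def pt_def power2_eq_square algebra_simps)
  have k: "\<phi> False * R p ?c + \<phi> True * R p ?d = 0" for p
    using pos_null(1)[OF R ker, of "single p"]
    by (simp add: sesq_single_left sum_qq UNIV_bool prodv_def single_def mult.commute add.commute)
  show False
  proof (cases "\<phi> False = 0 \<or> \<phi> True = 0")
    case True
    \<comment> \<open>If \<open>\<phi>\<close> has a zero component, a whole column of
      \<open>R\<close> vanishes, and with it the only term of \<open>q\<close> that could be
      negative.\<close>
    have "R ?c ?b = 0"
    proof (cases "\<phi> False = 0")
      case True
      then have "R ?d ?d = 0" using k[of ?d] nz by simp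
      then show ?thesis using st by simp
    next
      case False
      then have "R ?b ?c = 0" using True k[of ?b] by simp
      then show ?thesis using her[of ?b ?c] by simp
    qed
    then show False using qv q(2) rd(2)[of ?a] mult_nonneg_nonneg[OF zero_le_power2[of s] rd(2)[of ?d]] by simp
  next
    case False
    define r where "r = - \<phi> True / \<phi> False"
    have r: "r \<noteq> 0" and kr: "R p ?c = r * R p ?d" for p
      using False k[of p] by (auto simp: r_def field_simps eq_neg_iff_add_eq_0)
    \<comment> \<open>The second stationarity equation compares \<open>R a c\<close> with
      \<open>R d c\<close>; both contain the ratio \<open>r\<close> of the columns c and d, which
      then cancels and leaves \<open>|R a d| = s R d d\<close>.\<close>
    have "cmod (R ?a ?c) = s * (cmod r * Re (R ?d ?d))"
      using s st(2) kr[of ?d] her[of ?c ?a] rd[of ?d]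
      by (metis abs_of_nonneg complex_mod_cnj norm_minus_cancel norm_mult norm_of_real)
    then have "cmod (R ?a ?d) = s * Re (R ?d ?d)" using kr[of ?a] r by (simp add: norm_mult)
    then have cs: "(s * Re (R ?d ?d))\<^sup>2 \<le> Re (R ?a ?a) * Re (R ?d ?d)"
      using pos_Cauchy_Schwarz[OF R, of "single ?a" "single ?d"] by (simp add: sesq_single)
    have "Re (R ?c ?b) = - s * Re (R ?d ?d)" using st(1) by simp
    then have qq: "q = Re (R ?a ?a) - s\<^sup>2 * Re (R ?d ?d)" using qv by (simp add: power2_eq_square)
    show False
    proof (cases "Re (R ?d ?d) = 0")
      case True
      then show False using qq q(2) rd(2)[of ?a] by simp
    next
      case False
      then have "0 < Re (R ?d ?d)" using rd(2)[of ?d] by simp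
      moreover have "s\<^sup>2 * Re (R ?d ?d) * Re (R ?d ?d) \<le> Re (R ?a ?a) * Re (R ?d ?d)"
        using cs by (simp add: power2_eq_square mult_ac)
      ultimately have "s\<^sup>2 * Re (R ?d ?d) \<le> Re (R ?a ?a)" by (metis mult_right_le_imp_le)
      then show False using qq q(2) by simp
    qed
  qed
qed

definition swapk :: "(qq \<Rightarrow> qq \<Rightarrow> complex) \<Rightarrow> qq \<Rightarrow> qq \<Rightarrow> complex" where
  "swapk K p q = K (snd p, fst p) (snd q, fst q)"

lemma sesq_swapk: "sesq (swapk K) x y = sesq K (transp x) (transp y)"
  by (simp add: sesq_def swapk_def transp_def sum_qq UNIV_bool algebra_simps)

lemma sesq_pt_swapk: "sesq (pt (swapk K)) x x = sesq (pt K) (transp (cnjv x)) (transp (cnjv x))"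
  by (simp add: sesq_def swapk_def transp_def cnjv_def pt_def sum_qq UNIV_bool algebra_simps)

text \<open>Exchange of the qubits. The partial transpose then falls on the other factor, which
  amounts to replacing the test matrix by its adjoint; contractions and diag (1, s) are stable under
  this.\<close>

lemma no_kernel_column:
  assumes R: "pos R" and s: "0 \<le> s" "s < 1"
    and min: "lower_bound (pt R) q" and q: "q = Re (sesq (pt R) (diag2 (complex_of_real s)) (diag2 (complex_of_real s)))" "q < 0"
    and nz: "\<phi> False \<noteq> 0 \<or> \<phi> True \<noteq> 0"
    and ker: "Re (sesq R (prodv \<phi> (single True)) (prodv \<phi> (single True))) = 0"
  shows False
proof (rule no_kernel_row[of "swapk R" s q \<phi>])
  show "pos (swapk R)" using R by (simp add: pos_def sesq_swapk)
  show "lower_bound (pt (swapk R)) q"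
    using min contraction_transp contraction_cnjv by (simp add: lower_bound_def sesq_pt_swapk)
  have "transp (cnjv (diag2 (complex_of_real s))) = diag2 (complex_of_real s)"
    by (auto simp: fun_eq_iff transp_def cnjv_def diag2_def)
  then show "q = Re (sesq (pt (swapk R)) (diag2 (complex_of_real s)) (diag2 (complex_of_real s)))"
    by (simp add: sesq_pt_swapk q(1))
  have "transp (prodv (single True) \<phi>) = prodv \<phi> (single True)"
    by (auto simp: fun_eq_iff transp_def prodv_def)
  then show "Re (sesq (swapk R) (prodv (single True) \<phi>) (prodv (single True) \<phi>)) = 0"
    by (simp add: sesq_swapk ker)
qed (use assms in auto)

text \<open>A vector on which the first term of \<open>le\<close> already exhausts
  \<open>norm2 x\<close> must be orthogonal to the residue. The vector 00 is always of this kind, so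
  a factor of the residue is proportional to the second basis vector, and for \<open>s < 1\<close>
  the kernel lemmas apply.\<close>

lemma no_product_residue:
  assumes R: "pos R" and s: "0 \<le> s" "s \<le> 1"
    and min: "lower_bound (pt R) q" and q: "q = Re (sesq (pt R) (diag2 (complex_of_real s)) (diag2 (complex_of_real s)))" "q < 0"
    and ker: "Re (sesq R (prodv g h) (prodv g h)) = 0"
    and le: "\<And>x. Re (sesq (pt (outer (diag2 (complex_of_real s)))) x x) + (cmod (cdot x (prodv g h)))\<^sup>2 \<le> norm2 x"
  shows "prodv g h p = 0"
proof (rule ccontr)
  assume nz: "prodv g h p \<noteq> 0"
  have gh: "g False \<noteq> 0 \<or> g True \<noteq> 0" "h False \<noteq> 0 \<or> h True \<noteq> 0"
    using nz by (cases p; auto simp: prodv_def; metis (full_types))+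
  have c: "cdot (single r) (prodv g h) = prodv g h r" for r
    using sum_single[of "prodv g h" r] by (simp add: cdot_def mult.commute)
  have 1: "g False * h False = 0"
    using le[of "single (False, False)"] c[of "(False, False)"]
    by (simp add: sesq_single pt_def outer_def diag2_def prodv_def)
  show False
  proof (cases "s < 1")
    case True
    show False
    proof (cases "g False = 0")
      case 2: True
      have "prodv g h = (\<lambda>p. g True * prodv (single True) h p)"
        using 2 by (auto simp: fun_eq_iff prodv_def single_def)
      then have "Re (sesq R (prodv (single True) h) (prodv (single True) h)) = 0"
        using ker gh 2 by (simp add: Re_sesq_scale)
      then show False using no_kernel_row[OF R s(1) True min q gh(2)] by blast
    next
      case False
      then have 2: "h False = 0" using 1 by simp
      have "prodv g h = (\<lambda>p. h True * prodv g (single True) p)"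
        using 2 by (auto simp: fun_eq_iff prodv_def single_def)
      then have "Re (sesq R (prodv g (single True)) (prodv g (single True))) = 0"
        using ker gh 2 by (simp add: Re_sesq_scale)
      then show False using no_kernel_column[OF R s(1) True min q gh(1)] by blast
    qed
  next
    case False
    then have s1: "s = 1" using s by simp
    have 2: "g True * h True = 0"
      using le[of "single (True, True)"] c[of "(True, True)"] s1
      by (simp add: sesq_single pt_def outer_def diag2_def prodv_def)
    \<comment> \<open>At \<open>s = 1\<close> the transposed projector is the swap operator, which
      fixes the symmetric vectors. The vectors 00, 11 and this one then leave only the antisymmetric
      vector, which is not a product.\<close>
    let ?x = "\<lambda>p. single (False, True) p + 1 * single (True, False) p"
    have "norm2 ?x = 2" by (simp add: norm2_def sum_qq UNIV_bool single_def)
    moreover have "sesq (pt (outer (diag2 (complex_of_real s)))) ?x ?x = 2"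
      unfolding sesq_expand sesq_single by (simp add: pt_def outer_def diag2_def s1)
    moreover have "cdot ?x (prodv g h) = g False * h True + g True * h False"
      by (simp add: cdot_def sum_qq UNIV_bool single_def prodv_def)
    ultimately have "g False * h True + g True * h False = 0"
      using le[of ?x] by simp
    then show False using 1 2 gh by auto
  qed
qed


section \<open>Local orthonormal bases and the Schmidt form\<close>

definition onb :: "(bool \<Rightarrow> bool \<Rightarrow> complex) \<Rightarrow> bool" where
  "onb e \<longleftrightarrow> (\<forall>i j. cdot (e i) (e j) = (if i = j then 1 else 0)) \<and>
     (\<forall>k l. (\<Sum>i\<in>UNIV. e i k * cnj (e i l)) = (if k = l then 1 else 0))"

text \<open>Completes a unit vector \<open>u\<close> by its orthogonal complement in dimension two.
  The free phase \<open>\<omega>\<close> later makes the second Schmidt coefficient real and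
  nonnegative.\<close>

definition basis2 :: "(bool \<Rightarrow> complex) \<Rightarrow> complex \<Rightarrow> bool \<Rightarrow> bool \<Rightarrow> complex" where
  "basis2 u \<omega> i k = (if i then \<omega> * (if k then cnj (u False) else - cnj (u True)) else u k)"

lemma cmod_1_mult_cnj: "cmod \<omega> = 1 \<Longrightarrow> \<omega> * cnj \<omega> = 1" "cmod \<omega> = 1 \<Longrightarrow> cnj \<omega> * \<omega> = 1"
  using complex_norm_square[of \<omega>] by (simp_all add: mult.commute)

lemma onb_basis2:
  assumes "norm2 u = 1" "cmod \<omega> = 1"
  shows "onb (basis2 u \<omega>)"
proof -
  have u: "u False * cnj (u False) + u True * cnj (u True) = 1"
  proof -
    have "u False * cnj (u False) + u True * cnj (u True) = complex_of_real (norm2 u)"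
      by (simp only: norm2_bool of_real_add complex_norm_square)
    then show ?thesis using assms(1) by simp
  qed
  have w: "\<omega> * (cnj \<omega> * a) = a" for a
    by (simp add: mult.assoc[symmetric] cmod_1_mult_cnj[OF assms(2)])
  have "cdot (basis2 u \<omega> i) (basis2 u \<omega> j) = (if i = j then 1 else 0)" for i j
    using u by (cases i; cases j; simp add: cdot_def basis2_def UNIV_bool algebra_simps w)
  moreover have "(\<Sum>i\<in>UNIV. basis2 u \<omega> i k * cnj (basis2 u \<omega> i l)) = (if k = l then 1 else 0)" for k l
    using u by (cases k; cases l; simp add: UNIV_bool basis2_def algebra_simps w)
  ultimately show ?thesis by (simp add: onb_def)
qed

lemma onb_cnjv: "onb e \<Longrightarrow> onb (\<lambda>i. cnjv (e i))"
proof -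
  assume e: "onb e"
  have "cdot (cnjv (e i)) (cnjv (e j)) = cnj (cdot (e i) (e j))" for i j
    by (simp add: cdot_def cnjv_def)
  moreover have "(\<Sum>i\<in>UNIV. cnjv (e i) k * cnj (cnjv (e i) l)) = (if k = l then 1 else 0)" for k l
  proof -
    have o: "(\<Sum>i\<in>UNIV. e i k * cnj (e i l)) = (if k = l then 1 else 0)"
      using e unfolding onb_def by blast
    have "(\<Sum>i\<in>UNIV. cnjv (e i) k * cnj (cnjv (e i) l)) = cnj (\<Sum>i\<in>UNIV. e i k * cnj (e i l))"
      by (simp add: cnjv_def)
    then show ?thesis unfolding o by simp
  qed
  ultimately show ?thesis using e by (simp add: onb_def)
qed

lemma onb_expand:
  assumes "onb e"
  shows "u k = (\<Sum>i\<in>UNIV. cdot (e i) u * e i k)"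
proof -
  have "(\<Sum>i\<in>UNIV. cdot (e i) u * e i k) = (\<Sum>l\<in>UNIV. (\<Sum>i\<in>UNIV. e i k * cnj (e i l)) * u l)"
    by (simp add: cdot_def UNIV_bool algebra_simps)
  also have "\<dots> = (\<Sum>l\<in>UNIV. if k = l then u l else 0)"
    using assms by (intro sum.cong) (simp_all add: onb_def)
  finally show ?thesis by simp
qed

lemma onb_norm2:
  assumes "onb e"
  shows "norm2 (\<lambda>i. \<Sum>k\<in>UNIV. u k * e i k) = norm2 u"
proof -
  have "complex_of_real (norm2 (\<lambda>i. \<Sum>k\<in>UNIV. u k * e i k))
      = (\<Sum>k\<in>UNIV. \<Sum>l\<in>UNIV. (u k * cnj (u l)) * (\<Sum>i\<in>UNIV. e i k * cnj (e i l)))"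
    unfolding cdot_self[symmetric] cdot_def by (simp add: UNIV_bool algebra_simps)
  also have "\<dots> = (\<Sum>k\<in>UNIV. \<Sum>l\<in>UNIV. if k = l then u k * cnj (u l) else 0)"
    using assms by (intro sum.cong) (simp_all add: onb_def)
  also have "\<dots> = complex_of_real (norm2 u)"
    unfolding cdot_self[symmetric] cdot_def by (simp add: mult.commute)
  finally show ?thesis by (simp only: of_real_eq_iff)
qed

definition lin :: "(qq \<Rightarrow> qq \<Rightarrow> complex) \<Rightarrow> (qq \<Rightarrow> complex) \<Rightarrow> qq \<Rightarrow> complex" where
  "lin B x r = (\<Sum>p\<in>UNIV. x p * B p r)"

lemma sesq_lin: "sesq K (lin B x) (lin B y) = sesq (\<lambda>p q. sesq K (B p) (B q)) x y"
proof -
  have 1: "sesq K (lin B x) z = (\<Sum>p\<in>UNIV. cnj (x p) * sesq K (B p) z)" for z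
    by (simp add: lin_def sesq_def sum_qq UNIV_bool algebra_simps)
  have 2: "sesq K z (lin B y) = (\<Sum>q\<in>UNIV. sesq K z (B q) * y q)" for z
    by (simp add: lin_def sesq_def sum_qq UNIV_bool algebra_simps)
  show ?thesis
    unfolding 1 unfolding 2
    by (simp only: sesq_def[of "\<lambda>p q. sesq K (B p) (B q)"] sum_distrib_left mult.assoc)
qed

definition pbasis :: "(bool \<Rightarrow> bool \<Rightarrow> complex) \<Rightarrow> (bool \<Rightarrow> bool \<Rightarrow> complex) \<Rightarrow> qq \<Rightarrow> qq \<Rightarrow> complex" where
  "pbasis e f p = prodv (e (fst p)) (f (snd p))"

lemma amp_lin_pbasis:
  "amp (lin (pbasis e f) x) u v = amp x (\<lambda>i. \<Sum>k\<in>UNIV. u k * e i k) (\<lambda>j. \<Sum>l\<in>UNIV. v l * f j l)"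
  by (simp add: amp_def lin_def pbasis_def prodv_def sum_qq UNIV_bool algebra_simps)

lemma contraction_lin:
  assumes "onb e" "onb f" "contraction x"
  shows "contraction (lin (pbasis e f) x)"
  unfolding contraction_def
proof (intro allI)
  fix u v
  show "(cmod (amp (lin (pbasis e f) x) u v))\<^sup>2 \<le> norm2 u * norm2 v"
    using assms(3)[unfolded contraction_def, rule_format,
        of "\<lambda>i. \<Sum>k\<in>UNIV. u k * e i k" "\<lambda>j. \<Sum>l\<in>UNIV. v l * f j l"]
    by (simp only: amp_lin_pbasis onb_norm2[OF assms(1)] onb_norm2[OF assms(2)])
qed

lemma prodv_expand:
  assumes "onb e" "onb f"
  shows "prodv g h = lin (pbasis e f) (prodv (\<lambda>i. cdot (e i) g) (\<lambda>j. cdot (f j) h))"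
proof
  fix p :: qq
  have "prodv g h p = (\<Sum>i\<in>UNIV. cdot (e i) g * e i (fst p)) * (\<Sum>j\<in>UNIV. cdot (f j) h * f j (snd p))"
    using onb_expand[OF assms(1), of g "fst p"] onb_expand[OF assms(2), of h "snd p"]
    by (simp add: prodv_def)
  then show "prodv g h p = lin (pbasis e f) (prodv (\<lambda>i. cdot (e i) g) (\<lambda>j. cdot (f j) h)) p"
    by (simp add: lin_def pbasis_def prodv_def sum_qq UNIV_bool algebra_simps)
qed

lemma pbasis_expand:
  assumes "onb e" "onb f"
  shows "y = lin (pbasis e f) (\<lambda>p. cdot (pbasis e f p) y)"
proof
  fix p :: qq
  have "y p = (\<Sum>i\<in>UNIV. (\<Sum>k\<in>UNIV. cnj (e i k) * y (k, snd p)) * e i (fst p))"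
    using onb_expand[OF assms(1), of "\<lambda>k. y (k, snd p)" "fst p"] by (simp add: cdot_def)
  also have "\<dots> = (\<Sum>i\<in>UNIV. (\<Sum>k\<in>UNIV. cnj (e i k) * (\<Sum>j\<in>UNIV. (\<Sum>l\<in>UNIV. cnj (f j l) * y (k, l)) * f j (snd p))) * e i (fst p))"
    by (intro sum.cong refl arg_cong2[where f = "(*)"] onb_expand[OF assms(2), of "\<lambda>l. y (k, l)" "snd p" for k, unfolded cdot_def])
  also have "\<dots> = lin (pbasis e f) (\<lambda>p. cdot (pbasis e f p) y) p"
    by (simp add: lin_def pbasis_def prodv_def cdot_def sum_qq UNIV_bool algebra_simps)
  finally show "y p = lin (pbasis e f) (\<lambda>p. cdot (pbasis e f p) y) p" .
qed

lemma cdot_prodv_prodv: "cdot (prodv e f) (prodv g h) = cdot e g * cdot f h"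
  by (simp add: cdot_def prodv_def sum_qq UNIV_bool algebra_simps)

lemma cdot_pbasis:
  assumes "onb e" "onb f"
  shows "cdot (pbasis e f p) (pbasis e f q) = (if p = q then 1 else 0)"
  using assms by (auto simp: pbasis_def cdot_prodv_prodv onb_def prod_eq_iff)

lemma cdot_lin:
  assumes "onb e" "onb f"
  shows "cdot (lin (pbasis e f) x) (lin (pbasis e f) y) = cdot x y"
proof -
  have s: "sesq (\<lambda>p q. if p = q then 1 else 0) u v = cdot u v" for u v :: "qq \<Rightarrow> complex"
    using sesq_one[of 1 u v] by simp
  have "cdot (lin (pbasis e f) x) (lin (pbasis e f) y) = sesq (\<lambda>p q. cdot (pbasis e f p) (pbasis e f q)) x y"
    using sesq_lin[of "\<lambda>p q. if p = q then 1 else 0" "pbasis e f" x y] by (simp only: s)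
  then show ?thesis by (simp only: cdot_pbasis[OF assms] s)
qed

lemma norm2_lin:
  assumes "onb e" "onb f"
  shows "norm2 (lin (pbasis e f) x) = norm2 x"
  using cdot_lin[OF assms, of x x] by (simp only: cdot_self of_real_eq_iff)

text \<open>Compactness arguments run over tuples, since functions on \<^typ>\<open>bool\<close> carry no metric here.\<close>

definition vec_of_pair :: "complex \<times> complex \<Rightarrow> bool \<Rightarrow> complex" where
  "vec_of_pair z i = (if i then snd z else fst z)"

definition vec_of_quad :: "complex \<times> complex \<times> complex \<times> complex \<Rightarrow> qq \<Rightarrow> complex" where
  "vec_of_quad z p = (case z of (a, b, c, d) \<Rightarrow>
     if fst p then if snd p then d else c else if snd p then b else a)"

lemma vec_of_pair_surj: "u = vec_of_pair (u False, u True)"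
  by (auto simp: fun_eq_iff vec_of_pair_def)

lemma vec_of_quad_surj: "x = vec_of_quad (x (False, False), x (False, True), x (True, False), x (True, True))"
  by (auto simp: fun_eq_iff vec_of_quad_def)

text \<open>The amplitude is continuous on the compact product of two unit spheres; homogeneity
  carries its maximum over to all vectors.\<close>

lemma amp_attains_norm:
  obtains e f where "norm2 e = 1" "norm2 f = 1"
    "\<And>e' f'. (cmod (amp x e' f'))\<^sup>2 \<le> (cmod (amp x e f))\<^sup>2 * (norm2 e' * norm2 f')"
proof -
  let ?S = "{z :: complex \<times> complex. (cmod (fst z))\<^sup>2 + (cmod (snd z))\<^sup>2 = 1}"
  have "?S = sphere 0 1" by (auto simp: sphere_def norm_prod_def)
  then have "compact ?S" by simp
  then have 1: "compact (?S \<times> ?S)" by (intro compact_Times)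
  have "((1, 0), (1, 0)) \<in> ?S \<times> ?S" by simp
  then have 2: "?S \<times> ?S \<noteq> {}" by blast
  have 3: "continuous_on (?S \<times> ?S) (\<lambda>z. cmod (amp x (vec_of_pair (fst z)) (vec_of_pair (snd z))))"
    by (simp add: amp_def UNIV_bool vec_of_pair_def) (intro continuous_intros)
  obtain z where z: "z \<in> ?S \<times> ?S"
    "\<forall>w \<in> ?S \<times> ?S. cmod (amp x (vec_of_pair (fst w)) (vec_of_pair (snd w))) \<le> cmod (amp x (vec_of_pair (fst z)) (vec_of_pair (snd z)))"
    using continuous_attains_sup[OF 1 2 3] by blast
  define e where "e = vec_of_pair (fst z)"
  define f where "f = vec_of_pair (snd z)"
  have unit: "cmod (amp x e' f') \<le> cmod (amp x e f)" if "norm2 e' = 1" "norm2 f' = 1" for e' f'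
    using z(2)[rule_format, of "((e' False, e' True), (f' False, f' True))"] that
    unfolding fst_conv snd_conv vec_of_pair_surj[of e', symmetric] vec_of_pair_surj[of f', symmetric]
    by (simp add: norm2_bool e_def f_def)
  show ?thesis
  proof (rule that)
    show "norm2 e = 1" "norm2 f = 1"
      using z(1) by (auto simp: e_def f_def norm2_bool vec_of_pair_def)
    fix e' f'
    show "(cmod (amp x e' f'))\<^sup>2 \<le> (cmod (amp x e f))\<^sup>2 * (norm2 e' * norm2 f')"
    proof (cases "norm2 e' = 0 \<or> norm2 f' = 0")
      case True
      then have "amp x e' f' = 0" unfolding norm2_eq_0_iff by (auto simp: amp_def)
      then show ?thesis by simp
    next
      case False
      then have p: "0 < norm2 e'" "0 < norm2 f'" by (simp_all add: order_less_le)
      define a where "a = complex_of_real (1 / sqrt (norm2 e'))"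
      define b where "b = complex_of_real (1 / sqrt (norm2 f'))"
      have ab: "(cmod a)\<^sup>2 = 1 / norm2 e'" "(cmod b)\<^sup>2 = 1 / norm2 f'"
        using p by (simp_all add: a_def b_def norm_divide power_divide)
      have "cmod (amp x (\<lambda>i. a * e' i) (\<lambda>i. b * f' i)) \<le> cmod (amp x e f)"
        using p by (intro unit) (simp_all add: norm2_scale ab)
      moreover have "amp x (\<lambda>i. a * e' i) (\<lambda>i. b * f' i) = a * b * amp x e' f'"
        by (simp add: amp_def UNIV_bool algebra_simps)
      ultimately have "(cmod (a * b * amp x e' f'))\<^sup>2 \<le> (cmod (amp x e f))\<^sup>2"
        by (simp add: power_mono)
      then show ?thesis using p by (simp add: norm_mult power_mult_distrib ab field_simps)
    qed
  qed
qed

text \<open>A minimizer of norm below 1 could be enlarged within the unit ball, and since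
  \<open>q\<close> is negative this would lower the value further.\<close>

lemma minimizer_norm_attained:
  assumes "lower_bound S q" "contraction y" "q = Re (sesq S y y)" "q < 0"
  obtains e f where "norm2 e = 1" "norm2 f = 1" "amp y (cnjv e) (cnjv f) = 1"
proof -
  obtain e f where ef: "norm2 e = 1" "norm2 f = 1"
    "\<And>e' f'. (cmod (amp y e' f'))\<^sup>2 \<le> (cmod (amp y e f))\<^sup>2 * (norm2 e' * norm2 f')"
    using amp_attains_norm[of y] by blast
  define m where "m = (cmod (amp y e f))\<^sup>2"
  have m1: "m \<le> 1" using assms(2) ef(1,2) by (simp add: m_def contraction_def) (metis mult_1)
  have "m = 1"
  proof (rule ccontr)
    assume "m \<noteq> 1"
    \<comment> \<open>The midpoint of \<open>m\<close> and 1 is below 1 and, unlike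
      \<open>m\<close>, positive even if \<open>y\<close> should be zero.\<close>
    define N where "N = (m + 1) / 2"
    have N: "0 < N" "N < 1" "m \<le> N"
      using m1 \<open>m \<noteq> 1\<close> by (auto simp: N_def m_def add_nonneg_pos)
    have "(cmod (amp y e' f'))\<^sup>2 \<le> N * (norm2 e' * norm2 f')" for e' f'
      using ef(3)[of e' f'] N(3) unfolding m_def[symmetric]
      by (meson mult_nonneg_nonneg mult_right_mono norm2_nonneg order_trans)
    then have "N * q \<le> q" using lower_boundD_scaled[OF assms(1) N(1)] assms(3) by metis
    then show False using N(2) assms(4) by (simp add: mult_le_cancel_right1)
  qed
  then have am: "cmod (amp y e f) = 1"
    using norm_ge_zero[of "amp y e f"] unfolding m_def power2_eq_1_iff by linarith
  \<comment> \<open>The phase of the amplitude is absorbed into \<open>e\<close>, so that the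
    amplitude becomes exactly 1.\<close>
  define \<omega> where "\<omega> = cnj (amp y e f)"
  show ?thesis
  proof (rule that[of "cnjv (\<lambda>i. \<omega> * e i)" "cnjv f"])
    show "norm2 (cnjv (\<lambda>i. \<omega> * e i)) = 1" by (simp add: norm2_scale ef \<omega>_def am)
    show "norm2 (cnjv f) = 1" by (simp add: ef)
    have "amp y (\<lambda>i. \<omega> * e i) f = \<omega> * amp y e f" by (simp add: amp_def UNIV_bool algebra_simps)
    then show "amp y (cnjv (cnjv (\<lambda>i. \<omega> * e i))) (cnjv (cnjv f)) = 1"
      using cmod_1_mult_cnj[OF am] by (simp add: \<omega>_def)
  qed
qed

lemma norm2_diff: "norm2 (\<lambda>p. x p - y p) = norm2 x - 2 * Re (cdot y x) + norm2 y"
proof -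
  have "(cmod (a - b))\<^sup>2 = (cmod a)\<^sup>2 - 2 * Re (cnj b * a) + (cmod b)\<^sup>2" for a b :: complex
    unfolding cmod_power2 by (simp add: power2_eq_square algebra_simps)
  then show ?thesis
    by (simp add: norm2_def cdot_def sum.distrib sum_subtractf sum_distrib_left)
qed

lemma eq_of_cdot_1:
  assumes "norm2 w \<le> 1" "norm2 f = 1" "cdot f w = 1"
  shows "w = f"
proof -
  have "norm2 (\<lambda>p. w p - f p) \<le> 0" using assms by (simp add: norm2_diff)
  then have "norm2 (\<lambda>p. w p - f p) = 0" using norm2_nonneg order_antisym by blast
  then show ?thesis by (simp add: norm2_eq_0_iff fun_eq_iff)
qed

text \<open>The images of \<open>u\<close> and \<open>v\<close> under the contraction have norm at
  most 1 and overlap 1 with \<open>v\<close> and \<open>u\<close>; by the equality case of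
  Cauchy--Schwarz they coincide with them. Hence in bases starting with \<open>u\<close> and
  \<open>v\<close> the off-diagonal entries vanish.\<close>

lemma Schmidt_form:
  assumes "contraction y" "norm2 u = 1" "norm2 v = 1" "amp y (cnjv u) (cnjv v) = 1"
  obtains e f s where "onb e" "onb f" "0 \<le> s" "s \<le> 1" "y = lin (pbasis e f) (diag2 (complex_of_real s))"
proof -
  define w where "w l = (\<Sum>k\<in>UNIV. cnj (u k) * y (k, l))" for l
  define w' where "w' k = (\<Sum>l\<in>UNIV. y (k, l) * cnj (v l))" for k
  have "w = v"
  proof (rule eq_of_cdot_1)
    show "norm2 w \<le> 1"
      using contraction_row[OF contraction_transp[OF assms(1)], of "cnjv u"] assms(2)
      by (simp add: w_def[abs_def] transp_def cnjv_def mult.commute)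
    show "cdot v w = 1" using assms(4) by (simp add: cdot_def w_def amp_def cnjv_def UNIV_bool algebra_simps)
  qed (rule assms)
  have "w' = u"
  proof (rule eq_of_cdot_1)
    show "norm2 w' \<le> 1"
      using contraction_row[OF assms(1), of "cnjv v"] assms(3)
      by (simp add: w'_def[abs_def] cnjv_def)
    show "cdot u w' = 1" using assms(4) by (simp add: cdot_def w'_def amp_def cnjv_def UNIV_bool algebra_simps)
  qed (rule assms)
  define \<zeta> where "\<zeta> = cdot (prodv (basis2 u 1 True) (basis2 v 1 True)) y"
  \<comment> \<open>The remaining diagonal entry \<open>\<zeta>\<close> is computed with trivial
    phases; rotating the second basis vector on one side by its phase replaces it by its
    modulus.\<close>
  define \<omega> where "\<omega> = (if \<zeta> = 0 then 1 else \<zeta> / complex_of_real (cmod \<zeta>))"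
  have om: "cmod \<omega> = 1" by (simp add: \<omega>_def norm_divide)
  have "cnj \<omega> * \<zeta> = complex_of_real (cmod \<zeta>)"
    using complex_norm_square[of \<zeta>] by (simp add: \<omega>_def power2_eq_square field_simps)
  let ?e = "basis2 u 1" and ?f = "basis2 v \<omega>"
  have e: "onb ?e" and f: "onb ?f" using assms om by (auto intro: onb_basis2)
  have u0: "?e False = u" "?f False = v" by (simp_all add: basis2_def fun_eq_iff)
  have c: "cdot (pbasis ?e ?f p) y = diag2 (complex_of_real (cmod \<zeta>)) p" for p
  proof -
    have 1: "cdot (prodv u g) y = cdot g v" for g
    proof -
      have "cdot (prodv u g) y = cdot g w"
        by (simp add: cdot_def prodv_def w_def sum_qq UNIV_bool algebra_simps)
      then show ?thesis using \<open>w = v\<close> by simp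
    qed
    have 2: "cdot (prodv g v) y = cdot g u" for g
    proof -
      have "cdot (prodv g v) y = cdot g w'"
        by (simp add: cdot_def prodv_def w'_def sum_qq UNIV_bool algebra_simps)
      then show ?thesis using \<open>w' = u\<close> by simp
    qed
    have 3: "cdot (prodv (?e True) (?f True)) y = complex_of_real (cmod \<zeta>)"
    proof -
      have "cdot (prodv (?e True) (?f True)) y = cnj \<omega> * \<zeta>"
        by (simp add: \<zeta>_def cdot_def prodv_def basis2_def sum_qq UNIV_bool algebra_simps)
      then show ?thesis using \<open>cnj \<omega> * \<zeta> = _\<close> by simp
    qed
    have "cdot (?f True) v = 0" "cdot (?e True) u = 0" "cdot v v = 1" "cdot u u = 1"
      using e f u0 unfolding onb_def by (metis (full_types))+
    then show ?thesis
      using 1 2 3 u0 by (cases p; cases "fst p"; cases "snd p") (auto simp: pbasis_def diag2_def)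
  qed
  show ?thesis
  proof (rule that[OF e f])
    have "(cmod (cdot (prodv (?e True) (?f True)) y))\<^sup>2 \<le> 1"
    proof -
      have "norm2 (?e True) = 1" "norm2 (?f True) = 1"
        using e f cdot_self of_real_eq_1_iff unfolding onb_def by metis+
      then show ?thesis using assms(1) by (simp add: cdot_prodv contraction_def) (metis mult_1 norm2_cnjv)
    qed
    moreover have "cdot (prodv (?e True) (?f True)) y = complex_of_real (cmod \<zeta>)"
      using c[of "(True, True)"] by (simp add: pbasis_def diag2_def)
    ultimately show "cmod \<zeta> \<le> 1" by (simp add: abs_square_le_1)
    show "y = lin (pbasis ?e ?f) (diag2 (complex_of_real (cmod \<zeta>)))"
      using pbasis_expand[OF e f, of y] c by (simp add: lin_def[abs_def])
  qed simp
qed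

text \<open>The change to Schmidt bases of \<open>y\<close>. As the partial transpose conjugates the
  second factor, \<open>K\<close> is expressed in the basis with conjugated second factor, so that
  \<open>pt K\<close> appears in the basis where \<open>y\<close> is diagonal.\<close>

lemma no_residue:
  assumes K: "pos K" and y: "contraction y" "lower_bound (pt K) q" "q = Re (sesq (pt K) y y)" "q < 0"
    and ker: "Re (sesq K (prodv g (cnjv h)) (prodv g (cnjv h))) = 0"
    and le: "\<And>z. Re (sesq (pt (outer y)) z z) + (cmod (cdot z (prodv g (cnjv h))))\<^sup>2 \<le> norm2 z"
  shows "prodv g h p = 0"
proof -
  obtain u v where "norm2 u = 1" "norm2 v = 1" "amp y (cnjv u) (cnjv v) = 1"
    using minimizer_norm_attained[OF y(2,1,3,4)] by blast
  then obtain e f s where ef: "onb e" "onb f" and s: "0 \<le> s" "s \<le> 1"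
    and ys: "y = lin (pbasis e f) (diag2 (complex_of_real s))"
    using Schmidt_form[OF y(1)] by metis
  let ?d = "diag2 (complex_of_real s)"
  let ?f' = "\<lambda>i. cnjv (f i)"
  let ?B = "pbasis e f" and ?B' = "pbasis e ?f'"
  note ef' = ef(1) onb_cnjv[OF ef(2)]
  define R where "R p q = sesq K (?B' p) (?B' q)" for p q
  define g' where "g' i = cdot (e i) g" for i
  define h' where "h' j = cdot (?f' j) (cnjv h)" for j
  have gh: "prodv g (cnjv h) = lin ?B' (prodv g' h')"
    unfolding g'_def h'_def by (rule prodv_expand[OF ef'])
  have sR: "sesq R x x = sesq K (lin ?B' x) (lin ?B' x)" for x
    unfolding sesq_lin R_def ..
  have "pt R = (\<lambda>p q. sesq (pt K) (?B p) (?B q))"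
    by (intro ext) (simp add: pt_def[of R] R_def pbasis_def sesq_pt_prodv)
  then have spR: "sesq (pt R) x x = sesq (pt K) (lin ?B x) (lin ?B x)" for x
    by (simp add: sesq_lin)
  have so: "sesq (pt (outer y)) (lin ?B' x) (lin ?B' x) = sesq (pt (outer ?d)) x x" for x
  proof -
    have c: "cdot (?B p) y = ?d p" for p
    proof -
      have "?B p = lin ?B (single p)"
      proof
        fix r
        show "?B p r = lin ?B (single p) r"
          using sum_single[of "\<lambda>q. ?B q r" p] by (simp add: lin_def mult.commute)
      qed
      then have "cdot (?B p) y = cdot (single p) ?d" by (metis cdot_lin[OF ef] ys)
      also have "\<dots> = ?d p" using sum_single[of ?d p] by (simp add: cdot_def mult.commute)
      finally show ?thesis .
    qed
    have "sesq (pt (outer y)) (?B' p) (?B' q) = pt (outer ?d) p q" for p q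
    proof -
      have "sesq (pt (outer y)) (?B' p) (?B' q) = sesq (outer y) (?B (fst p, snd q)) (?B (fst q, snd p))"
        by (simp add: pbasis_def sesq_pt_prodv)
      also have "\<dots> = cdot (?B (fst p, snd q)) y * cnj (cdot (?B (fst q, snd p)) y)"
        by (simp add: sesq_outer cnj_cdot)
      also have "\<dots> = pt (outer ?d) p q"
        unfolding c by (simp add: pt_def outer_def)
      finally show ?thesis .
    qed
    then show ?thesis by (simp add: sesq_lin)
  qed
  have "prodv g' h' r = 0" for r
  proof (rule no_product_residue[of R s q])
    show "pos R" using K by (simp add: pos_def sR)
    show "lower_bound (pt R) q"
      using y(2) contraction_lin[OF ef] by (simp add: lower_bound_def spR)
    show "q = Re (sesq (pt R) ?d ?d)" by (simp add: spR y(3) flip: ys)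
    show "Re (sesq R (prodv g' h') (prodv g' h')) = 0" using ker by (simp add: sR gh)
    show "Re (sesq (pt (outer ?d)) x x) + (cmod (cdot x (prodv g' h')))\<^sup>2 \<le> norm2 x" for x
      using le[of "lin ?B' x"] by (simp add: so gh cdot_lin[OF ef'] norm2_lin[OF ef'])
  qed (use s y in auto)
  then have "prodv g (cnjv h) r = 0" for r by (simp add: gh lin_def)
  then show ?thesis by (simp add: prodv_def cnjv_def)
qed

section \<open>Existence of an optimal contraction\<close>

text \<open>Contractions form a closed set, cut out by one continuous inequality for each pair of
  vectors, and a bounded one, since each entry is the amplitude at two basis vectors.\<close>

lemma minimizer_exists:
  obtains y where "contraction y" "lower_bound S (Re (sesq S y y))"
proof -
  let ?C = "{z. contraction (vec_of_quad z)}"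
  have am: "amp (vec_of_quad z) e f = e False * fst z * f False + e False * fst (snd z) * f True
      + (e True * fst (snd (snd z)) * f False + e True * snd (snd (snd z)) * f True)" for z e f
    by (cases z) (simp add: amp_def vec_of_quad_def UNIV_bool)
  have "?C = (\<Inter>e. \<Inter>f. {z. (cmod (amp (vec_of_quad z) e f))\<^sup>2 \<le> norm2 e * norm2 f})"
    by (auto simp: contraction_def)
  moreover have "closed {z. (cmod (amp (vec_of_quad z) e f))\<^sup>2 \<le> norm2 e * norm2 f}" for e f
    unfolding am by (intro closed_Collect_le continuous_intros)
  ultimately have cl: "closed ?C" by (simp add: closed_INT)
  have "bounded ?C"
  proof -
    have le1: "cmod (x p) \<le> 1" if "contraction x" for x :: "qq \<Rightarrow> complex" and p
    proof -
      have "amp x (single (fst p)) (single (snd p)) = x p"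
        by (cases p; cases "fst p"; cases "snd p") (simp_all add: amp_def single_def UNIV_bool)
      then have "(cmod (x p))\<^sup>2 \<le> 1"
        using that unfolding contraction_def by (metis mult_1 norm2_single)
      then show ?thesis by (simp add: abs_square_le_1)
    qed
    have "?C \<subseteq> cball 0 1 \<times> cball 0 1 \<times> cball 0 1 \<times> cball 0 1"
    proof
      fix z assume "z \<in> ?C"
      then show "z \<in> cball 0 1 \<times> cball 0 1 \<times> cball 0 1 \<times> cball 0 1"
        using le1[of "vec_of_quad z" "(False, False)"] le1[of "vec_of_quad z" "(False, True)"]
          le1[of "vec_of_quad z" "(True, False)"] le1[of "vec_of_quad z" "(True, True)"]
        by (cases z) (simp add: vec_of_quad_def)
    qed
    moreover have "bounded (cball (0 :: complex) 1 \<times> cball (0 :: complex) 1 \<times> cball (0 :: complex) 1 \<times> cball (0 :: complex) 1)"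
      by (intro bounded_Times bounded_cball)
    ultimately show ?thesis using bounded_subset by blast
  qed
  with cl have 1: "compact ?C" by (simp add: compact_eq_bounded_closed)
  have "(0, 0, 0, 0) \<in> ?C"
    by (simp add: contraction_def amp_def vec_of_quad_def)
  then have 2: "?C \<noteq> {}" by blast
  have 3: "continuous_on ?C (\<lambda>z. Re (sesq S (vec_of_quad z) (vec_of_quad z)))"
  proof -
    have v: "vec_of_quad z (False, False) = fst z" "vec_of_quad z (False, True) = fst (snd z)"
      "vec_of_quad z (True, False) = fst (snd (snd z))" "vec_of_quad z (True, True) = snd (snd (snd z))" for z
      by (cases z; simp add: vec_of_quad_def)+
    show ?thesis unfolding sesq_def sum_qq
      by (simp add: UNIV_bool v) (intro continuous_intros)
  qed
  obtain z where z: "z \<in> ?C"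
    "\<forall>w\<in>?C. Re (sesq S (vec_of_quad z) (vec_of_quad z)) \<le> Re (sesq S (vec_of_quad w) (vec_of_quad w))"
    using continuous_attains_inf[OF 1 2 3] by blast
  show ?thesis
  proof (rule that[of "vec_of_quad z"])
    show "contraction (vec_of_quad z)" using z by simp
    show "lower_bound S (Re (sesq S (vec_of_quad z) (vec_of_quad z)))"
      unfolding lower_bound_def using z(2) vec_of_quad_surj by (metis mem_Collect_eq)
  qed
qed


section \<open>The Peres--Horodecki criterion\<close>

text \<open>Separability without normalization: the weights are absorbed into the vectors, which
  gives a cone closed under sums, nonnegative multiples and the partial transpose.\<close>

definition sepc :: "(qq \<Rightarrow> qq \<Rightarrow> complex) \<Rightarrow> bool" where
  "sepc K \<longleftrightarrow> (\<exists>efs. \<forall>p q. K p q = (\<Sum>(e, f)\<leftarrow>efs. outer (prodv e f) p q))"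

lemma sepc_outer: "sepc (outer (prodv e f))"
  unfolding sepc_def by (intro exI[of _ "[(e, f)]"]) simp

lemma sepc_add:
  assumes "sepc K" "sepc L"
  shows "sepc (\<lambda>p q. K p q + L p q)"
proof -
  obtain xs ys where "\<forall>p q. K p q = (\<Sum>(e, f)\<leftarrow>xs. outer (prodv e f) p q)"
    "\<forall>p q. L p q = (\<Sum>(e, f)\<leftarrow>ys. outer (prodv e f) p q)"
    using assms unfolding sepc_def by blast
  then show ?thesis unfolding sepc_def by (intro exI[of _ "xs @ ys"]) simp
qed

lemma sepc_scale:
  assumes "sepc K" "0 \<le> t"
  shows "sepc (\<lambda>p q. complex_of_real t * K p q)"
proof -
  obtain xs where xs: "\<forall>p q. K p q = (\<Sum>(e, f)\<leftarrow>xs. outer (prodv e f) p q)"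
    using assms unfolding sepc_def by blast
  have "complex_of_real (sqrt t) * complex_of_real (sqrt t) = complex_of_real t"
    using assms(2) by (metis of_real_mult real_sqrt_mult_self abs_of_nonneg)
  then have "outer (prodv (\<lambda>i. complex_of_real (sqrt t) * e i) f) p q = complex_of_real t * outer (prodv e f) p q" for e f p q
    by (simp add: outer_def prodv_def)
  then show ?thesis using xs unfolding sepc_def
    by (intro exI[of _ "map (\<lambda>(e, f). (\<lambda>i. complex_of_real (sqrt t) * e i, f)) xs"])
      (simp add: sum_list_const_mult o_def case_prod_unfold)
qed

lemma sepc_pt:
  assumes "sepc K"
  shows "sepc (pt K)"
proof -
  obtain xs where xs: "\<forall>p q. K p q = (\<Sum>(e, f)\<leftarrow>xs. outer (prodv e f) p q)"
    using assms unfolding sepc_def by blast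
  have "pt K p q = (\<Sum>(e, f)\<leftarrow>xs. pt (outer (prodv e f)) p q)" for p q
    by (simp add: pt_def xs case_prod_unfold)
  then show ?thesis unfolding sepc_def
    by (intro exI[of _ "map (\<lambda>(e, f). (e, cnjv f)) xs"])
      (simp add: o_def case_prod_unfold pt_outer_prodv)
qed

lemma lin_outer: "(\<Sum>r\<in>UNIV. \<Sum>s\<in>UNIV. B r p * outer v r s * cnj (B s q)) = outer (lin B v) p q"
  by (simp add: outer_def lin_def sum_product mult_ac)

text \<open>\<open>B\<close> and \<open>B'\<close> are dual frames: the entries of \<open>K\<close>
  with respect to \<open>B'\<close> are its coefficients with respect to \<open>B\<close>.\<close>

lemma frame_reconstruct:
  assumes "\<And>p q. (\<Sum>r\<in>UNIV. B r p * cnj (B' r q)) = (if p = q then 1 else 0)"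
    and "\<And>r s. sesq K (B' r) (B' s) = (\<Sum>v\<leftarrow>vs. outer v r s)"
  shows "K p q = (\<Sum>v\<leftarrow>vs. outer (lin B v) p q)"
proof -
  let ?g = "\<lambda>r s a b. B r p * cnj (B' r a) * (K a b * cnj (B s q * cnj (B' s b)))"
  have d1: "(\<Sum>a\<in>UNIV. (\<Sum>r\<in>UNIV. B r p * cnj (B' r a)) * f a) = f p" for f
    by (simp add: assms(1) if_distrib[of "\<lambda>x. x * _"] cong: if_cong)
  have d2: "(\<Sum>b\<in>UNIV. f b * cnj (\<Sum>s\<in>UNIV. B s q * cnj (B' s b))) = f q" for f
    by (simp only: assms(1)) (simp add: if_distrib[of "\<lambda>x. _ * x"] if_distrib[of cnj] cong: if_cong)
  have "(\<Sum>v\<leftarrow>vs. outer (lin B v) p q) = (\<Sum>r\<in>UNIV. \<Sum>s\<in>UNIV. B r p * (\<Sum>v\<leftarrow>vs. outer v r s) * cnj (B s q))"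
    unfolding lin_outer[symmetric]
    by (induction vs) (simp_all add: algebra_simps sum.distrib)
  also have "\<dots> = (\<Sum>r\<in>UNIV. \<Sum>s\<in>UNIV. \<Sum>a\<in>UNIV. \<Sum>b\<in>UNIV. ?g r s a b)"
    unfolding assms(2)[symmetric] sesq_def sum_distrib_left sum_distrib_right
    by (intro sum.cong refl) (simp add: mult_ac)
  also have "\<dots> = (\<Sum>r\<in>UNIV. \<Sum>a\<in>UNIV. \<Sum>s\<in>UNIV. \<Sum>b\<in>UNIV. ?g r s a b)"
    by (rule sum.cong[OF refl], rule sum.swap)
  also have "\<dots> = (\<Sum>a\<in>UNIV. \<Sum>r\<in>UNIV. \<Sum>s\<in>UNIV. \<Sum>b\<in>UNIV. ?g r s a b)"
    by (rule sum.swap)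
  also have "\<dots> = (\<Sum>a\<in>UNIV. \<Sum>r\<in>UNIV. \<Sum>b\<in>UNIV. \<Sum>s\<in>UNIV. ?g r s a b)"
    by (rule sum.cong[OF refl], rule sum.cong[OF refl], rule sum.swap)
  also have "\<dots> = (\<Sum>a\<in>UNIV. (\<Sum>r\<in>UNIV. B r p * cnj (B' r a)) * (\<Sum>b\<in>UNIV. K a b * cnj (\<Sum>s\<in>UNIV. B s q * cnj (B' s b))))"
    unfolding cnj_sum sum_product by (simp only: sum_distrib_left)
  also have "\<dots> = K p q" unfolding d2 d1 ..
  finally show ?thesis ..
qed

lemma lin_pbasis_prodv:
  "lin (pbasis e f) (prodv g h) = prodv (\<lambda>k. \<Sum>i\<in>UNIV. g i * e i k) (\<lambda>l. \<Sum>j\<in>UNIV. h j * f j l)"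
  by (intro ext) (simp add: lin_def pbasis_def prodv_def sum_qq UNIV_bool algebra_simps)

text \<open>Separability is invariant under invertible local changes of frame, not only unitary
  ones. This is what permits a local filter to normalize the kernel vector.\<close>

lemma sepc_local_transform:
  assumes e: "\<And>k l. (\<Sum>i\<in>UNIV. e i k * cnj (e' i l)) = (if k = l then 1 else 0)"
    and f: "\<And>k l. (\<Sum>i\<in>UNIV. f i k * cnj (f' i l)) = (if k = l then 1 else 0)"
    and sep: "sepc (\<lambda>p q. sesq K (pbasis e' f' p) (pbasis e' f' q))"
  shows "sepc K"
proof -
  obtain xs where xs: "\<And>p q. sesq K (pbasis e' f' p) (pbasis e' f' q) = (\<Sum>(g, h)\<leftarrow>xs. outer (prodv g h) p q)"
    using sep unfolding sepc_def by blast
  have "(\<Sum>r\<in>UNIV. pbasis e f r p * cnj (pbasis e' f' r q)) = (if p = q then 1 else 0)" for p q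
  proof -
    have "(\<Sum>r\<in>UNIV. pbasis e f r p * cnj (pbasis e' f' r q))
        = (\<Sum>i\<in>UNIV. e i (fst p) * cnj (e' i (fst q))) * (\<Sum>j\<in>UNIV. f j (snd p) * cnj (f' j (snd q)))"
      by (simp add: pbasis_def prodv_def sum_qq UNIV_bool algebra_simps)
    then show ?thesis by (simp add: e f prod_eq_iff)
  qed
  from frame_reconstruct[OF this, of K "map (\<lambda>(g, h). prodv g h) xs"]
  have "K p q = (\<Sum>(g, h)\<leftarrow>xs. outer (lin (pbasis e f) (prodv g h)) p q)" for p q
    by (simp add: xs o_def case_prod_unfold)
  then show ?thesis unfolding sepc_def lin_pbasis_prodv
    by (intro exI[of _ "map (\<lambda>(g, h). (\<lambda>k. \<Sum>i\<in>UNIV. g i * e i k, \<lambda>l. \<Sum>j\<in>UNIV. h j * f j l)) xs"])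
      (simp add: o_def case_prod_unfold)
qed

lemma pos_transform: "pos K \<Longrightarrow> pos (\<lambda>p q. sesq K (B p) (B q))"
  for B :: "qq \<Rightarrow> qq \<Rightarrow> complex"
  unfolding pos_def sesq_lin[symmetric] by blast

lemma pt_transform:
  "pt (\<lambda>p q. sesq K (pbasis e f p) (pbasis e f q))
    = (\<lambda>p q. sesq (pt K) (pbasis e (\<lambda>j. cnjv (f j)) p) (pbasis e (\<lambda>j. cnjv (f j)) q))"
  by (intro ext) (simp add: pt_def pbasis_def sesq_pt_prodv)

subsection \<open>A product vector in the kernel\<close>

text \<open>The vanishing corner belongs to \<open>K\<close> and to its partial transpose, so the
  first row of both is zero. For the transpose this removes the coherence between 01 and 10, and
  every remaining Cholesky vector is then a product.\<close>

lemma sepc_corner: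
  assumes K: "pos K" and P: "pos (pt K)" and z: "K (False, False) (False, False) = 0"
  shows "sepc K"
proof -
  let ?a = "(False, False)" and ?b = "(False, True)" and ?c = "(True, False)" and ?d = "(True, True)"
  have row: "K ?a q = 0" "K q ?a = 0" for q using pos_zero_pivot[OF K z] by auto
  have "pt K ?a ?d = 0" by (rule pos_zero_pivot(1)[OF P]) (simp add: pt_def z)
  then have bc: "K ?b ?c = 0" by (simp add: pt_def)
  then have cb: "K ?c ?b = 0" using pos_hermitian_entry[OF K, of ?c ?b] by simp
  define L where "L = schur K ?b"
  have L: "pos L" unfolding L_def by (rule pos_schur[OF K])
  define M where "M = schur L ?c"
  have M: "pos M" unfolding M_def by (rule pos_schur[OF L])
  have Lz: "L ?a q = 0" "L q ?a = 0" "L ?b q = 0" "L q ?b = 0" for q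
    using row schur_pivot_row[OF K] by (auto simp: L_def schur_def outer_pivot[OF K])
  have Mz: "M ?a q = 0" "M q ?a = 0" "M ?b q = 0" "M q ?b = 0" "M ?c q = 0" "M q ?c = 0" for q
    using Lz schur_pivot_row[OF L] by (auto simp: M_def schur_def outer_pivot[OF L])
  \<comment> \<open>This vector lives on 01 and 11 and the next one on 10 and 11, so one tensor
    factor is the second basis vector in each case; what remains is a multiple of the projector onto
    11.\<close>
  have "pivot K ?b = prodv (\<lambda>i. pivot K ?b (i, True)) (single True)"
    using row cb by (auto simp: fun_eq_iff prodv_def single_def pivot_def) (metis (full_types))
  then have 1: "sepc (outer (pivot K ?b))" by (metis sepc_outer)
  have "pivot L ?c = prodv (single True) (\<lambda>j. pivot L ?c (True, j))"
    using Lz by (auto simp: fun_eq_iff prodv_def single_def pivot_def) (metis (full_types))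
  then have 2: "sepc (outer (pivot L ?c))" by (metis sepc_outer)
  have "M p q = complex_of_real (Re (M ?d ?d)) * outer (prodv (single True) (single True)) p q" for p q
    using Mz pos_diag(1)[OF M, of ?d]
    by (cases p rule: qq_cases; cases q rule: qq_cases) (simp_all add: outer_def prodv_def single_def)
  then have 3: "sepc M"
    using sepc_scale[OF sepc_outer pos_diag(2)[OF M, of ?d], of "single True" "single True"]
    by (metis (no_types, lifting) ext)
  have "K = (\<lambda>p q. outer (pivot K ?b) p q + (outer (pivot L ?c) p q + M p q))"
    by (intro ext) (simp add: M_def L_def schur_def)
  then show ?thesis using sepc_add[OF 1 sepc_add[OF 2 3]] by simp
qed

lemma sepc_product_kernel:
  assumes K: "pos K" and P: "pos (pt K)" and z: "Re (sesq K (prodv g h) (prodv g h)) = 0"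
    and nz: "norm2 g \<noteq> 0" "norm2 h \<noteq> 0"
  shows "sepc K"
proof -
  define u where "u i = g i / complex_of_real (sqrt (norm2 g))" for i
  define v where "v i = h i / complex_of_real (sqrt (norm2 h))" for i
  have n1: "norm2 (\<lambda>i. x i / complex_of_real (sqrt (norm2 x))) = 1" if "norm2 x \<noteq> 0" for x :: "bool \<Rightarrow> complex"
    using that norm2_scale[of "1 / complex_of_real (sqrt (norm2 x))" x]
    by (simp add: norm_divide power_divide)
  have u: "norm2 u = 1" and v: "norm2 v = 1" using nz n1 by (simp_all add: u_def[abs_def] v_def[abs_def])
  let ?e = "basis2 u 1" and ?f = "basis2 v 1"
  have e: "onb ?e" and f: "onb ?f" using u v by (auto intro: onb_basis2)
  define c where "c = 1 / (complex_of_real (sqrt (norm2 g)) * complex_of_real (sqrt (norm2 h)))"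
  have "pbasis ?e ?f (False, False) = (\<lambda>p. c * prodv g h p)"
    by (intro ext) (simp add: pbasis_def basis2_def prodv_def u_def v_def c_def)
  then have "sesq K (pbasis ?e ?f (False, False)) (pbasis ?e ?f (False, False)) = 0"
    using z pos_null(1)[OF K z, of "prodv g h"] by (simp add: sesq_scale_left sesq_scale_right)
  then have "sepc (\<lambda>p q. sesq K (pbasis ?e ?f p) (pbasis ?e ?f q))"
    by (intro sepc_corner) (simp_all add: pos_transform K P pt_transform)
  moreover have "(\<Sum>i\<in>UNIV. ?e i k * cnj (?e i l)) = (if k = l then 1 else 0)"
    "(\<Sum>i\<in>UNIV. ?f i k * cnj (?f i l)) = (if k = l then 1 else 0)" for k l
    using e f unfolding onb_def by blast+
  ultimately show ?thesis by (rule sepc_local_transform[rotated 2])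
qed

subsection \<open>A singlet in the kernel\<close>

definition hermv :: "(qq \<Rightarrow> complex) \<Rightarrow> bool" where
  "hermv h \<longleftrightarrow> transp (cnjv h) = h"

lemma hermvD: "hermv h \<Longrightarrow> h (j, i) = cnj (h (i, j))"
  by (auto simp: hermv_def fun_eq_iff transp_def cnjv_def)

lemma hermv_combine: "hermv g \<Longrightarrow> hermv h \<Longrightarrow> hermv (\<lambda>p. complex_of_real a * g p + complex_of_real b * h p)"
  by (simp add: hermv_def fun_eq_iff transp_def cnjv_def)

lemma hermv_det2: "hermv h \<Longrightarrow> Im (det2 h) = 0"
proof -
  assume h: "hermv h"
  then have "h (False, False) = cnj (h (False, False))" "h (True, True) = cnj (h (True, True))"
    "h (True, False) = cnj (h (False, True))"
    using hermvD by blast+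
  then show ?thesis by (simp add: det2_def complex_eq_iff)
qed

text \<open>Determinants of Hermitian matrices are real, and they change sign on the segment from
  \<open>g\<close> to \<open>h\<close>, so some combination is singular. Normalized, it is one half
  of a real rotation of the pair, which preserves the sum of projectors and, the determinant being a
  quadratic form, the sum of determinants.\<close>

lemma rotate_to_det2_0:
  assumes "hermv g" "hermv h" "Re (det2 g) * Re (det2 h) < 0"
  obtains k l where "hermv k" "hermv l" "det2 k = 0" "\<And>p q. outer g p q + outer h p q = outer k p q + outer l p q"
    "det2 g + det2 h = det2 k + det2 l"
proof -
  define \<phi> where "\<phi> t = Re (det2 (\<lambda>p. complex_of_real (1 - t) * g p + complex_of_real t * h p))" for t
  have cont: "continuous_on {0..1} \<phi>"
    unfolding \<phi>_def det2_def by (intro continuous_intros)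
  have 01: "\<phi> 0 = Re (det2 g)" "\<phi> 1 = Re (det2 h)" by (simp_all add: \<phi>_def)
  obtain t where t: "\<phi> t = 0"
  proof (cases "\<phi> 0 \<le> 0")
    case True
    then have "0 \<le> \<phi> 1" using assms(3) unfolding 01 by (simp add: mult_less_0_iff)
    then show ?thesis using IVT'[of \<phi> 0 0 1] True cont that by auto
  next
    case False
    then have "\<phi> 1 \<le> 0" "0 \<le> \<phi> 0" using assms(3) unfolding 01 by (auto simp: mult_less_0_iff)
    then show ?thesis using IVT2'[of \<phi> 1 0 0] cont that by auto
  qed
  define n where "n = sqrt ((1 - t)\<^sup>2 + t\<^sup>2)"
  have "(1 - t)\<^sup>2 + t\<^sup>2 \<noteq> 0" by (simp add: sum_power2_eq_zero_iff)
  then have n: "n\<^sup>2 = (1 - t)\<^sup>2 + t\<^sup>2" "n \<noteq> 0" by (simp_all add: n_def)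
  define a where "a = (1 - t) / n"
  define b where "b = t / n"
  have ab: "a * a + b * b = 1"
    using n by (simp add: a_def b_def power2_eq_square flip: add_divide_distrib)
  let ?k = "\<lambda>p. complex_of_real a * g p + complex_of_real b * h p"
  let ?l = "\<lambda>p. complex_of_real (- b) * g p + complex_of_real a * h p"
  have ab': "complex_of_real a * complex_of_real a + complex_of_real b * complex_of_real b = 1"
    using ab by (metis of_real_1 of_real_add of_real_mult)
  show ?thesis
  proof (rule that[of ?k ?l])
    show k: "hermv ?k" by (rule hermv_combine[OF assms(1,2)])
    show "hermv ?l" by (rule hermv_combine[OF assms(1,2)])
    have "?k = (\<lambda>p. complex_of_real (1 / n) * (complex_of_real (1 - t) * g p + complex_of_real t * h p))"
      by (simp add: a_def b_def distrib_left)
    then have "det2 ?k = complex_of_real (1 / n) * complex_of_real (1 / n) * det2 (\<lambda>p. complex_of_real (1 - t) * g p + complex_of_real t * h p)"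
      by (simp only:) (simp only: det2_def, simp only: algebra_simps)
    then have "Re (det2 ?k) = 0" using t by (simp add: \<phi>_def del: of_real_diff)
    then show "det2 ?k = 0" using hermv_det2[OF k] by (simp add: complex_eq_iff)
    show "outer g p q + outer h p q = outer ?k p q + outer ?l p q" for p q
    proof -
      have "outer ?k p q + outer ?l p q
          = (complex_of_real a * complex_of_real a + complex_of_real b * complex_of_real b) * (outer g p q + outer h p q)"
        by (simp add: outer_def algebra_simps)
      then show ?thesis by (simp add: ab')
    qed
    have "det2 ?k + det2 ?l
        = (complex_of_real a * complex_of_real a + complex_of_real b * complex_of_real b) * (det2 g + det2 h)"
      by (simp add: det2_def algebra_simps)
    then show "det2 g + det2 h = det2 ?k + det2 ?l" by (simp add: ab')
  qed
qed

text \<open>A nonzero determinant forces one of opposite sign elsewhere in the list. Rotating this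
  pair makes one matrix singular, hence a product vector; the other returns to the list, whose total
  stays 0 while its length drops by one.\<close>

lemma balance_determinants:
  assumes "\<And>h. h \<in> set hs \<Longrightarrow> hermv h" "(\<Sum>h\<leftarrow>hs. det2 h) = 0"
  shows "sepc (\<lambda>p q. \<Sum>h\<leftarrow>hs. outer h p q)"
  using assms
proof (induction "length hs" arbitrary: hs)
  case 0
  then show ?case by (auto simp: sepc_def intro: exI[of _ "[]"])
next
  case (Suc n)
  then obtain h hs' where hs: "hs = h # hs'" "n = length hs'" by (cases hs) auto
  have h: "hermv h" "\<And>g. g \<in> set hs' \<Longrightarrow> hermv g" using Suc.prems hs by auto
  show ?case
  proof (cases "det2 h = 0")
    case True
    then have "sepc (\<lambda>p q. \<Sum>h\<leftarrow>hs'. outer h p q)"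
      using Suc.hyps(1)[OF hs(2) h(2)] Suc.prems(2) hs by simp
    moreover have "sepc (outer h)" using product_of_det2_0[OF True] sepc_outer by metis
    ultimately show ?thesis using sepc_add[of "outer h"] by (simp add: hs)
  next
    case False
    have im: "Im (det2 h) = 0" by (rule hermv_det2[OF h(1)])
    have "\<exists>g\<in>set hs'. Re (det2 h) * Re (det2 g) < 0"
    proof (rule ccontr)
      assume "\<not> ?thesis"
      then have "0 \<le> (\<Sum>g\<leftarrow>hs'. Re (det2 h) * Re (det2 g))"
        by (intro sum_list_nonneg) (auto simp: not_less)
      also have "(\<Sum>g\<leftarrow>hs'. Re (det2 h) * Re (det2 g)) = Re (det2 h) * Re (\<Sum>g\<leftarrow>hs'. det2 g)"
        by (induction hs') (simp_all add: algebra_simps)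
      also have "(\<Sum>g\<leftarrow>hs'. det2 g) = - det2 h"
        using Suc.prems(2) by (simp add: hs eq_neg_iff_add_eq_0 add.commute)
      finally have "Re (det2 h) * Re (det2 h) \<le> 0" by simp
      then show False using False im by (auto simp: complex_eq_iff mult_le_0_iff)
    qed
    then obtain g where g: "g \<in> set hs'" "Re (det2 h) * Re (det2 g) < 0" by blast
    obtain k l where kl: "hermv k" "hermv l" "det2 k = 0"
      "\<And>p q. outer h p q + outer g p q = outer k p q + outer l p q" "det2 h + det2 g = det2 k + det2 l"
      using rotate_to_det2_0[OF h(1) h(2)[OF g(1)] g(2)] by blast
    let ?r = "remove1 g hs'"
    have "sepc (\<lambda>p q. \<Sum>h\<leftarrow>l # ?r. outer h p q)"
    proof (rule Suc.hyps(1))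
      show "n = length (l # ?r)" using g(1) hs(2) length_pos_if_in_set[OF g(1)] by (simp add: length_remove1)
      show "hermv x" if "x \<in> set (l # ?r)" for x
        using that kl(2) h(2) set_remove1_subset[of g hs'] by auto
      have "(\<Sum>h\<leftarrow>hs. det2 h) = det2 h + (det2 g + (\<Sum>h\<leftarrow>?r. det2 h))"
        using sum_list_map_remove1[OF g(1), of det2] by (simp add: hs)
      also have "\<dots> = (\<Sum>h\<leftarrow>l # ?r. det2 h)" using kl(3,5) by (simp add: add.assoc[symmetric])
      finally show "(\<Sum>h\<leftarrow>l # ?r. det2 h) = 0" using Suc.prems(2) by simp
    qed
    moreover have "sepc (outer k)" using product_of_det2_0[OF kl(3)] sepc_outer by metis
    ultimately have "sepc (\<lambda>p q. outer k p q + (\<Sum>h\<leftarrow>l # ?r. outer h p q))"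
      using sepc_add by blast
    moreover have "outer k p q + (\<Sum>h\<leftarrow>l # ?r. outer h p q) = (\<Sum>h\<leftarrow>hs. outer h p q)" for p q
      using sum_list_map_remove1[OF g(1), of "\<lambda>h. outer h p q"] kl(4)[of p q]
      by (simp add: hs add.assoc[symmetric])
    ultimately show ?thesis by simp
  qed
qed

text \<open>A basis of Hermitian matrices: two diagonal matrix units and two off-diagonal Pauli
  matrices up to sign, the latter scaled by \<open>c\<close>. The choices \<open>c = 1\<close> and
  \<open>c = 1 / 2\<close> are dual to each other.\<close>

definition pauli :: "complex \<Rightarrow> qq \<Rightarrow> qq \<Rightarrow> complex" where
  "pauli c r = (if r = (False, True) then (\<lambda>p. c * (single (False, True) p + single (True, False) p))
     else if r = (True, False) then (\<lambda>p. c * (\<i> * single (False, True) p - \<i> * single (True, False) p))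
     else single r)"

definition singlet :: "qq \<Rightarrow> complex" where
  "singlet p = single (False, True) p - single (True, False) p"

text \<open>A kernel annihilating the antisymmetric vector is unchanged when the qubits are
  exchanged in either argument. Together with Hermitian symmetry this makes \<open>pt K\<close>
  compatible with the conjugation that sends a matrix to its adjoint.\<close>

lemma sesq_pt_transp_cnjv:
  assumes K: "pos K" and z: "Re (sesq K singlet singlet) = 0"
  shows "sesq (pt K) (transp (cnjv x)) (transp (cnjv y)) = cnj (sesq (pt K) x y)"
proof -
  let ?b = "(False, True)" and ?c = "(True, False)"
  have "K p ?b = K p ?c" for p
    using pos_null(1)[OF K z, of "single p"]
    by (simp add: sesq_single_left singlet_def single_def sum_qq UNIV_bool)
  then have r: "K p (j, i) = K p (i, j)" for p i j by (cases i; cases j) auto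
  then have l: "K (j, i) p = K (i, j) p" for p i j
    using pos_hermitian_entry[OF K] by metis
  have "cnj (pt K (i, j) (k, l)) = pt K (j, i) (l, k)" for i j k l
  proof -
    have "cnj (pt K (i, j) (k, l)) = K (k, j) (i, l)"
      using pos_hermitian_entry[OF K, of "(k, j)" "(i, l)"] by (simp add: pt_def)
    also have "\<dots> = K (j, k) (l, i)" using r l by metis
    finally show ?thesis by (simp add: pt_def)
  qed
  note c = this
  have "cnj (sesq (pt K) x y) = (\<Sum>i\<in>UNIV. \<Sum>j\<in>UNIV. \<Sum>k\<in>UNIV. \<Sum>l\<in>UNIV. x (i, j) * cnj (pt K (i, j) (k, l)) * cnj (y (k, l)))"
    by (simp add: sesq_def sum_qq)
  also have "\<dots> = (\<Sum>i\<in>UNIV. \<Sum>j\<in>UNIV. \<Sum>k\<in>UNIV. \<Sum>l\<in>UNIV. x (i, j) * pt K (j, i) (l, k) * cnj (y (k, l)))"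
    unfolding c ..
  also have "\<dots> = sesq (pt K) (transp (cnjv x)) (transp (cnjv y))"
    by (simp add: sesq_def sum_qq transp_def cnjv_def UNIV_bool algebra_simps)
  finally show ?thesis ..
qed

text \<open>If the singlet is in the kernel of \<open>K\<close>, then \<open>K\<^sup>\<Gamma>\<close> is real with respect to \<open>h \<mapsto> h\<^sup>\<dagger>\<close>, so it is
  a sum of \<open>|h><h|\<close> with Hermitian \<open>h\<close>; the singlet condition becomes \<open>\<Sum> det h = 0\<close>.\<close>

lemma sepc_singlet_kernel:
  assumes K: "pos K" and P: "pos (pt K)" and z: "Re (sesq K singlet singlet) = 0"
  shows "sepc K"
proof -
  \<comment> \<open>The coefficients of \<open>pt K\<close> in the basis dual to
    \<open>pauli 1\<close>. They are real, so the Cholesky vectors are real combinations of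
    Hermitian matrices.\<close>
  define T where "T r s = sesq (pt K) (pauli (1 / 2) r) (pauli (1 / 2) s)" for r s
  have hp: "transp (cnjv (pauli (complex_of_real t) r)) = pauli (complex_of_real t) r" for t r
    by (cases r rule: qq_cases) (auto simp: fun_eq_iff transp_def cnjv_def pauli_def single_def)
  have hp2: "transp (cnjv (pauli (1 / 2) r)) = pauli (1 / 2) r" for r
    using hp[of "1 / 2" r] by simp
  have "pos T" unfolding T_def[abs_def] by (rule pos_transform[OF P])
  moreover have "Im (T r s) = 0" for r s
    using sesq_pt_transp_cnjv[OF K z, of "pauli (1 / 2) r" "pauli (1 / 2) s"]
    unfolding hp2 T_def[symmetric] by (simp add: complex_eq_iff)
  ultimately obtain vs where vs: "\<forall>r s. T r s = (\<Sum>v\<leftarrow>vs. outer v r s)" "\<forall>v\<in>set vs. \<forall>p. Im (v p) = 0"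
    using pos_decomp[of T] by blast
  let ?h = "lin (pauli 1)"
  have rec: "(\<Sum>r\<in>UNIV. pauli 1 r p * cnj (pauli (1 / 2) r q)) = (if p = q then 1 else 0)" for p q
    by (cases p rule: qq_cases; cases q rule: qq_cases)
      (simp_all add: sum_qq UNIV_bool pauli_def single_def)
  have S: "pt K p q = (\<Sum>v\<leftarrow>vs. outer (?h v) p q)" for p q
    by (rule frame_reconstruct[OF rec]) (rule vs(1)[unfolded T_def, rule_format])
  have herm: "hermv (?h v)" if "v \<in> set vs" for v
  proof -
    have "cnj (v p) = v p" for p using vs(2)[rule_format, OF that, of p] by (simp add: complex_eq_iff)
    then show ?thesis using hp[of 1]
      unfolding hermv_def lin_def
      by (auto simp: fun_eq_iff transp_def cnjv_def)
  qed
  have d: "sesq (pt (outer h)) singlet singlet = - 2 * det2 h" if "hermv h" for h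
  proof -
    have "h (False, False) = cnj (h (False, False))" "h (True, True) = cnj (h (True, True))"
      "h (True, False) = cnj (h (False, True))"
      using hermvD[OF that] by blast+
    moreover have "sesq (pt (outer h)) singlet singlet
      = h (False, True) * cnj (h (False, True)) - h (False, False) * cnj (h (True, True))
        - h (True, True) * cnj (h (False, False)) + h (True, False) * cnj (h (True, False))"
      by (simp add: sesq_def sum_qq UNIV_bool singlet_def single_def pt_def outer_def)
    ultimately show ?thesis by (simp add: det2_def algebra_simps)
  qed
  have "K = pt (\<lambda>p q. \<Sum>v\<leftarrow>vs. outer (?h v) p q)"
    using S by (metis (no_types, lifting) ext pt_pt)
  then have "sesq K singlet singlet = (\<Sum>v\<leftarrow>vs. sesq (pt (outer (?h v))) singlet singlet)"
    by (simp only: pt_sum_list sesq_sum_list)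
  also have "\<dots> = (\<Sum>v\<leftarrow>vs. - 2 * det2 (?h v))"
    using herm d by (intro arg_cong[where f = sum_list] map_cong) auto
  also have "\<dots> = - 2 * (\<Sum>v\<leftarrow>vs. det2 (?h v))" by (simp only: sum_list_const_mult)
  finally have "(\<Sum>v\<leftarrow>vs. det2 (?h v)) = 0"
    using pos_null(1)[OF K z, of singlet] by simp
  then have "sepc (\<lambda>p q. \<Sum>h\<leftarrow>map ?h vs. outer h p q)"
    using herm by (intro balance_determinants) (auto simp: o_def)
  then have "sepc (pt K)" using S by (simp add: o_def flip: fun_eq_iff) (metis (no_types, lifting) ext)
  then show ?thesis using sepc_pt by fastforce
qed

text \<open>With \<open>x\<close> read as an invertible matrix, an invertible operator on the first
  qubit maps the singlet to \<open>x\<close>; undoing it reduces to the singlet case.\<close>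

lemma sepc_nonproduct_kernel:
  assumes K: "pos K" and P: "pos (pt K)" and z: "Re (sesq K x x) = 0" and nz: "det2 x \<noteq> 0"
  shows "sepc K"
proof -
  define e' where "e' i k = (if i then - x (k, False) else x (k, True))" for i k
  \<comment> \<open>The conjugated cofactors of \<open>e'\<close>; divided by the conjugated
    determinant they form the frame dual to \<open>e'\<close>.\<close>
  define E where "E i k = (if i then (if k then cnj (x (False, True)) else - cnj (x (True, True)))
      else (if k then cnj (x (False, False)) else - cnj (x (True, False))))" for i k
  define e where "e i k = E i k / cnj (det2 x)" for i k
  have "(\<Sum>i\<in>UNIV. E i k * cnj (e' i l)) = (if k = l then cnj (det2 x) else 0)" for k l
    by (cases k; cases l) (simp_all add: UNIV_bool E_def e'_def det2_def)
  then have ee: "(\<Sum>i\<in>UNIV. e i k * cnj (e' i l)) = (if k = l then 1 else 0)" for k l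
    using nz by (simp add: e_def flip: sum_divide_distrib)
  have ss: "(\<Sum>i\<in>UNIV. single i k * cnj (single i l)) = (if k = l then 1 else 0)" for k l :: bool
    by (cases k; cases l) (simp_all add: UNIV_bool single_def)
  let ?L = "\<lambda>p q. sesq K (pbasis e' single p) (pbasis e' single q)"
  have "lin (pbasis e' single) singlet = x"
  proof
    fix p
    show "lin (pbasis e' single) singlet p = x p"
      by (cases p rule: qq_cases)
        (simp_all add: lin_def pbasis_def prodv_def e'_def single_def singlet_def sum_qq UNIV_bool)
  qed
  then have "Re (sesq ?L singlet singlet) = 0" using z by (simp flip: sesq_lin)
  then have "sepc ?L"
    by (intro sepc_singlet_kernel) (simp_all add: pos_transform K P pt_transform)
  then show ?thesis using sepc_local_transform[OF ee ss] by blast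
qed

lemma sepc_singular:
  assumes "pos K" "pos (pt K)" "Re (sesq K x x) = 0" "x p \<noteq> 0"
  shows "sepc K"
proof (cases "det2 x = 0")
  case True
  then obtain g h where gh: "x = prodv g h" using product_of_det2_0 by blast
  then have "norm2 g \<noteq> 0" "norm2 h \<noteq> 0" using assms(4) by (auto simp: prodv_def norm2_eq_0_iff)
  then show ?thesis using sepc_product_kernel[OF assms(1,2)] assms(3) gh by blast
next
  case False
  then show ?thesis using sepc_nonproduct_kernel[OF assms(1-3)] by blast
qed

subsection \<open>Subtracting a product vector until the kernel is nontrivial\<close>

lemma cdot_add_single: "cdot (\<lambda>p. x p + c * single r p) w = cdot x w + cnj c * w r"
proof -
  have "cdot (\<lambda>p. x p + c * single r p) w = cdot x w + (\<Sum>p\<in>UNIV. (cnj c * w p) * single r p)"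
    by (simp add: cdot_def algebra_simps sum.distrib)
  then show ?thesis by (simp only: sum_single)
qed

lemma orthogonalize:
  assumes "w r = 0 \<Longrightarrow> \<forall>p. w p = 0"
  obtains c where "cdot (\<lambda>p. x p + c * single r p) w = 0"
proof (cases "w r = 0")
  case True
  then have "cdot (\<lambda>p. x p + 0 * single r p) w = 0" using assms by (simp add: cdot_def)
  then show ?thesis by (rule that)
next
  case False
  then have "cdot (\<lambda>p. x p + (- cnj (cdot x w / w r)) * single r p) w = 0"
    unfolding cdot_add_single by simp
  then show ?thesis by (rule that)
qed

lemma pivot_zero:
  assumes "pos K" "pivot K r r = 0"
  shows "\<forall>p. pivot K r p = 0"
proof -
  have "K r r = 0"
  proof (rule ccontr)
    assume "K r r \<noteq> 0"
    moreover have "Re (K r r) \<noteq> 0" using calculation pos_diag(1)[OF assms(1), of r] by (metis of_real_0)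
    ultimately show False using assms(2) by (simp add: pivot_def)
  qed
  then show ?thesis by (simp add: pivot_def pos_zero_pivot(2)[OF assms(1)])
qed

text \<open>Three elimination steps at the indices other than 00 leave a multiple
  \<open>\<kappa>\<close> of the projector onto 00. What is subtracted from \<open>K\<close> is this
  remainder, so only three pivot vectors survive, and in dimension four some \<open>x\<close> is
  orthogonal to all of them.\<close>

lemma corner_subtract:
  assumes "pos K"
  obtains \<kappa> x where "0 \<le> \<kappa>" "x (False, False) \<noteq> 0"
    "pos (\<lambda>p q. K p q - complex_of_real \<kappa> * outer (single (False, False)) p q)"
    "Re (sesq (\<lambda>p q. K p q - complex_of_real \<kappa> * outer (single (False, False)) p q) x x) = 0"
proof -
  let ?a = "(False, False)" and ?b = "(False, True)" and ?c = "(True, False)" and ?d = "(True, True)"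
  define L where "L = schur K ?b"
  define M where "M = schur L ?c"
  define N where "N = schur M ?d"
  have L: "pos L" unfolding L_def by (rule pos_schur[OF assms])
  have M: "pos M" unfolding M_def by (rule pos_schur[OF L])
  have N: "pos N" unfolding N_def by (rule pos_schur[OF M])
  have Lz: "L ?b q = 0" "L q ?b = 0" for q
    using schur_pivot_row[OF assms] by (auto simp: L_def)
  have Mz: "M ?b q = 0" "M q ?b = 0" "M ?c q = 0" "M q ?c = 0" for q
    using Lz schur_pivot_row[OF L] by (auto simp: M_def schur_def outer_pivot[OF L])
  have Nz: "N ?b q = 0" "N q ?b = 0" "N ?c q = 0" "N q ?c = 0" "N ?d q = 0" "N q ?d = 0" for q
    using Mz schur_pivot_row[OF M] by (auto simp: N_def schur_def outer_pivot[OF M])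
  define \<kappa> where "\<kappa> = Re (N ?a ?a)"
  have Neq: "N p q = complex_of_real \<kappa> * outer (single ?a) p q" for p q
    using Nz pos_diag(1)[OF N, of ?a]
    by (cases p rule: qq_cases; cases q rule: qq_cases) (simp_all add: outer_def single_def \<kappa>_def)
  have diff: "(\<lambda>p q. K p q - complex_of_real \<kappa> * outer (single ?a) p q)
      = (\<lambda>p q. outer (pivot K ?b) p q + (outer (pivot L ?c) p q + outer (pivot M ?d) p q))"
    unfolding Neq[symmetric] by (intro ext) (simp add: N_def M_def L_def schur_def)
  \<comment> \<open>Back substitution in a triangular system: the pivot of \<open>M\<close> vanishes
    at 01 and 10 and that of \<open>L\<close> at 01, so later corrections do not disturb earlier
    ones. The component of \<open>x\<close> at 00 stays 1.\<close>
  obtain c3 where c3: "cdot (\<lambda>p. single ?a p + c3 * single ?d p) (pivot M ?d) = 0"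
    using orthogonalize[of "pivot M ?d" ?d] pivot_zero[OF M] by blast
  obtain c2 where c2: "cdot (\<lambda>p. single ?a p + c3 * single ?d p + c2 * single ?c p) (pivot L ?c) = 0"
    using orthogonalize[of "pivot L ?c" ?c "\<lambda>p. single ?a p + c3 * single ?d p"] pivot_zero[OF L] by blast
  obtain c1 where c1: "cdot (\<lambda>p. single ?a p + c3 * single ?d p + c2 * single ?c p + c1 * single ?b p) (pivot K ?b) = 0"
    using orthogonalize[of "pivot K ?b" ?b "\<lambda>p. single ?a p + c3 * single ?d p + c2 * single ?c p"]
      pivot_zero[OF assms] by blast
  define x where "x p = single ?a p + c3 * single ?d p + c2 * single ?c p + c1 * single ?b p" for p
  have "cdot x (pivot K ?b) = 0" using c1 by (simp add: x_def[abs_def])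
  moreover have "cdot x (pivot L ?c) = 0"
    using c2 by (simp add: x_def[abs_def] cdot_add_single) (simp add: pivot_def Lz)
  moreover have "cdot x (pivot M ?d) = 0"
    using c3 by (simp add: x_def[abs_def] cdot_add_single) (simp add: pivot_def Mz)
  ultimately have "Re (sesq (\<lambda>p q. K p q - complex_of_real \<kappa> * outer (single ?a) p q) x x) = 0"
    unfolding diff by (simp add: sesq_plus sesq_outer_self)
  moreover have "pos (\<lambda>p q. K p q - complex_of_real \<kappa> * outer (single ?a) p q)"
    unfolding diff by (intro pos_add pos_outer)
  moreover have "x ?a \<noteq> 0" by (simp add: x_def single_def)
  moreover have "0 \<le> \<kappa>" using pos_diag(2)[OF N] by (simp add: \<kappa>_def)
  ultimately show ?thesis using that by blast
qed

lemma pos_subtract_less: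
  assumes "pos (\<lambda>p q. K p q - complex_of_real \<kappa> * outer w p q)" "t \<le> \<kappa>"
  shows "pos (\<lambda>p q. K p q - complex_of_real t * outer w p q)"
  unfolding pos_def
proof
  fix x
  have "0 \<le> sesq (\<lambda>p q. K p q - complex_of_real \<kappa> * outer w p q) x x"
    by (rule posD[OF assms(1)])
  then have 1: "0 \<le> sesq K x x - complex_of_real (\<kappa> * (cmod (cdot x w))\<^sup>2)"
    by (simp add: sesq_minus sesq_scale sesq_outer_self)
  have "t * (cmod (cdot x w))\<^sup>2 \<le> \<kappa> * (cmod (cdot x w))\<^sup>2"
    using assms(2) by (intro mult_right_mono) auto
  then have "0 \<le> sesq K x x - complex_of_real (t * (cmod (cdot x w))\<^sup>2)"
    using 1 by (simp add: less_eq_complex_def del: of_real_mult)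
  then show "0 \<le> sesq (\<lambda>p q. K p q - complex_of_real t * outer w p q) x x"
    by (simp add: sesq_minus sesq_scale sesq_outer_self)
qed

theorem Peres_Horodecki:
  assumes K: "pos K" and P: "pos (pt K)"
  shows "sepc K"
proof -
  let ?a = "(False, False)"
  let ?sub = "\<lambda>K t p q. K p q - complex_of_real t * outer (single ?a) p q"
  obtain \<kappa> x where 1: "0 \<le> \<kappa>" "x ?a \<noteq> 0" "pos (?sub K \<kappa>)" "Re (sesq (?sub K \<kappa>) x x) = 0"
    using corner_subtract[OF K] by blast
  obtain \<mu> y where 2: "0 \<le> \<mu>" "y ?a \<noteq> 0" "pos (?sub (pt K) \<mu>)" "Re (sesq (?sub (pt K) \<mu>) y y) = 0"
    using corner_subtract[OF P] by blast
  have pts: "pt (?sub L t) = ?sub (pt L) t" for L t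
  proof (intro ext)
    fix p q
    show "pt (?sub L t) p q = ?sub (pt L) t p q"
      by (cases p rule: qq_cases; cases q rule: qq_cases) (simp_all add: pt_def outer_def single_def)
  qed
  have "single ?a = prodv (single False) (single False)"
    by (auto simp: fun_eq_iff prodv_def single_def)
  then have sa: "sepc (outer (single ?a))" by (metis sepc_outer)
  have fin: "sepc L" if "sepc (?sub L t)" "0 \<le> t" for L t
    using sepc_add[OF that(1) sepc_scale[OF sa that(2)]] by simp
  show ?thesis
  \<comment> \<open>The projector onto 00 equals its own partial transpose. Subtracting the smaller
    multiple keeps both kernels positive and makes one of them singular.\<close>
  proof (cases "\<kappa> \<le> \<mu>")
    case True
    have "pos (pt (?sub K \<kappa>))" unfolding pts using pos_subtract_less[OF 2(3) True] .
    then have "sepc (?sub K \<kappa>)" using sepc_singular[OF 1(3) _ 1(4,2)] by blast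
    then show ?thesis using fin 1(1) by blast
  next
    case False
    have "pos (pt (?sub (pt K) \<mu>))"
      unfolding pts pt_pt using pos_subtract_less[OF 1(3)] False by simp
    then have "sepc (?sub (pt K) \<mu>)" using sepc_singular[OF 2(3) _ 2(4,2)] by blast
    then have "sepc (pt K)" using fin 2(1) by blast
    then show ?thesis using sepc_pt by fastforce
  qed
qed


section \<open>Quadratic forms of matrices\<close>

lemma div_mod_block [simp]: "(j::nat) < b \<Longrightarrow> (i * b + j) div b = i" "(j::nat) < b \<Longrightarrow> (i * b + j) mod b = j"
  by auto

lemma block_less: "(i::nat) < a \<Longrightarrow> j < b \<Longrightarrow> i * b + j < a * b"
proof -
  assume "i < a" "j < b"
  then have "i * b + j < (i + 1) * b" by simp
  also have "\<dots> \<le> a * b" using \<open>i < a\<close> by (intro mult_le_mono1) simp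
  finally show ?thesis .
qed

lemma sum_blocks: "(\<Sum>p<a * b. f p) = (\<Sum>i<a. \<Sum>j<b. f (i * b + j :: nat))"
proof (cases "b = 0")
  case False
  have "(\<Sum>p<a * b. f p) = (\<Sum>(i, j)\<in>{..<a} \<times> {..<b}. f (i * b + j))"
    by (rule sum.reindex_bij_witness[of _ "\<lambda>(i, j). i * b + j" "\<lambda>p. (p div b, p mod b)"])
      (use False in \<open>auto simp: block_less less_mult_imp_div_less\<close>)
  then show ?thesis by (simp add: sum.cartesian_product)
qed simp

lemma block_cases:
  assumes "p < a * (b::nat)"
  obtains i j where "i < a" "j < b" "p = i * b + j"
proof
  have "b \<noteq> 0" using assms by (cases b) auto
  then show "p mod b < b" by simp
  show "p div b < a" using assms by (simp add: less_mult_imp_div_less)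
  show "p = p div b * b + p mod b" by simp
qed

lemma mat_adjoint_index [simp]:
  fixes A :: "complex mat"
  shows "i < dim_col A \<Longrightarrow> j < dim_row A \<Longrightarrow> mat_adjoint A $$ (i, j) = cnj (A $$ (j, i))"
  "dim_row (mat_adjoint A) = dim_col A" "dim_col (mat_adjoint A) = dim_row A"
  by (simp_all add: mat_adjoint_def mat_of_rows_index)

lemma mat_adjoint_carrier: "(A :: complex mat) \<in> carrier_mat n m \<Longrightarrow> mat_adjoint A \<in> carrier_mat m n"
  unfolding carrier_mat_def by simp

lemma mat_mult_index:
  "A \<in> carrier_mat n m \<Longrightarrow> B \<in> carrier_mat m k \<Longrightarrow> i < n \<Longrightarrow> j < k \<Longrightarrow>
    (A * B) $$ (i, j) = (\<Sum>l<m. A $$ (i, l) * B $$ (l, j))"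
  by (auto simp: scalar_prod_def lessThan_atLeast0)

definition qf :: "nat \<Rightarrow> complex mat \<Rightarrow> (nat \<Rightarrow> complex) \<Rightarrow> complex" where
  "qf n M x = (\<Sum>i<n. \<Sum>j<n. cnj (x i) * M $$ (i, j) * x j)"

lemma psd_iff_qf: "psd n M \<longleftrightarrow> M \<in> carrier_mat n n \<and> (\<forall>x. 0 \<le> qf n M x)"
proof -
  have eq: "(M *\<^sub>v v) \<bullet>c v = qf n M (\<lambda>i. v $ i)" if "M \<in> carrier_mat n n" "v \<in> carrier_vec n" for v
    using that
    by (auto simp: qf_def scalar_prod_def lessThan_atLeast0 sum_distrib_right intro!: sum.cong)
  have "qf n M x = qf n M (\<lambda>i. vec n x $ i)" for x
    by (simp add: qf_def)
  then show ?thesis unfolding psd_def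
    by (metis eq vec_carrier)
qed

lemma sum_list_mats:
  assumes "\<And>M. M \<in> set Ms \<Longrightarrow> M \<in> carrier_mat n m"
  shows "sum_mats n m Ms \<in> carrier_mat n m"
    "i < n \<Longrightarrow> j < m \<Longrightarrow> sum_mats n m Ms $$ (i, j) = (\<Sum>M\<leftarrow>Ms. M $$ (i, j))"
proof -
  have "sum_mats n m Ms \<in> carrier_mat n m \<and>
      (i < n \<longrightarrow> j < m \<longrightarrow> sum_mats n m Ms $$ (i, j) = (\<Sum>M\<leftarrow>Ms. M $$ (i, j)))"
    using assms by (induction Ms) (auto simp: sum_mats_def)
  then show "sum_mats n m Ms \<in> carrier_mat n m"
    "i < n \<Longrightarrow> j < m \<Longrightarrow> sum_mats n m Ms $$ (i, j) = (\<Sum>M\<leftarrow>Ms. M $$ (i, j))" by auto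
qed

lemma sum_mats_carrier [simp]: "sum_mats n m Ms \<in> carrier_mat n m"
  by (induction Ms) (auto simp: sum_mats_def)

lemma sum_mats_dim [simp]: "dim_row (sum_mats n m Ms) = n" "dim_col (sum_mats n m Ms) = m"
  by (rule carrier_matD[OF sum_mats_carrier])+

lemma qf_sum_mats:
  assumes "\<And>M. M \<in> set Ms \<Longrightarrow> M \<in> carrier_mat n n"
  shows "qf n (sum_mats n n Ms) x = (\<Sum>M\<leftarrow>Ms. qf n M x)"
proof -
  have "qf n (sum_mats n n Ms) x = (\<Sum>i<n. \<Sum>j<n. (\<Sum>M\<leftarrow>Ms. cnj (x i) * M $$ (i, j) * x j))"
    unfolding qf_def using assms
    by (intro sum.cong refl) (simp add: sum_list_mats(2) sum_list_mult_const sum_list_const_mult)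
  also have "\<dots> = (\<Sum>M\<leftarrow>Ms. qf n M x)"
    unfolding qf_def by (induction Ms) (simp_all add: sum.distrib)
  finally show ?thesis .
qed

definition tr_pair :: "nat \<Rightarrow> complex mat \<Rightarrow> complex mat \<Rightarrow> complex" where
  "tr_pair n A B = (\<Sum>i<n. \<Sum>j<n. A $$ (i, j) * B $$ (j, i))"

lemma mat_trace_mult:
  assumes "A \<in> carrier_mat n n" "B \<in> carrier_mat n n"
  shows "mat_trace (A * B) = tr_pair n A B"
  unfolding mat_trace_def tr_pair_def using assms
  by (auto simp: mat_mult_index[OF assms] simp del: index_mult_mat(1) intro!: sum.cong)

lemma tr_pair_commute: "tr_pair n A B = tr_pair n B A"
  unfolding tr_pair_def by (subst sum.swap) (simp add: mult.commute)

lemma tr_pair_sum_mats: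
  assumes "\<And>M. M \<in> set Ms \<Longrightarrow> M \<in> carrier_mat n n"
  shows "tr_pair n (sum_mats n n Ms) B = (\<Sum>M\<leftarrow>Ms. tr_pair n M B)"
proof -
  have "tr_pair n (sum_mats n n Ms) B = (\<Sum>i<n. \<Sum>j<n. (\<Sum>M\<leftarrow>Ms. M $$ (i, j) * B $$ (j, i)))"
    unfolding tr_pair_def using assms
    by (intro sum.cong refl) (simp add: sum_list_mats(2) sum_list_mult_const)
  also have "\<dots> = (\<Sum>M\<leftarrow>Ms. tr_pair n M B)"
    unfolding tr_pair_def by (induction Ms) (simp_all add: sum.distrib)
  finally show ?thesis .
qed

section \<open>Observables in the Heisenberg picture\<close>

definition pullback :: "complex mat \<Rightarrow> complex mat \<Rightarrow> complex mat" where
  "pullback L Y = mat_adjoint L * Y * L"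

lemma pullback_carrier: "L \<in> carrier_mat m n \<Longrightarrow> Y \<in> carrier_mat m m \<Longrightarrow> pullback L Y \<in> carrier_mat n n"
  unfolding pullback_def by (intro mult_carrier_mat mat_adjoint_carrier)

lemma pullback_index:
  assumes L: "L \<in> carrier_mat m n" and Y: "Y \<in> carrier_mat m m" and ij: "i < n" "j < n"
  shows "pullback L Y $$ (i, j) = (\<Sum>p<m. \<Sum>q<m. cnj (L $$ (p, i)) * Y $$ (p, q) * L $$ (q, j))"
proof -
  have AY: "mat_adjoint L * Y \<in> carrier_mat n m" using mat_adjoint_carrier[OF L] Y by simp
  have "pullback L Y $$ (i, j) = (\<Sum>q<m. (\<Sum>p<m. cnj (L $$ (p, i)) * Y $$ (p, q)) * L $$ (q, j))"
    unfolding pullback_def mat_mult_index[OF AY L ij]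
    using L ij by (intro sum.cong refl) (simp add: mat_mult_index[OF mat_adjoint_carrier[OF L] Y] del: index_mult_mat(1))
  also have "\<dots> = (\<Sum>p<m. \<Sum>q<m. cnj (L $$ (p, i)) * Y $$ (p, q) * L $$ (q, j))"
    unfolding sum_distrib_right by (rule sum.swap)
  finally show ?thesis .
qed

definition mapply :: "nat \<Rightarrow> complex mat \<Rightarrow> (nat \<Rightarrow> complex) \<Rightarrow> nat \<Rightarrow> complex" where
  "mapply n L x p = (\<Sum>i<n. L $$ (p, i) * x i)"

lemma qf_pullback:
  assumes "L \<in> carrier_mat m n" "Y \<in> carrier_mat m m"
  shows "qf n (pullback L Y) x = qf m Y (mapply n L x)"
proof -
  let ?f = "\<lambda>p q i j. cnj (L $$ (p, i) * x i) * Y $$ (p, q) * (L $$ (q, j) * x j)"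
  have "qf n (pullback L Y) x
      = (\<Sum>i<n. \<Sum>j<n. \<Sum>p<m. \<Sum>q<m. ?f p q i j)"
    unfolding qf_def
    by (intro sum.cong refl) (simp add: pullback_index[OF assms] sum_distrib_left sum_distrib_right mult_ac)
  also have "\<dots> = (\<Sum>i<n. \<Sum>p<m. \<Sum>j<n. \<Sum>q<m. ?f p q i j)"
    by (rule sum.cong[OF refl], rule sum.swap)
  also have "\<dots> = (\<Sum>p<m. \<Sum>i<n. \<Sum>j<n. \<Sum>q<m. ?f p q i j)"
    by (rule sum.swap)
  also have "\<dots> = (\<Sum>p<m. \<Sum>i<n. \<Sum>q<m. \<Sum>j<n. ?f p q i j)"
    by (rule sum.cong[OF refl], rule sum.cong[OF refl], rule sum.swap)
  also have "\<dots> = (\<Sum>p<m. \<Sum>q<m. \<Sum>i<n. \<Sum>j<n. ?f p q i j)"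
    by (rule sum.cong[OF refl], rule sum.swap)
  also have "\<dots> = (\<Sum>p<m. \<Sum>q<m. \<Sum>j<n. \<Sum>i<n. ?f p q i j)"
    by (rule sum.cong[OF refl], rule sum.cong[OF refl], rule sum.swap)
  also have "\<dots> = qf m Y (mapply n L x)"
    unfolding qf_def mapply_def cnj_sum sum_distrib_right sum_distrib_left ..
  finally show ?thesis .
qed

lemma tr_pair_pullback:
  assumes L: "L \<in> carrier_mat m n" and M: "M \<in> carrier_mat n n" and Y: "Y \<in> carrier_mat m m"
  shows "tr_pair m (L * M * mat_adjoint L) Y = tr_pair n M (pullback L Y)"
proof -
  have LM: "L * M \<in> carrier_mat m n" using L M by simp
  have e: "(L * M * mat_adjoint L) $$ (p, q) = (\<Sum>j<n. \<Sum>i<n. L $$ (p, i) * M $$ (i, j) * cnj (L $$ (q, j)))"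
    if "p < m" "q < m" for p q
    unfolding mat_mult_index[OF LM mat_adjoint_carrier[OF L] that]
    using L that by (intro sum.cong refl) (simp add: mat_mult_index[OF L M] sum_distrib_right del: index_mult_mat(1))
  let ?f = "\<lambda>p q i j. M $$ (i, j) * (cnj (L $$ (q, j)) * Y $$ (q, p) * L $$ (p, i))"
  have "tr_pair m (L * M * mat_adjoint L) Y = (\<Sum>p<m. \<Sum>q<m. \<Sum>j<n. \<Sum>i<n. ?f p q i j)"
    unfolding tr_pair_def
    by (intro sum.cong refl) (simp add: e sum_distrib_left sum_distrib_right mult_ac del: index_mult_mat)
  also have "\<dots> = (\<Sum>p<m. \<Sum>q<m. \<Sum>i<n. \<Sum>j<n. ?f p q i j)"
    by (rule sum.cong[OF refl], rule sum.cong[OF refl], rule sum.swap)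
  also have "\<dots> = (\<Sum>p<m. \<Sum>i<n. \<Sum>q<m. \<Sum>j<n. ?f p q i j)"
    by (rule sum.cong[OF refl], rule sum.swap)
  also have "\<dots> = (\<Sum>i<n. \<Sum>p<m. \<Sum>q<m. \<Sum>j<n. ?f p q i j)"
    by (rule sum.swap)
  also have "\<dots> = (\<Sum>i<n. \<Sum>p<m. \<Sum>j<n. \<Sum>q<m. ?f p q i j)"
    by (rule sum.cong[OF refl], rule sum.cong[OF refl], rule sum.swap)
  also have "\<dots> = (\<Sum>i<n. \<Sum>j<n. \<Sum>p<m. \<Sum>q<m. ?f p q i j)"
    by (rule sum.cong[OF refl], rule sum.swap)
  also have "\<dots> = (\<Sum>i<n. \<Sum>j<n. \<Sum>q<m. \<Sum>p<m. ?f p q i j)"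
    by (rule sum.cong[OF refl], rule sum.cong[OF refl], rule sum.swap)
  also have "\<dots> = tr_pair n M (pullback L Y)"
    unfolding tr_pair_def
    by (intro sum.cong refl) (simp add: pullback_index[OF L Y] sum_distrib_left)
  finally show ?thesis .
qed

section \<open>Partial transpose and local operators in general dimensions\<close>

text \<open>Arbitrary dimensions are needed since local dimensions may change from round to round;
  for two qubits it agrees with \<open>partial_transpose\<close>.\<close>

definition ptr :: "nat \<Rightarrow> nat \<Rightarrow> complex mat \<Rightarrow> complex mat" where
  "ptr a b M = mat (a * b) (a * b)
     (\<lambda>(p, q). M $$ (p div b * b + q mod b, q div b * b + p mod b))"

lemma ptr_carrier [simp]: "ptr a b M \<in> carrier_mat (a * b) (a * b)"
  by (simp add: ptr_def)

lemma ptr_dim [simp]: "dim_row (ptr a b M) = a * b" "dim_col (ptr a b M) = a * b"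
  by (simp_all add: ptr_def)

lemma ptr_index:
  "i < a \<Longrightarrow> j < b \<Longrightarrow> k < a \<Longrightarrow> l < b \<Longrightarrow>
    ptr a b M $$ (i * b + j, k * b + l) = M $$ (i * b + l, k * b + j)"
  by (simp add: ptr_def block_less)

lemma tensor_carrier: "A \<in> carrier_mat m n \<Longrightarrow> B \<in> carrier_mat k l \<Longrightarrow> A \<otimes>\<^sub>m B \<in> carrier_mat (m * k) (n * l)"
  by (auto simp: tensor_mat_def)

lemma tensor_index:
  "A \<in> carrier_mat m n \<Longrightarrow> B \<in> carrier_mat k l \<Longrightarrow> i < m \<Longrightarrow> j < k \<Longrightarrow> i' < n \<Longrightarrow> j' < l \<Longrightarrow>
    (A \<otimes>\<^sub>m B) $$ (i * k + j, i' * l + j') = A $$ (i, i') * B $$ (j, j')"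
  by (auto simp: tensor_mat_def block_less)

text \<open>The operator replacing \<open>K\<close> after a partial transpose: Bob's operators are conjugated.\<close>

definition conj_mat :: "complex mat \<Rightarrow> complex mat" where
  "conj_mat K = map_mat cnj K"

definition tr_op :: "party \<Rightarrow> complex mat \<Rightarrow> complex mat" where
  "tr_op p K = (case p of Alice \<Rightarrow> K | Bob \<Rightarrow> conj_mat K)"

lemma pullback_Alice_index:
  assumes K: "K \<in> carrier_mat d a" and Z: "Z \<in> carrier_mat (d * b) (d * b)"
    and ij: "i < a" "j < b" "k < a" "l < b"
  shows "pullback (K \<otimes>\<^sub>m 1\<^sub>m b) Z $$ (i * b + j, k * b + l)
      = (\<Sum>i'<d. \<Sum>k'<d. cnj (K $$ (i', i)) * Z $$ (i' * b + j, k' * b + l) * K $$ (k', k))"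
proof -
  let ?L = "K \<otimes>\<^sub>m 1\<^sub>m b"
  have L: "?L \<in> carrier_mat (d * b) (a * b)" by (rule tensor_carrier[OF K one_carrier_mat])
  have "pullback ?L Z $$ (i * b + j, k * b + l)
      = (\<Sum>i'<d. \<Sum>j'<b. \<Sum>k'<d. \<Sum>l'<b. cnj (?L $$ (i' * b + j', i * b + j)) * Z $$ (i' * b + j', k' * b + l') * ?L $$ (k' * b + l', k * b + l))"
    by (simp only: pullback_index[OF L Z block_less block_less] ij sum_blocks)
  also have "\<dots> = (\<Sum>i'<d. \<Sum>j'<b. \<Sum>k'<d. \<Sum>l'<b. if j' = j \<and> l' = l then cnj (K $$ (i', i)) * Z $$ (i' * b + j, k' * b + l) * K $$ (k', k) else 0)"
    using ij by (intro sum.cong refl) (simp add: tensor_index[OF K one_carrier_mat])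
  also have "\<dots> = (\<Sum>i'<d. \<Sum>j'<b. if j' = j then (\<Sum>k'<d. cnj (K $$ (i', i)) * Z $$ (i' * b + j, k' * b + l) * K $$ (k', k)) else 0)"
    using ij by (intro sum.cong refl) (auto intro!: sum.cong)
  also have "\<dots> = (\<Sum>i'<d. \<Sum>k'<d. cnj (K $$ (i', i)) * Z $$ (i' * b + j, k' * b + l) * K $$ (k', k))"
    using ij by simp
  finally show ?thesis .
qed

lemma pullback_ptr_Alice:
  assumes K: "K \<in> carrier_mat d a" and Y: "Y \<in> carrier_mat (d * b) (d * b)"
  shows "ptr a b (pullback (local_mat Alice b K) Y) = pullback (local_mat Alice b K) (ptr d b Y)"
proof -
  let ?L = "K \<otimes>\<^sub>m 1\<^sub>m b"
  have L: "?L \<in> carrier_mat (d * b) (a * b)" by (rule tensor_carrier[OF K one_carrier_mat])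
  have "ptr a b (pullback ?L Y) = pullback ?L (ptr d b Y)"
  proof (rule eq_matI)
    fix p q
    assume "p < dim_row (pullback ?L (ptr d b Y))" "q < dim_col (pullback ?L (ptr d b Y))"
    then have pq: "p < a * b" "q < a * b" using pullback_carrier[OF L ptr_carrier, of Y] by auto
    then obtain i j where ij: "i < a" "j < b" "p = i * b + j" using block_cases by metis
    obtain k l where kl: "k < a" "l < b" "q = k * b + l" using block_cases[OF pq(2)] by metis
    show "ptr a b (pullback ?L Y) $$ (p, q) = pullback ?L (ptr d b Y) $$ (p, q)"
      using ij kl Y by (simp add: ptr_index pullback_Alice_index[OF K])
  qed (use pullback_carrier[OF L ptr_carrier, of Y] in auto)
  then show ?thesis by (simp add: local_mat_def)
qed

lemma sum_if_const: "(\<Sum>l\<in>A. if P then f l else 0) = (if P then \<Sum>l\<in>A. f l else (0 :: complex))"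
  by simp

lemma pullback_Bob_index:
  assumes K: "K \<in> carrier_mat d b" and Z: "Z \<in> carrier_mat (a * d) (a * d)"
    and ij: "i < a" "j < b" "k < a" "l < b"
  shows "pullback (1\<^sub>m a \<otimes>\<^sub>m K) Z $$ (i * b + j, k * b + l)
      = (\<Sum>j'<d. \<Sum>l'<d. cnj (K $$ (j', j)) * Z $$ (i * d + j', k * d + l') * K $$ (l', l))"
proof -
  let ?L = "1\<^sub>m a \<otimes>\<^sub>m K"
  have L: "?L \<in> carrier_mat (a * d) (a * b)" by (rule tensor_carrier[OF one_carrier_mat K])
  have "pullback ?L Z $$ (i * b + j, k * b + l)
      = (\<Sum>i'<a. \<Sum>j'<d. \<Sum>k'<a. \<Sum>l'<d. cnj (?L $$ (i' * d + j', i * b + j)) * Z $$ (i' * d + j', k' * d + l') * ?L $$ (k' * d + l', k * b + l))"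
    by (simp only: pullback_index[OF L Z block_less block_less] ij sum_blocks)
  also have "\<dots> = (\<Sum>i'<a. \<Sum>j'<d. \<Sum>k'<a. \<Sum>l'<d. if i' = i then if k' = k then cnj (K $$ (j', j)) * Z $$ (i * d + j', k * d + l') * K $$ (l', l) else 0 else 0)"
    using ij by (intro sum.cong refl) (simp add: tensor_index[OF one_carrier_mat K])
  also have "\<dots> = (\<Sum>i'<a. if i' = i then (\<Sum>j'<d. \<Sum>k'<a. if k' = k then (\<Sum>l'<d. cnj (K $$ (j', j)) * Z $$ (i * d + j', k * d + l') * K $$ (l', l)) else 0) else 0)"
    by (simp only: sum_if_const)
  also have "\<dots> = (\<Sum>j'<d. \<Sum>l'<d. cnj (K $$ (j', j)) * Z $$ (i * d + j', k * d + l') * K $$ (l', l))"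
    using ij by simp
  finally show ?thesis .
qed

text \<open>Bob acts on the transposed factor, so bra and ket sides of his operator trade places.
  Renaming the two summation indices shows the result as conjugation by the entrywise
  conjugate.\<close>

lemma pullback_ptr_Bob:
  assumes K: "K \<in> carrier_mat d b" and Y: "Y \<in> carrier_mat (a * d) (a * d)"
  shows "ptr a b (pullback (local_mat Bob a K) Y) = pullback (local_mat Bob a (conj_mat K)) (ptr a d Y)"
proof -
  have G: "conj_mat K \<in> carrier_mat d b" using K by (simp add: conj_mat_def)
  have L: "1\<^sub>m a \<otimes>\<^sub>m conj_mat K \<in> carrier_mat (a * d) (a * b)" by (rule tensor_carrier[OF one_carrier_mat G])
  have "ptr a b (pullback (1\<^sub>m a \<otimes>\<^sub>m K) Y) = pullback (1\<^sub>m a \<otimes>\<^sub>m conj_mat K) (ptr a d Y)"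
  proof (rule eq_matI)
    fix p q
    assume "p < dim_row (pullback (1\<^sub>m a \<otimes>\<^sub>m conj_mat K) (ptr a d Y))" "q < dim_col (pullback (1\<^sub>m a \<otimes>\<^sub>m conj_mat K) (ptr a d Y))"
    then have pq: "p < a * b" "q < a * b" using pullback_carrier[OF L ptr_carrier, of Y] by auto
    then obtain i j where ij: "i < a" "j < b" "p = i * b + j" using block_cases by metis
    obtain k l where kl: "k < a" "l < b" "q = k * b + l" using block_cases[OF pq(2)] by metis
    have "ptr a b (pullback (1\<^sub>m a \<otimes>\<^sub>m K) Y) $$ (p, q)
        = (\<Sum>j'<d. \<Sum>l'<d. cnj (K $$ (j', l)) * Y $$ (i * d + j', k * d + l') * K $$ (l', j))"
      using ij kl by (simp add: ptr_index pullback_Bob_index[OF K Y])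
    also have "\<dots> = (\<Sum>l'<d. \<Sum>j'<d. cnj (K $$ (j', l)) * Y $$ (i * d + j', k * d + l') * K $$ (l', j))"
      by (rule sum.swap)
    also have "\<dots> = pullback (1\<^sub>m a \<otimes>\<^sub>m conj_mat K) (ptr a d Y) $$ (p, q)"
      unfolding ij(3) kl(3) pullback_Bob_index[OF G ptr_carrier ij(1,2) kl(1,2)]
      using ij kl K by (intro sum.cong refl) (simp add: ptr_index conj_mat_def)
    finally show "ptr a b (pullback (1\<^sub>m a \<otimes>\<^sub>m K) Y) $$ (p, q) = pullback (1\<^sub>m a \<otimes>\<^sub>m conj_mat K) (ptr a d Y) $$ (p, q)" .
  qed (use pullback_carrier[OF L ptr_carrier, of Y] in auto)
  then show ?thesis by (simp add: local_mat_def)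
qed


section \<open>The LOCC bound\<close>

definition nrm2 :: "nat \<Rightarrow> (nat \<Rightarrow> complex) \<Rightarrow> real" where
  "nrm2 n x = (\<Sum>i<n. (cmod (x i))\<^sup>2)"

text \<open>\<open>feas\<close> in arbitrary local dimensions: the property of an observable that is
  carried backwards through a protocol.\<close>

definition dual_feas :: "nat \<Rightarrow> nat \<Rightarrow> complex mat \<Rightarrow> bool" where
  "dual_feas a b Y \<longleftrightarrow> Y \<in> carrier_mat (a * b) (a * b) \<and> (\<forall>x. 0 \<le> qf (a * b) Y x) \<and>
     (\<forall>x. qf (a * b) (ptr a b Y) x \<le> complex_of_real (nrm2 (a * b) x / 2))"

text \<open>The first dimension argument below is that of the acting party.\<close>

definition ptrp :: "party \<Rightarrow> nat \<Rightarrow> nat \<Rightarrow> complex mat \<Rightarrow> complex mat" where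
  "ptrp p a c = (case p of Alice \<Rightarrow> ptr a c | Bob \<Rightarrow> ptr c a)"

definition dual_feas_of :: "party \<Rightarrow> nat \<Rightarrow> nat \<Rightarrow> complex mat \<Rightarrow> bool" where
  "dual_feas_of p a c = (case p of Alice \<Rightarrow> dual_feas a c | Bob \<Rightarrow> dual_feas c a)"

lemma dual_feas_of_iff:
  "dual_feas_of p a c Y \<longleftrightarrow> Y \<in> carrier_mat (a * c) (a * c) \<and> (\<forall>x. 0 \<le> qf (a * c) Y x) \<and>
     (\<forall>x. qf (a * c) (ptrp p a c Y) x \<le> complex_of_real (nrm2 (a * c) x / 2))"
  by (cases p) (simp_all add: dual_feas_of_def dual_feas_def ptrp_def mult.commute[of a c])

lemma conj_mat_carrier [simp]: "conj_mat K \<in> carrier_mat d a \<longleftrightarrow> K \<in> carrier_mat d a"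
  by (simp add: conj_mat_def)

lemma tr_op_carrier [simp]: "tr_op p K \<in> carrier_mat d a \<longleftrightarrow> K \<in> carrier_mat d a"
  by (cases p) (simp_all add: tr_op_def)

lemma local_mat_carrier:
  "K \<in> carrier_mat d a \<Longrightarrow> local_mat p c K \<in> carrier_mat (d * c) (a * c)"
  using tensor_carrier[of K d a "1\<^sub>m c" c c] tensor_carrier[of "1\<^sub>m c" c c K d a]
  by (cases p) (simp_all add: local_mat_def mult.commute)

lemma pullback_ptrp:
  assumes "K \<in> carrier_mat d a" "Y \<in> carrier_mat (d * c) (d * c)"
  shows "ptrp p a c (pullback (local_mat p c K) Y) = pullback (local_mat p c (tr_op p K)) (ptrp p d c Y)"
  using pullback_ptr_Alice[OF assms] pullback_ptr_Bob[OF assms(1), of Y c] assms(2)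
  by (cases p) (simp_all add: ptrp_def tr_op_def mult.commute)

lemma ptrp_carrier: "ptrp p a c Y \<in> carrier_mat (a * c) (a * c)"
  by (cases p; simp add: ptrp_def) (metis mult.commute ptr_carrier)

lemma ptr_sum_mats:
  assumes "\<And>M. M \<in> set Ms \<Longrightarrow> M \<in> carrier_mat (a * b) (a * b)"
  shows "ptr a b (sum_mats (a * b) (a * b) Ms) = sum_mats (a * b) (a * b) (map (ptr a b) Ms)"
proof (rule eq_matI)
  fix p q
  assume "p < dim_row (sum_mats (a * b) (a * b) (map (ptr a b) Ms))" "q < dim_col (sum_mats (a * b) (a * b) (map (ptr a b) Ms))"
  then have pq: "p < a * b" "q < a * b" using sum_mats_carrier[of "a * b" "a * b" "map (ptr a b) Ms"] by auto
  then obtain i j where ij: "i < a" "j < b" "p = i * b + j" using block_cases by metis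
  obtain k l where kl: "k < a" "l < b" "q = k * b + l" using block_cases[OF pq(2)] by metis
  have "sum_mats (a * b) (a * b) (map (ptr a b) Ms) $$ (p, q) = (\<Sum>M\<leftarrow>Ms. ptr a b M $$ (p, q))"
    using pq by (subst sum_list_mats(2)) (auto simp: o_def)
  also have "\<dots> = (\<Sum>M\<leftarrow>Ms. M $$ (i * b + l, k * b + j))"
    using ij kl by (simp add: ptr_index)
  also have "\<dots> = ptr a b (sum_mats (a * b) (a * b) Ms) $$ (p, q)"
    using ij kl assms by (simp add: ptr_index sum_list_mats(2) block_less)
  finally show "ptr a b (sum_mats (a * b) (a * b) Ms) $$ (p, q) = sum_mats (a * b) (a * b) (map (ptr a b) Ms) $$ (p, q)" ..
qed simp_all

lemma ptrp_sum_mats: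
  assumes "\<And>M. M \<in> set Ms \<Longrightarrow> M \<in> carrier_mat (a * c) (a * c)"
  shows "ptrp p a c (sum_mats (a * c) (a * c) Ms) = sum_mats (a * c) (a * c) (map (ptrp p a c) Ms)"
  using ptr_sum_mats[of Ms a c] ptr_sum_mats[of Ms c a] assms
  by (cases p) (simp_all add: ptrp_def mult.commute)

lemma qf_one: "qf n (1\<^sub>m n) x = complex_of_real (nrm2 n x)"
proof -
  have "qf n (1\<^sub>m n) x = (\<Sum>i<n. \<Sum>j<n. if j = i then cnj (x i) * x i else 0)"
    unfolding qf_def by (intro sum.cong refl) auto
  also have "\<dots> = (\<Sum>i<n. cnj (x i) * x i)" by simp
  finally show ?thesis
    unfolding nrm2_def of_real_sum complex_norm_square by (simp add: mult.commute)
qed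

lemma qf_mult_adjoint:
  assumes "K \<in> carrier_mat d a"
  shows "qf a (mat_adjoint K * K) y = complex_of_real (nrm2 d (mapply a K y))"
proof -
  have "mat_adjoint K * K = pullback K (1\<^sub>m d)"
    by (simp add: pullback_def right_mult_one_mat[OF mat_adjoint_carrier[OF assms]])
  then show ?thesis using qf_pullback[OF assms one_carrier_mat] by (simp add: qf_one)
qed

text \<open>The part of \<open>x\<close> seen by the acting party when the other index is
  \<open>j\<close>. Bob's fibre is conjugated to match \<open>tr_op\<close>, so that the same
  operator \<open>K\<^sup>\<dagger> K\<close> governs both parties.\<close>

definition fibre :: "party \<Rightarrow> nat \<Rightarrow> nat \<Rightarrow> nat \<Rightarrow> (nat \<Rightarrow> complex) \<Rightarrow> nat \<Rightarrow> complex" where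
  "fibre p a c j x i = (case p of Alice \<Rightarrow> x (i * c + j) | Bob \<Rightarrow> cnj (x (j * a + i)))"

lemma nrm2_fibre: "(\<Sum>j<c. nrm2 a (fibre p a c j x)) = nrm2 (a * c) x"
proof (cases p)
  case Alice
  then show ?thesis
    by (simp add: nrm2_def fibre_def sum_blocks) (rule sum.swap)
next
  case Bob
  then show ?thesis
    by (simp add: nrm2_def fibre_def sum_blocks mult.commute[of a c])
qed

lemma nrm2_local:
  assumes K: "K \<in> carrier_mat d a"
  shows "complex_of_real (nrm2 (d * c) (mapply (a * c) (local_mat p c (tr_op p K)) x))
    = (\<Sum>j<c. qf a (mat_adjoint K * K) (fibre p a c j x))"
proof -
  have "nrm2 (d * c) (mapply (a * c) (local_mat p c (tr_op p K)) x) = (\<Sum>j<c. nrm2 d (mapply a K (fibre p a c j x)))"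
  proof (cases p)
    case Alice
    have "mapply (a * c) (K \<otimes>\<^sub>m 1\<^sub>m c) x (i' * c + j) = mapply a K (fibre p a c j x) i'" if "i' < d" "j < c" for i' j
    proof -
      have "mapply (a * c) (K \<otimes>\<^sub>m 1\<^sub>m c) x (i' * c + j)
          = (\<Sum>i<a. \<Sum>l<c. if l = j then K $$ (i', i) * x (i * c + j) else 0)"
        unfolding mapply_def sum_blocks
        using that by (intro sum.cong refl) (auto simp: tensor_index[OF K one_carrier_mat])
      then show ?thesis using that by (simp add: mapply_def fibre_def Alice)
    qed
    then have "nrm2 (d * c) (mapply (a * c) (K \<otimes>\<^sub>m 1\<^sub>m c) x) = (\<Sum>i'<d. \<Sum>j<c. (cmod (mapply a K (fibre p a c j x) i'))\<^sup>2)"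
      by (simp add: nrm2_def sum_blocks)
    also have "\<dots> = (\<Sum>j<c. nrm2 d (mapply a K (fibre p a c j x)))"
      unfolding nrm2_def by (rule sum.swap)
    finally show ?thesis by (simp add: local_mat_def tr_op_def Alice)
  next
    case Bob
    have G: "conj_mat K \<in> carrier_mat d a" using K by simp
    have "mapply (c * a) (1\<^sub>m c \<otimes>\<^sub>m conj_mat K) x (j * d + i') = cnj (mapply a K (fibre p a c j x) i')" if "i' < d" "j < c" for i' j
    proof -
      have "mapply (c * a) (1\<^sub>m c \<otimes>\<^sub>m conj_mat K) x (j * d + i')
          = (\<Sum>l<c. \<Sum>i<a. if l = j then conj_mat K $$ (i', i) * x (l * a + i) else 0)"
        unfolding mapply_def sum_blocks
        using that by (intro sum.cong refl) (auto simp: tensor_index[OF one_carrier_mat G])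
      also have "\<dots> = (\<Sum>i<a. conj_mat K $$ (i', i) * x (j * a + i))"
        using that by (simp only: sum_if_const) simp
      also have "\<dots> = cnj (mapply a K (fibre p a c j x) i')"
        using K that by (simp add: mapply_def fibre_def Bob conj_mat_def)
      finally show ?thesis .
    qed
    then have "nrm2 (c * d) (mapply (c * a) (1\<^sub>m c \<otimes>\<^sub>m conj_mat K) x) = (\<Sum>j<c. \<Sum>i'<d. (cmod (mapply a K (fibre p a c j x) i'))\<^sup>2)"
      by (simp add: nrm2_def sum_blocks)
    then show ?thesis by (simp add: local_mat_def tr_op_def Bob nrm2_def mult.commute)
  qed
  then show ?thesis by (simp add: qf_mult_adjoint[OF K])
qed

lemma of_real_sum_list: "complex_of_real (\<Sum>x\<leftarrow>xs. f x) = (\<Sum>x\<leftarrow>xs. complex_of_real (f x))"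
  by (induction xs) simp_all

lemma sum_list_sum_swap: "(\<Sum>x\<leftarrow>xs. \<Sum>j\<in>A. f x j) = (\<Sum>j\<in>A. \<Sum>x\<leftarrow>xs. f x j :: complex)"
  by (induction xs) (simp_all add: sum.distrib)

text \<open>The completeness relation, applied in every fibre, also holds for the operators that
  appear after the partial transpose. It is the reason why the bound 1/2 does not grow from round to
  round.\<close>

lemma instrument_isometry:
  assumes "instrument a E"
  shows "(\<Sum>K\<leftarrow>concat (map snd E). nrm2 (dim_row K * c) (mapply (a * c) (local_mat p c (tr_op p K)) x)) = nrm2 (a * c) x"
proof -
  let ?Ks = "concat (map snd E)"
  have K: "K \<in> carrier_mat (dim_row K) a" if K: "K \<in> set ?Ks" for K
  proof -
    obtain d where "K \<in> carrier_mat d a" using K assms unfolding instrument_def by fastforce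
    then show ?thesis by auto
  qed
  have car: "M \<in> carrier_mat a a" if M: "M \<in> set (map (\<lambda>K. mat_adjoint K * K) ?Ks)" for M
  proof -
    obtain K where "K \<in> set ?Ks" "M = mat_adjoint K * K" using M by auto
    then show ?thesis using mult_carrier_mat[OF mat_adjoint_carrier] K by blast
  qed
  have one: "sum_mats a a (map (\<lambda>K. mat_adjoint K * K) ?Ks) = 1\<^sub>m a"
    using assms by (simp add: instrument_def)
  have "complex_of_real (\<Sum>K\<leftarrow>?Ks. nrm2 (dim_row K * c) (mapply (a * c) (local_mat p c (tr_op p K)) x))
      = (\<Sum>K\<leftarrow>?Ks. complex_of_real (nrm2 (dim_row K * c) (mapply (a * c) (local_mat p c (tr_op p K)) x)))"
    by (rule of_real_sum_list)
  also have "\<dots> = (\<Sum>K\<leftarrow>?Ks. \<Sum>j<c. qf a (mat_adjoint K * K) (fibre p a c j x))"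
    using K by (intro arg_cong[where f = sum_list] map_cong refl nrm2_local) auto
  also have "\<dots> = (\<Sum>j<c. \<Sum>K\<leftarrow>?Ks. qf a (mat_adjoint K * K) (fibre p a c j x))"
    by (rule sum_list_sum_swap)
  also have "\<dots> = (\<Sum>j<c. qf a (1\<^sub>m a) (fibre p a c j x))"
    unfolding one[symmetric] using car by (subst qf_sum_mats) (auto simp: o_def)
  also have "\<dots> = complex_of_real (nrm2 (a * c) x)"
    unfolding qf_one nrm2_fibre[where p = p and a = a and c = c and x = x, symmetric] by simp
  finally show ?thesis by (simp only: of_real_eq_iff)
qed

lemma tr_pair_apply_local:
  assumes K: "\<And>K. K \<in> set (snd e) \<Longrightarrow> K \<in> carrier_mat (fst e) a"
    and M: "M \<in> carrier_mat (a * c) (a * c)" and Z: "Z \<in> carrier_mat (fst e * c) (fst e * c)"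
  shows "tr_pair (fst e * c) (apply_local p c e M) Z
    = (\<Sum>K\<leftarrow>snd e. tr_pair (a * c) M (pullback (local_mat p c K) Z))"
proof -
  have L: "local_mat p c K \<in> carrier_mat (fst e * c) (a * c)" if "K \<in> set (snd e)" for K
    using K[OF that] by (rule local_mat_carrier)
  have "tr_pair (fst e * c) (apply_local p c e M) Z
      = (\<Sum>K\<leftarrow>snd e. tr_pair (fst e * c) (local_mat p c K * M * mat_adjoint (local_mat p c K)) Z)"
    unfolding apply_local_def kraus_map_def
    by (subst tr_pair_sum_mats) (use L M in \<open>auto simp: o_def intro!: mult_carrier_mat mat_adjoint_carrier\<close>)
  also have "\<dots> = (\<Sum>K\<leftarrow>snd e. tr_pair (a * c) M (pullback (local_mat p c K) Z))"
    using L by (intro arg_cong[where f = sum_list] map_cong refl tr_pair_pullback[OF _ M Z]) auto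
  finally show ?thesis .
qed

text \<open>The new observable is the sum of all pulled-back ones. Each branch bounds its transposed
  form by half of its share of the squared norm, and by \<open>instrument_isometry\<close> the
  shares add up to the whole.\<close>

lemma local_round:
  assumes E: "instrument a E"
    and Z: "\<And>i. i < length E \<Longrightarrow> dual_feas_of p (fst (E ! i)) c (Z i)"
  shows "\<exists>Y. dual_feas_of p a c Y \<and> (\<forall>M\<in>carrier_mat (a * c) (a * c).
    (\<Sum>i\<leftarrow>[0..<length E]. tr_pair (fst (E ! i) * c) (apply_local p c (E ! i) M) (Z i)) = tr_pair (a * c) M Y)"
proof -
  \<comment> \<open>Every Kraus operator is paired with the observable of its outcome. The flat list
    handles outcomes of different dimensions in a single sum, and its first components are exactly
    the operators of the instrument.\<close>
  define KZ where "KZ = concat (map (\<lambda>i. map (\<lambda>K. (K, Z i)) (snd (E ! i))) [0..<length E])"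
  have car: "K \<in> carrier_mat (fst (E ! i)) a" if "i < length E" "K \<in> set (snd (E ! i))" for i K
    using that E nth_mem[of i E] unfolding instrument_def by (cases "E ! i") fastforce
  have mem: "\<exists>d. K \<in> carrier_mat d a \<and> dual_feas_of p d c W" if KW: "(K, W) \<in> set KZ" for K W
  proof -
    obtain i where "i < length E" "K \<in> set (snd (E ! i))" "W = Z i" using KW by (auto simp: KZ_def)
    then show ?thesis using car Z by blast
  qed
  have fstKZ: "map fst KZ = concat (map snd E)"
  proof -
    have "map fst KZ = concat (map (\<lambda>i. snd (E ! i)) [0..<length E])"
      by (simp add: KZ_def map_concat o_def)
    also have "map (\<lambda>i. snd (E ! i)) [0..<length E] = map snd E"
      by (rule nth_equalityI) simp_all
    finally show ?thesis .
  qed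
  let ?n = "a * c"
  define Ys where "Ys = map (\<lambda>(K, W). pullback (local_mat p c K) W) KZ"
  define Y where "Y = sum_mats ?n ?n Ys"
  have pc: "pullback (local_mat p c K) W \<in> carrier_mat ?n ?n" if "(K, W) \<in> set KZ" for K W
    using mem[OF that] by (auto simp: dual_feas_of_iff intro: pullback_carrier local_mat_carrier)
  then have Ysc: "M \<in> carrier_mat ?n ?n" if "M \<in> set Ys" for M
    using that by (auto simp: Ys_def)
  have Yc: "Y \<in> carrier_mat ?n ?n" by (simp add: Y_def)
  have "0 \<le> qf ?n Y x" for x
  proof -
    have "0 \<le> qf ?n (pullback (local_mat p c K) W) x" if KW: "(K, W) \<in> set KZ" for K W
    proof -
      obtain d where d: "K \<in> carrier_mat d a" "dual_feas_of p d c W" using mem[OF KW] by blast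
      then show ?thesis
        using qf_pullback[OF local_mat_carrier[OF d(1)], of W c p x] by (simp add: dual_feas_of_iff)
    qed
    then have "0 \<le> (\<Sum>M\<leftarrow>Ys. qf ?n M x)"
      by (intro sum_list_nonneg) (auto simp: Ys_def)
    then show ?thesis by (simp add: Y_def qf_sum_mats[OF Ysc])
  qed
  moreover have "qf ?n (ptrp p a c Y) x \<le> complex_of_real (nrm2 ?n x / 2)" for x
  proof -
    have le: "qf ?n (ptrp p a c (pullback (local_mat p c K) W)) x
        \<le> complex_of_real (nrm2 (dim_row K * c) (mapply ?n (local_mat p c (tr_op p K)) x) / 2)"
      if KW: "(K, W) \<in> set KZ" for K W
    proof -
      obtain d where d: "K \<in> carrier_mat d a" "dual_feas_of p d c W" using mem[OF KW] by blast
      then have K': "tr_op p K \<in> carrier_mat d a" and W: "W \<in> carrier_mat (d * c) (d * c)"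
        by (simp_all add: dual_feas_of_iff)
      have "qf ?n (ptrp p a c (pullback (local_mat p c K) W)) x
          = qf (d * c) (ptrp p d c W) (mapply ?n (local_mat p c (tr_op p K)) x)"
        unfolding pullback_ptrp[OF d(1) W]
        by (rule qf_pullback[OF local_mat_carrier[OF K'] ptrp_carrier])
      moreover have "dim_row K = d" using d by simp
      ultimately show ?thesis using d(2) unfolding dual_feas_of_iff by simp
    qed
    have "ptrp p a c Y = sum_mats ?n ?n (map (ptrp p a c) Ys)"
      unfolding Y_def by (rule ptrp_sum_mats[OF Ysc])
    then have "qf ?n (ptrp p a c Y) x = (\<Sum>M\<leftarrow>map (ptrp p a c) Ys. qf ?n M x)"
      using ptrp_carrier by (simp only:) (rule qf_sum_mats, auto)
    also have "\<dots> = (\<Sum>kz\<leftarrow>KZ. qf ?n (ptrp p a c (pullback (local_mat p c (fst kz)) (snd kz))) x)"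
      by (simp add: Ys_def o_def case_prod_unfold)
    also have "\<dots> \<le> (\<Sum>kz\<leftarrow>KZ. complex_of_real (nrm2 (dim_row (fst kz) * c) (mapply ?n (local_mat p c (tr_op p (fst kz))) x) / 2))"
      using le by (intro sum_list_mono) (metis prod.collapse)
    also have "\<dots> = complex_of_real ((\<Sum>kz\<leftarrow>KZ. nrm2 (dim_row (fst kz) * c) (mapply ?n (local_mat p c (tr_op p (fst kz))) x)) / 2)"
      by (induction KZ) (simp_all add: add_divide_distrib)
    also have "(\<Sum>kz\<leftarrow>KZ. nrm2 (dim_row (fst kz) * c) (mapply ?n (local_mat p c (tr_op p (fst kz))) x))
        = (\<Sum>K\<leftarrow>map fst KZ. nrm2 (dim_row K * c) (mapply ?n (local_mat p c (tr_op p K)) x))"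
      by (simp add: o_def)
    also have "\<dots> = nrm2 ?n x" unfolding fstKZ by (rule instrument_isometry[OF E])
    finally show ?thesis .
  qed
  moreover have "(\<Sum>i\<leftarrow>[0..<length E]. tr_pair (fst (E ! i) * c) (apply_local p c (E ! i) M) (Z i)) = tr_pair ?n M Y"
    if M: "M \<in> carrier_mat ?n ?n" for M
  proof -
    have r: "tr_pair (fst (E ! i) * c) (apply_local p c (E ! i) M) (Z i)
        = (\<Sum>K\<leftarrow>snd (E ! i). tr_pair ?n M (pullback (local_mat p c K) (Z i)))" if "i < length E" for i
      using car[OF that] Z[OF that] M by (intro tr_pair_apply_local) (simp_all add: dual_feas_of_iff)
    have "tr_pair ?n M Y = (\<Sum>W\<leftarrow>Ys. tr_pair ?n W M)"
      unfolding Y_def by (subst tr_pair_commute) (rule tr_pair_sum_mats[OF Ysc])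
    also have "\<dots> = (\<Sum>(K, W)\<leftarrow>KZ. tr_pair ?n M (pullback (local_mat p c K) W))"
      by (simp add: Ys_def o_def case_prod_unfold tr_pair_commute[of _ M])
    also have "\<dots> = (\<Sum>i\<leftarrow>[0..<length E]. \<Sum>K\<leftarrow>snd (E ! i). tr_pair ?n M (pullback (local_mat p c K) (Z i)))"
    proof -
      have "(\<Sum>(K, W)\<leftarrow>concat (map (\<lambda>i. map (\<lambda>K. (K, Z i)) (snd (E ! i))) xs). tr_pair ?n M (pullback (local_mat p c K) W))
          = (\<Sum>i\<leftarrow>xs. \<Sum>K\<leftarrow>snd (E ! i). tr_pair ?n M (pullback (local_mat p c K) (Z i)))" for xs
        by (induction xs) (simp_all add: o_def)
      then show ?thesis by (simp add: KZ_def)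
    qed
    also have "\<dots> = (\<Sum>i\<leftarrow>[0..<length E]. tr_pair (fst (E ! i) * c) (apply_local p c (E ! i) M) (Z i))"
      by (intro arg_cong[where f = sum_list] map_cong refl) (simp add: r)
    finally show ?thesis ..
  qed
  ultimately show ?thesis using Yc unfolding dual_feas_of_iff by blast
qed

lemma apply_local_carrier: "apply_local p c e M \<in> carrier_mat (fst e * c) (fst e * c)"
  by (simp add: apply_local_def kraus_map_def)

lemma locc_step:
  assumes E: "instrument a E"
    and F: "\<forall>i<length E. \<exists>Y. dual_feas_of p (fst (E ! i)) c Y \<and> (\<forall>M\<in>carrier_mat (fst (E ! i) * c) (fst (E ! i) * c).
      F i M \<in> carrier_mat n n \<and> tr_pair n (F i M) P = tr_pair (fst (E ! i) * c) M Y)"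
  shows "\<exists>Y. dual_feas_of p a c Y \<and> (\<forall>M\<in>carrier_mat (a * c) (a * c).
    tr_pair n (sum_mats n n (map (\<lambda>i. F i (apply_local p c (E ! i) M)) [0..<length E])) P = tr_pair (a * c) M Y)"
proof -
  obtain Z where Z: "\<And>i. i < length E \<Longrightarrow> dual_feas_of p (fst (E ! i)) c (Z i) \<and>
    (\<forall>M\<in>carrier_mat (fst (E ! i) * c) (fst (E ! i) * c).
      F i M \<in> carrier_mat n n \<and> tr_pair n (F i M) P = tr_pair (fst (E ! i) * c) M (Z i))"
    using F by metis
  obtain Y where Y: "dual_feas_of p a c Y" "\<forall>M\<in>carrier_mat (a * c) (a * c).
    (\<Sum>i\<leftarrow>[0..<length E]. tr_pair (fst (E ! i) * c) (apply_local p c (E ! i) M) (Z i)) = tr_pair (a * c) M Y"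
    using local_round[OF E, of p c Z] Z by blast
  have FM: "F i (apply_local p c (E ! i) M) \<in> carrier_mat n n"
    "tr_pair n (F i (apply_local p c (E ! i) M)) P = tr_pair (fst (E ! i) * c) (apply_local p c (E ! i) M) (Z i)"
    if "i < length E" for i M
    using Z[OF that] apply_local_carrier[of p c "E ! i" M] by auto
  have "tr_pair n (sum_mats n n (map (\<lambda>i. F i (apply_local p c (E ! i) M)) [0..<length E])) P
      = (\<Sum>i\<leftarrow>[0..<length E]. tr_pair (fst (E ! i) * c) (apply_local p c (E ! i) M) (Z i))" for M
    using FM by (subst tr_pair_sum_mats) (auto simp: o_def intro!: arg_cong[where f = sum_list])
  then show ?thesis using Y by (intro exI[of _ Y]) simp
qed

text \<open>The final observable is moved backwards: the continuation after each outcome has its own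
  observable by induction, and \<open>locc_step\<close> merges them for the round in front.\<close>

lemma locc_dual:
  assumes "locc a' b' a b \<Lambda>" "dual_feas a' b' P"
  shows "\<exists>Y. dual_feas a b Y \<and> (\<forall>M\<in>carrier_mat (a * b) (a * b).
    \<Lambda> M \<in> carrier_mat (a' * b') (a' * b') \<and> tr_pair (a' * b') (\<Lambda> M) P = tr_pair (a * b) M Y)"
  using assms
proof (induction rule: locc.induct)
  case finish
  then show ?case by blast
next
  case (alice a E b F)
  then have "\<forall>i<length E. \<exists>Y. dual_feas_of Alice (fst (E ! i)) b Y \<and> (\<forall>M\<in>carrier_mat (fst (E ! i) * b) (fst (E ! i) * b).
      F i M \<in> carrier_mat (a' * b') (a' * b') \<and> tr_pair (a' * b') (F i M) P = tr_pair (fst (E ! i) * b) M Y)"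
    by (simp add: dual_feas_of_def)
  from locc_step[OF alice.hyps(1) this] show ?case by (simp add: dual_feas_of_def)
next
  case (bob b E a F)
  then have "\<forall>i<length E. \<exists>Y. dual_feas_of Bob (fst (E ! i)) a Y \<and> (\<forall>M\<in>carrier_mat (fst (E ! i) * a) (fst (E ! i) * a).
      F i M \<in> carrier_mat (a' * b') (a' * b') \<and> tr_pair (a' * b') (F i M) P = tr_pair (fst (E ! i) * a) M Y)"
    by (simp add: dual_feas_of_def mult.commute[of _ a])
  from locc_step[OF bob.hyps(1) this] show ?case by (simp add: dual_feas_of_def mult.commute[of b a])
qed


section \<open>From matrices to kernels\<close>

definition ix :: "qq \<Rightarrow> nat" where
  "ix p = (if fst p then 2 else 0) + (if snd p then 1 else 0)"

definition kern :: "complex mat \<Rightarrow> qq \<Rightarrow> qq \<Rightarrow> complex" where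
  "kern M p q = M $$ (ix p, ix q)"

definition qq_of :: "nat \<Rightarrow> qq" where
  "qq_of n = (n div 2 = 1, n mod 2 = 1)"

definition of_kern :: "(qq \<Rightarrow> qq \<Rightarrow> complex) \<Rightarrow> complex mat" where
  "of_kern K = mat 4 4 (\<lambda>(i, j). K (qq_of i) (qq_of j))"

lemma ix_simps [simp]:
  "ix (False, False) = 0" "ix (False, True) = 1" "ix (True, False) = 2" "ix (True, True) = 3"
  by (simp_all add: ix_def)

lemma qq_of_simps [simp]:
  "qq_of 0 = (False, False)" "qq_of (Suc 0) = (False, True)" "qq_of 2 = (True, False)" "qq_of 3 = (True, True)"
  by (simp_all add: qq_of_def)

lemma qq_of_ix [simp]: "qq_of (ix p) = p"
  by (cases p rule: qq_cases) simp_all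

lemma ix_less [simp]: "ix p < 4"
  by (cases p rule: qq_cases) simp_all

lemma less_4_cases: "i < 4 \<Longrightarrow> i = 0 \<or> i = Suc 0 \<or> i = 2 \<or> i = (3 :: nat)"
  by auto

lemma ix_qq_of: "i < 4 \<Longrightarrow> ix (qq_of i) = i"
  by (drule less_4_cases) auto

lemma sum_4: "(\<Sum>i<4. f i) = (\<Sum>p\<in>UNIV. f (ix p))"
  for f :: "nat \<Rightarrow> 'a::comm_monoid_add"
  by (simp add: sum_qq UNIV_bool numeral_eq_Suc add_ac)

lemma of_kern_carrier [simp]: "of_kern K \<in> carrier_mat 4 4"
  by (simp add: of_kern_def)

lemma kern_of_kern [simp]: "kern (of_kern K) = K"
  by (intro ext) (simp add: kern_def of_kern_def)

lemma of_kern_kern: "M \<in> carrier_mat 4 4 \<Longrightarrow> of_kern (kern M) = M"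
  by (rule eq_matI) (auto simp: kern_def of_kern_def ix_qq_of)

lemma all_ix: "(\<forall>x :: nat \<Rightarrow> complex. P (\<lambda>p. x (ix p))) \<longleftrightarrow> (\<forall>y. P y)"
proof (intro iffI allI)
  fix y assume "\<forall>x :: nat \<Rightarrow> complex. P (\<lambda>p. x (ix p))"
  from this[rule_format, of "\<lambda>i. y (qq_of i)"] show "P y" by simp
qed simp

lemma qf_kern: "qf 4 M x = sesq (kern M) (\<lambda>p. x (ix p)) (\<lambda>p. x (ix p))"
  by (simp add: qf_def sesq_def kern_def sum_4)

lemma psd_kern: "psd 4 M \<longleftrightarrow> M \<in> carrier_mat 4 4 \<and> pos (kern M)"
  unfolding psd_iff_qf pos_def qf_kern all_ix[of "\<lambda>y. 0 \<le> sesq (kern M) y y"] ..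

lemma nrm2_4: "nrm2 4 x = norm2 (\<lambda>p. x (ix p))"
  by (simp add: nrm2_def norm2_def sum_4)

lemma kern_partial_transpose: "kern (partial_transpose M) = pt (kern M)"
proof (intro ext)
  fix p q
  show "kern (partial_transpose M) p q = pt (kern M) p q"
    by (cases p rule: qq_cases; cases q rule: qq_cases) (simp_all add: kern_def pt_def partial_transpose_def flip: numeral_2_eq_2 numeral_3_eq_3)
qed

lemma partial_transpose_carrier [simp]: "partial_transpose M \<in> carrier_mat 4 4"
  by (simp add: partial_transpose_def)

lemma kern_ptr: "kern (ptr 2 2 M) = pt (kern M)"
proof (intro ext)
  fix p q
  show "kern (ptr 2 2 M) p q = pt (kern M) p q"
    by (cases p rule: qq_cases; cases q rule: qq_cases) (simp_all add: kern_def pt_def ptr_def flip: numeral_2_eq_2 numeral_3_eq_3)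
qed

lemma tr_pair_kern: "tr_pair 4 A B = tr2 (kern A) (kern B)"
  by (simp add: tr_pair_def tr2_def kern_def sum_4)

lemma dual_feas_kern: "dual_feas 2 2 Y \<longleftrightarrow> Y \<in> carrier_mat 4 4 \<and> feas (kern Y)"
proof -
  have "(0 \<le> sesq (gap K) y y) \<longleftrightarrow> sesq K y y \<le> complex_of_real (norm2 y / 2)" for K and y :: "qq \<Rightarrow> complex"
    by (simp add: sesq_gap)
  then show ?thesis
    unfolding dual_feas_def feas_def pos_def
    using all_ix[of "\<lambda>y. 0 \<le> sesq (kern Y) y y"] all_ix[of "\<lambda>y. sesq (pt (kern Y)) y y \<le> complex_of_real (norm2 y / 2)"]
    by (simp add: qf_kern kern_ptr nrm2_4)
qed

lemma kern_minus: "A \<in> carrier_mat 4 4 \<Longrightarrow> B \<in> carrier_mat 4 4 \<Longrightarrow> kern (A - B) p q = kern A p q - kern B p q"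
  by (simp add: kern_def)

lemma ix_eq_iff [simp]: "ix p = ix q \<longleftrightarrow> p = q"
  by (metis qq_of_ix)

lemma kern_one: "kern (1\<^sub>m 4) p q = (if p = q then 1 else 0)"
  by (simp add: kern_def)

lemma kern_smult_one: "kern (c \<cdot>\<^sub>m 1\<^sub>m 4) p q = (if p = q then c else 0)"
  by (simp add: kern_def)

lemma kern_uminus_smult_one: "kern (- (c \<cdot>\<^sub>m 1\<^sub>m 4)) p q = (if p = q then - c else 0)"
  by (simp add: kern_def)

lemma kern_zero: "kern (0\<^sub>m 4 4) p q = 0"
  by (simp add: kern_def)

lemma loewner_kern:
  assumes "A \<in> carrier_mat 4 4" "B \<in> carrier_mat 4 4"
  shows "loewner_le 4 A B \<longleftrightarrow> pos (\<lambda>p q. kern B p q - kern A p q)"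
proof -
  have "kern (B - A) = (\<lambda>p q. kern B p q - kern A p q)"
    using assms by (intro ext) (simp add: kern_minus)
  then show ?thesis using minus_carrier_mat[OF assms(1)] by (simp add: loewner_le_def psd_kern)
qed

lemma sdp_feasible_kern: "sdp_feasible X \<longleftrightarrow> X \<in> carrier_mat 4 4 \<and> feas (kern X)"
proof (cases "X \<in> carrier_mat 4 4")
  case X: True
  have h: "(1 / 2) \<cdot>\<^sub>m 1\<^sub>m 4 \<in> carrier_mat 4 4" "- ((1 / 2) \<cdot>\<^sub>m 1\<^sub>m 4) \<in> carrier_mat 4 4" by auto
  have 1: "loewner_le 4 (0\<^sub>m 4 4) X \<longleftrightarrow> pos (kern X)"
    using X by (simp add: loewner_kern kern_zero)
  have "(\<lambda>p q. kern ((1 / 2) \<cdot>\<^sub>m 1\<^sub>m 4) p q - kern (partial_transpose X) p q) = gap (pt (kern X))"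
    by (intro ext) (simp only: kern_smult_one kern_partial_transpose gap_def)
  then have 2: "loewner_le 4 (partial_transpose X) ((1 / 2) \<cdot>\<^sub>m 1\<^sub>m 4) \<longleftrightarrow> pos (gap (pt (kern X)))"
    using loewner_kern[OF partial_transpose_carrier[of X] h(1)] by simp
  have 3: "loewner_le 4 X (1\<^sub>m 4)" if f: "feas (kern X)"
  proof -
    have P: "pos (kern X)" using f by (simp add: feas_def)
    have "0 \<le> sesq (\<lambda>p q. kern (1\<^sub>m 4) p q - kern X p q) x x" for x
      using feas_le_one[OF f, of x] posD_Im[OF P, of x]
      by (simp add: kern_one sesq_minus sesq_one cdot_self less_eq_complex_def)
    then show ?thesis using X by (simp add: loewner_kern pos_def)
  qed
  have 4: "loewner_le 4 (- ((1 / 2) \<cdot>\<^sub>m 1\<^sub>m 4)) (partial_transpose X)" if f: "feas (kern X)"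
  proof -
    have P: "pos (kern X)" using f by (simp add: feas_def)
    have im: "Im (sesq (pt (kern X)) x x) = 0" for x
      using pos_pt_hermitian[OF P, of x x] by (simp add: complex_eq_iff)
    have "0 \<le> sesq (\<lambda>p q. kern (partial_transpose X) p q - kern (- ((1 / 2) \<cdot>\<^sub>m 1\<^sub>m 4)) p q) x x" for x
      unfolding kern_uminus_smult_one kern_partial_transpose
      using feas_pt_ge[OF f, of x] im[of x]
      by (simp only: sesq_minus sesq_one cdot_self) (simp add: less_eq_complex_def)
    then show ?thesis using loewner_kern[OF h(2) partial_transpose_carrier[of X]] by (simp add: pos_def)
  qed
  show ?thesis using X 1 2 3 4 unfolding sdp_feasible_def feas_def by auto
qed (simp add: sdp_feasible_def)

lemma sdp_value_kern:
  assumes "X \<in> carrier_mat 4 4"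
  shows "sdp_value \<rho> X = 1 / 2 - Re (tr2 (kern X) (pt (kern \<rho>)))"
  using assms by (simp add: sdp_value_def mat_trace_mult tr_pair_kern kern_partial_transpose)

lemma tr2_pos_real:
  assumes "pos K" "\<And>p q. L q p = cnj (L p q)"
  shows "Im (tr2 K L) = 0"
proof -
  have "cnj (tr2 K L) = (\<Sum>p\<in>UNIV. \<Sum>q\<in>UNIV. K q p * L p q)"
    unfolding tr2_def cnj_sum
    by (intro sum.cong refl) (metis assms(2) complex_cnj_mult pos_hermitian_entry[OF assms(1)])
  also have "\<dots> = tr2 K L" unfolding tr2_def by (rule sum.swap)
  finally show ?thesis by (simp add: complex_eq_iff)
qed

section \<open>Maximally entangled vectors\<close>

definition vkern :: "complex vec \<Rightarrow> qq \<Rightarrow> complex" where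
  "vkern v p = v $ ix p"

text \<open>\<open>U\<close> preserves the norm of \<open>c\<close>; written out in entries from the
  four equations contained in \<open>mat_adjoint U * U = 1\<close>.\<close>

lemma unitary_mat_row_col:
  assumes "unitary_mat 2 U" "(cmod (c False))\<^sup>2 + (cmod (c True))\<^sup>2 = n"
  shows "(cmod (U $$ (0, 0) * c False + U $$ (0, 1) * c True))\<^sup>2 + (cmod (U $$ (1, 0) * c False + U $$ (1, 1) * c True))\<^sup>2 = n"
proof -
  have U: "U \<in> carrier_mat 2 2" "mat_adjoint U * U = 1\<^sub>m 2" using assms by (auto simp: unitary_mat_def)
  have "(mat_adjoint U * U) $$ (i, j) = cnj (U $$ (0, i)) * U $$ (0, j) + cnj (U $$ (1, i)) * U $$ (1, j)"
    if "i < 2" "j < 2" for i j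
    using that U(1) by (simp add: mat_mult_index[OF mat_adjoint_carrier[OF U(1)] U(1)] numeral_2_eq_2 del: index_mult_mat(1))
  from this[of 0 0] this[of 0 1] this[of 1 0] this[of 1 1]
  have u: "cnj (U $$ (0, 0)) * U $$ (0, 0) + cnj (U $$ (1, 0)) * U $$ (1, 0) = 1"
    "cnj (U $$ (0, 0)) * U $$ (0, 1) + cnj (U $$ (1, 0)) * U $$ (1, 1) = 0"
    "cnj (U $$ (0, 1)) * U $$ (0, 0) + cnj (U $$ (1, 1)) * U $$ (1, 0) = 0"
    "cnj (U $$ (0, 1)) * U $$ (0, 1) + cnj (U $$ (1, 1)) * U $$ (1, 1) = 1"
    unfolding U(2) by simp_all
  let ?a = "U $$ (0, 0) * c False + U $$ (0, 1) * c True" and ?b = "U $$ (1, 0) * c False + U $$ (1, 1) * c True"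
  have "cnj ?a * ?a + cnj ?b * ?b
     = cnj (c False) * c False * (cnj (U $$ (0, 0)) * U $$ (0, 0) + cnj (U $$ (1, 0)) * U $$ (1, 0))
     + cnj (c False) * c True * (cnj (U $$ (0, 0)) * U $$ (0, 1) + cnj (U $$ (1, 0)) * U $$ (1, 1))
     + cnj (c True) * c False * (cnj (U $$ (0, 1)) * U $$ (0, 0) + cnj (U $$ (1, 1)) * U $$ (1, 0))
     + cnj (c True) * c True * (cnj (U $$ (0, 1)) * U $$ (0, 1) + cnj (U $$ (1, 1)) * U $$ (1, 1))"
    by (simp add: algebra_simps)
  also have "\<dots> = cnj (c False) * c False + cnj (c True) * c True" unfolding u by simp
  finally have "complex_of_real ((cmod ?a)\<^sup>2 + (cmod ?b)\<^sup>2) = complex_of_real ((cmod (c False))\<^sup>2 + (cmod (c True))\<^sup>2)"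
    by (simp only: of_real_add complex_norm_square mult.commute[of "cnj _"])
  then show ?thesis using assms(2) by (simp only: of_real_eq_iff)
qed

definition bit :: "bool \<Rightarrow> nat" where
  "bit i = (if i then 1 else 0)"

lemma bit_simps [simp]: "bit False = 0" "bit True = 1" "bit i < 2"
  by (simp_all add: bit_def)

lemma tensor_bell_entry:
  assumes "U \<in> carrier_mat 2 2" "V \<in> carrier_mat 2 2"
  shows "vkern ((U \<otimes>\<^sub>m V) *\<^sub>v bell) (i, j)
    = (U $$ (bit i, 0) * V $$ (bit j, 0) + U $$ (bit i, 1) * V $$ (bit j, 1)) / complex_of_real (sqrt 2)"
proof -
  have T: "U \<otimes>\<^sub>m V \<in> carrier_mat 4 4" using tensor_carrier[OF assms] by simp
  have "((U \<otimes>\<^sub>m V) *\<^sub>v bell) $ n = (\<Sum>m<4. (U \<otimes>\<^sub>m V) $$ (n, m) * bell $ m)" if "n < 4" for n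
    using T that by (auto simp: bell_def scalar_prod_def lessThan_atLeast0 intro!: sum.cong)
  then have "vkern ((U \<otimes>\<^sub>m V) *\<^sub>v bell) (i, j) = (\<Sum>m<4. (U \<otimes>\<^sub>m V) $$ (ix (i, j), m) * bell $ m)"
    by (simp add: vkern_def)
  also have "\<dots> = (U $$ (bit i, 0) * V $$ (bit j, 0) + U $$ (bit i, 1) * V $$ (bit j, 1)) / complex_of_real (sqrt 2)"
    using assms
    by (cases i; cases j) (simp_all add: sum_4 sum_qq UNIV_bool bell_def tensor_mat_def add_divide_distrib)
  finally show ?thesis .
qed

text \<open>Up to \<open>sqrt 2\<close> the coefficients of the vector form the product of
  \<open>U\<close> with the transpose of \<open>V\<close>. The amplitude involves the transposes of
  both unitaries, whose norm bound follows from that of the matrices by duality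
  (\<open>adj\<close>).\<close>

lemma max_entangled_contraction:
  assumes "max_entangled \<phi>"
  obtains w where "contraction w" "vkern \<phi> = (\<lambda>p. w p / complex_of_real (sqrt 2))" "\<phi> \<in> carrier_vec 4"
proof -
  obtain U V where UV: "unitary_mat 2 U" "unitary_mat 2 V" "\<phi> = (U \<otimes>\<^sub>m V) *\<^sub>v bell"
    using assms unfolding max_entangled_def by blast
  have c: "U \<in> carrier_mat 2 2" "V \<in> carrier_mat 2 2" using UV by (auto simp: unitary_mat_def)
  define w where "w p = U $$ (bit (fst p), 0) * V $$ (bit (snd p), 0) + U $$ (bit (fst p), 1) * V $$ (bit (snd p), 1)" for p
  have adj: "norm2 (\<lambda>k. \<Sum>i\<in>UNIV. W $$ (bit i, bit k) * e i) \<le> norm2 e" if W: "unitary_mat 2 W" for W e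
  proof -
    define g where "g k = (\<Sum>i\<in>UNIV. W $$ (bit i, bit k) * e i)" for k
    define h where "h i = W $$ (bit i, 0) * cnj (g False) + W $$ (bit i, 1) * cnj (g True)" for i
    have "cdot (cnjv e) h = cdot g g"
      by (simp add: cdot_def h_def g_def cnjv_def UNIV_bool algebra_simps)
    moreover have "norm2 h = norm2 g"
      using unitary_mat_row_col[OF W, of "\<lambda>k. cnj (g k)"] by (simp add: norm2_bool h_def)
    ultimately have "(norm2 g)\<^sup>2 \<le> norm2 e * norm2 g"
      using norm2_Cauchy_Schwarz[of "cnjv e" h] by (simp add: cdot_self)
    then have "norm2 g \<le> norm2 e"
      by (cases "norm2 g = 0") (auto simp: power2_eq_square order_less_le)
    then show ?thesis by (simp add: g_def[abs_def])
  qed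
  have "contraction w"
    unfolding contraction_def
  proof (intro allI)
    fix e f :: "bool \<Rightarrow> complex"
    let ?g = "\<lambda>k. \<Sum>i\<in>UNIV. U $$ (bit i, bit k) * e i" and ?h = "\<lambda>k. \<Sum>i\<in>UNIV. V $$ (bit i, bit k) * f i"
    have "amp w e f = cdot (cnjv ?g) ?h"
      by (simp add: amp_def cdot_def w_def cnjv_def UNIV_bool algebra_simps)
    then have "(cmod (amp w e f))\<^sup>2 \<le> norm2 ?g * norm2 ?h"
      using norm2_Cauchy_Schwarz[of "cnjv ?g" ?h] by simp
    also have "\<dots> \<le> norm2 e * norm2 f"
      by (intro mult_mono adj UV) simp_all
    finally show "(cmod (amp w e f))\<^sup>2 \<le> norm2 e * norm2 f" .
  qed
  moreover have "vkern \<phi> = (\<lambda>p. w p / complex_of_real (sqrt 2))"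
    unfolding UV(3) by (intro ext) (metis tensor_bell_entry[OF c] w_def prod.collapse)
  moreover have "\<phi> \<in> carrier_vec 4"
    unfolding UV(3) using tensor_carrier[OF c] by (intro mult_mat_vec_carrier[of _ 4 4]) (simp_all add: bell_def)
  ultimately show ?thesis by (rule that)
qed

lemma expectation_kern:
  assumes "M \<in> carrier_mat 4 4" "\<phi> \<in> carrier_vec 4"
  shows "(M *\<^sub>v \<phi>) \<bullet>c \<phi> = sesq (kern M) (vkern \<phi>) (vkern \<phi>)"
proof -
  have "(M *\<^sub>v \<phi>) \<bullet>c \<phi> = qf 4 M (\<lambda>i. \<phi> $ i)"
    using assms by (auto simp: qf_def scalar_prod_def lessThan_atLeast0 sum_distrib_right intro!: sum.cong)
  then show ?thesis by (simp add: qf_kern vkern_def[abs_def])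
qed

lemma tr2_gap: "tr2 (gap X) L = tr2 (\<lambda>p q. if p = q then 1 / 2 else 0) L - tr2 X L"
  by (simp add: tr2_def gap_def sum_subtractf left_diff_distrib)

lemma tr2_half:
  assumes "two_qubit_state \<rho>"
  shows "tr2 (\<lambda>p q. if p = q then 1 / 2 else 0) (pt (kern \<rho>)) = 1 / 2"
proof -
  have "\<rho> \<in> carrier_mat 4 4" "mat_trace \<rho> = 1" using assms by (auto simp: density_def psd_def)
  then have "(\<Sum>p\<in>UNIV. kern \<rho> p p) = 1"
    by (simp add: mat_trace_def sum_4 kern_def)
  then show ?thesis
    by (simp add: tr2_def pt_def sum_qq UNIV_bool algebra_simps)
qed

lemma locc_expectation_bound:
  assumes \<rho>: "two_qubit_state \<rho>" and \<Lambda>: "locc_two_qubits \<Lambda>" and \<phi>: "max_entangled \<phi>"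
  obtains X where "sdp_feasible X" "Re ((\<Lambda> \<rho> *\<^sub>v \<phi>) \<bullet>c \<phi>) = sdp_value \<rho> X" "\<Lambda> \<rho> \<in> carrier_mat 4 4"
proof -
  have \<rho>c: "\<rho> \<in> carrier_mat 4 4" using \<rho> by (auto simp: density_def psd_def)
  obtain w where w: "contraction w" "vkern \<phi> = (\<lambda>p. w p / complex_of_real (sqrt 2))" "\<phi> \<in> carrier_vec 4"
    using max_entangled_contraction[OF \<phi>] by blast
  define P where "P = of_kern (outer (vkern \<phi>))"
  have "feas (outer (vkern \<phi>))" unfolding w(2) feas_outer_iff by (rule w(1))
  then have "dual_feas 2 2 P" by (simp add: dual_feas_kern P_def)
  from locc_dual[OF \<Lambda> this] obtain Y where Y: "dual_feas 2 2 Y"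
    "\<Lambda> \<rho> \<in> carrier_mat 4 4" "tr_pair 4 (\<Lambda> \<rho>) P = tr_pair 4 \<rho> Y"
    using \<rho>c by auto
  \<comment> \<open>The trace of \<open>\<rho>\<close> is 1, so the identity part contributes 1/2
    and the value at \<open>X\<close> is the expectation of \<open>Y\<close>.\<close>
  define X where "X = of_kern (gap (pt (kern Y)))"
  have "feas (kern Y)" using Y(1) by (simp add: dual_feas_kern)
  then have "sdp_feasible X" by (simp add: sdp_feasible_kern X_def feas_dual)
  moreover have "Re ((\<Lambda> \<rho> *\<^sub>v \<phi>) \<bullet>c \<phi>) = sdp_value \<rho> X"
  proof -
    have "(\<Lambda> \<rho> *\<^sub>v \<phi>) \<bullet>c \<phi> = tr2 (outer (vkern \<phi>)) (kern (\<Lambda> \<rho>))"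
      by (simp add: expectation_kern[OF Y(2) w(3)] tr2_outer)
    also have "\<dots> = tr_pair 4 (\<Lambda> \<rho>) P" by (subst tr_pair_commute) (simp add: tr_pair_kern P_def)
    also have "\<dots> = tr2 (kern Y) (kern \<rho>)" by (subst Y(3), subst tr_pair_commute) (simp add: tr_pair_kern)
    finally have 1: "(\<Lambda> \<rho> *\<^sub>v \<phi>) \<bullet>c \<phi> = tr2 (kern Y) (kern \<rho>)" .
    have "tr2 (gap (pt (kern Y))) (pt (kern \<rho>)) = 1 / 2 - tr2 (kern Y) (kern \<rho>)"
      by (simp only: tr2_gap tr2_half[OF \<rho>] tr2_pt pt_pt)
    then show ?thesis unfolding 1 by (simp add: sdp_value_kern X_def)
  qed
  ultimately show ?thesis using Y(2) that by blast
qed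


section \<open>The filter protocol\<close>

lemma vec_space_rank_le_1:
  assumes "A \<in> carrier_mat 4 4" "\<And>i j. i < 4 \<Longrightarrow> j < 4 \<Longrightarrow> A $$ (i, j) = f i * (g j :: complex)"
  shows "vec_space.rank 4 A \<le> 1"
  using assms by (intro vec_space.rank_le_1_product_entries[of A 4 4 f g]) auto

lemma vec_space_rank_ge_1:
  assumes A: "A \<in> carrier_mat 4 4" and nz: "i < 4" "j < 4" "A $$ (i, j) \<noteq> (0 :: complex)"
  shows "1 \<le> vec_space.rank 4 A"
proof -
  interpret vec_space "TYPE(complex)" 4 .
  let ?u = "col A j"
  have u: "?u \<in> carrier_vec 4" using A by (metis col_dim carrier_matD(1))
  have "?u $ i \<noteq> 0\<^sub>v 4 $ i" using A nz by simp
  then have u0: "?u \<noteq> 0\<^sub>v 4" by metis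
  have "\<not> lin_dep {?u}"
    using lindep_span[of "{?u}"] u u0 span_empty by auto
  moreover have "{?u} \<subseteq> set (cols A)" using A nz(2) by (auto simp: cols_def)
  ultimately have "card {?u} \<le> rank A" by (intro rank_ge_card_indpt[OF A])
  then show ?thesis by simp
qed

lemma other_apply_local_carrier: "apply_local p 2 (2, Ks) M \<in> carrier_mat 4 4"
  using apply_local_carrier[of p 2 "(2, Ks)" M] by simp

lemma sum_mats_single: "Z \<in> carrier_mat n n \<Longrightarrow> sum_mats n n [Z] = Z"
  by (simp add: sum_mats_def)

lemma locc_local_channel:
  assumes "instrument 2 [(2, D)]"
  shows "locc_two_qubits (apply_local p 2 (2, D))"
proof -
  have "locc 2 2 2 2 (\<lambda>M. sum_mats (2 * 2) (2 * 2)
      (map (\<lambda>i. (\<lambda>M. M) (apply_local p 2 ([(2, D)] ! i) M)) [0..<length [(2, D)]]))"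
    using locc.alice[OF assms, of 2 2 2 "\<lambda>_ M. M"] locc.bob[OF assms, of 2 2 2 "\<lambda>_ M. M"] locc.finish[of 2 2]
    by (cases p) auto
  then show ?thesis
    by (simp add: sum_mats_single[OF other_apply_local_carrier])
qed

lemma one_way_locc_is_locc:
  assumes "one_way_locc \<Lambda>"
  shows "locc_two_qubits \<Lambda>"
proof -
  obtain p E Ds where E: "instrument 2 E" "\<forall>e\<in>set E. fst e = 2" "length Ds = length E"
    "\<forall>D\<in>set Ds. instrument 2 [(2, D)]" "\<Lambda> = one_way_map p E Ds"
    using assms unfolding one_way_locc_def by blast
  have "locc_two_qubits (apply_local q 2 (2, Ds ! i))" if "i < length E" for i q
    using E(3,4) that by (intro locc_local_channel) simp
  then have F: "\<forall>i<length E. locc 2 2 (fst (E ! i)) 2 (apply_local (other p) 2 (2, Ds ! i))"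
    "\<forall>i<length E. locc 2 2 2 (fst (E ! i)) (apply_local (other p) 2 (2, Ds ! i))"
    using E(2) by simp_all
  have "locc 2 2 2 2 (\<lambda>M. sum_mats (2 * 2) (2 * 2)
      (map (\<lambda>i. apply_local (other p) 2 (2, Ds ! i) (apply_local p 2 (E ! i) M)) [0..<length E]))"
    using locc.alice[OF E(1) F(1)] locc.bob[OF E(1) F(2)] by (cases p) auto
  moreover have "\<Lambda> = (\<lambda>M. sum_mats (2 * 2) (2 * 2)
      (map (\<lambda>i. apply_local (other p) 2 (2, Ds ! i) (apply_local p 2 (E ! i) M)) [0..<length E]))"
    unfolding E(5) by (intro ext) (simp add: one_way_map_def)
  ultimately show ?thesis by simp
qed

section \<open>Completeness relations and value of the filter instrument\<close>

lemma gram_index: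
  "K \<in> carrier_mat 2 2 \<Longrightarrow> i < 2 \<Longrightarrow> j < 2 \<Longrightarrow>
    (mat_adjoint K * K) $$ (i, j) = cnj (K $$ (0, i)) * K $$ (0, j) + cnj (K $$ (1, i)) * K $$ (1, j)"
  by (simp add: mat_mult_index[OF mat_adjoint_carrier] numeral_2_eq_2 del: index_mult_mat(1))

lemma mult_index_2:
  "A \<in> carrier_mat 2 2 \<Longrightarrow> B \<in> carrier_mat 2 2 \<Longrightarrow> i < 2 \<Longrightarrow> j < 2 \<Longrightarrow>
    (A * B) $$ (i, j) = A $$ (i, 0) * B $$ (0, j) + A $$ (i, 1) * B $$ (1, j :: nat)"
  for A B :: "complex mat"
  by (simp add: mat_mult_index numeral_2_eq_2 del: index_mult_mat(1))

definition prep :: "complex vec \<Rightarrow> nat \<Rightarrow> complex mat" where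
  "prep u k = mat 2 2 (\<lambda>(i, j). if j = k then u $ i else 0)"

lemma prepare_list: "prepare u = [prep u 0, prep u 1]"
  by (simp add: prepare_def prep_def upt_rec)

lemma prep_carrier [simp]: "prep u k \<in> carrier_mat 2 2"
  by (simp add: prep_def)

lemma prep_index: "i < 2 \<Longrightarrow> j < 2 \<Longrightarrow> prep u k $$ (i, j) = (if j = k then u $ i else 0)"
  by (simp add: prep_def)

lemma unit_vector_2: "unit_vector 2 u \<Longrightarrow> cnj (u $ 0) * u $ 0 + cnj (u $ 1) * u $ 1 = 1"
  by (auto simp: unit_vector_def scalar_prod_def numeral_2_eq_2 mult.commute)

lemma add_zero_index:
  "G \<in> carrier_mat n n \<Longrightarrow> H \<in> carrier_mat n n \<Longrightarrow> i < n \<Longrightarrow> j < n \<Longrightarrow>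
    (G + (H + 0\<^sub>m n n)) $$ (i, j) = G $$ (i, j) + (H $$ (i, j) :: complex)"
  by auto

text \<open>Re-preparing a unit vector after \<open>B\<close> preserves the completeness relation,
  because the preparation is itself a channel.\<close>

lemma gram_prepare:
  assumes u: "unit_vector 2 u" and B: "B \<in> carrier_mat 2 2"
  shows "mat_adjoint (prep u 0 * B) * (prep u 0 * B) + (mat_adjoint (prep u 1 * B) * (prep u 1 * B) + 0\<^sub>m 2 2)
    = mat_adjoint B * B"
proof (rule eq_matI)
  have c: "prep u k * B \<in> carrier_mat 2 2" for k by (rule mult_carrier_mat[OF prep_carrier B])
  have gc: "mat_adjoint K * K \<in> carrier_mat 2 2" if "K \<in> carrier_mat 2 2" for K :: "complex mat"
    using that by (intro mult_carrier_mat mat_adjoint_carrier)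
  fix i j
  assume "i < dim_row (mat_adjoint B * B)" "j < dim_col (mat_adjoint B * B)"
  then have ij: "i < 2" "j < 2" using B by auto
  have e: "(prep u k * B) $$ (l, m) = u $ l * B $$ (k, m)" if "k < 2" "l < 2" "m < 2" for k l m
    using that B by (auto simp: mult_index_2 prep_index less_2_cases_iff simp del: index_mult_mat(1))
  have "(mat_adjoint (prep u 0 * B) * (prep u 0 * B) + (mat_adjoint (prep u 1 * B) * (prep u 1 * B) + 0\<^sub>m 2 2)) $$ (i, j)
      = (mat_adjoint (prep u 0 * B) * (prep u 0 * B)) $$ (i, j) + (mat_adjoint (prep u 1 * B) * (prep u 1 * B)) $$ (i, j)"
    by (rule add_zero_index[OF gc[OF c] gc[OF c] ij])
  also have "\<dots> = (cnj (u $ 0) * u $ 0 + cnj (u $ 1) * u $ 1) * (cnj (B $$ (0, i)) * B $$ (0, j) + cnj (B $$ (1, i)) * B $$ (1, j))"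
    unfolding gram_index[OF c ij] using ij by (simp add: e algebra_simps)
  also have "\<dots> = (mat_adjoint B * B) $$ (i, j)"
    unfolding unit_vector_2[OF u] gram_index[OF B ij] by simp
  finally show "(mat_adjoint (prep u 0 * B) * (prep u 0 * B) + (mat_adjoint (prep u 1 * B) * (prep u 1 * B) + 0\<^sub>m 2 2)) $$ (i, j)
      = (mat_adjoint B * B) $$ (i, j)" .
qed (use B in auto)

lemma instrument_prepare:
  assumes "unit_vector 2 v"
  shows "instrument 2 [(2, prepare v)]"
proof -
  have "mat_adjoint (prep v 0) * prep v 0 + (mat_adjoint (prep v 1) * prep v 1 + 0\<^sub>m 2 2)
      = mat_adjoint (prep v 0 * 1\<^sub>m 2) * (prep v 0 * 1\<^sub>m 2) + (mat_adjoint (prep v 1 * 1\<^sub>m 2) * (prep v 1 * 1\<^sub>m 2) + 0\<^sub>m 2 2)"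
    by (simp add: right_mult_one_mat[OF prep_carrier])
  also have "\<dots> = mat_adjoint (1\<^sub>m 2) * 1\<^sub>m 2" by (rule gram_prepare[OF assms]) simp
  also have "\<dots> = (1\<^sub>m 2 :: complex mat)"
    by (rule eq_matI) (auto simp: gram_index less_2_cases_iff simp del: index_mult_mat(1))
  finally show ?thesis by (simp add: instrument_def prepare_list sum_mats_def)
qed

lemma filter_protocol_one_way:
  assumes "filter_protocol p A \<Lambda>"
  shows "one_way_locc \<Lambda>"
proof -
  obtain B u v where B: "B \<in> carrier_mat 2 2" "mat_adjoint A * A + mat_adjoint B * B = 1\<^sub>m 2"
    and uv: "unit_vector 2 u" "unit_vector 2 v"
    and \<Lambda>: "\<Lambda> = one_way_map p [(2, [A]), (2, map (\<lambda>K. K * B) (prepare u))] [[1\<^sub>m 2], prepare v]"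
    using assms unfolding filter_protocol_def by blast
  have A: "A \<in> carrier_mat 2 2" using assms by (auto simp: filter_protocol_def is_filter_def)
  let ?E = "[(2, [A]), (2, map (\<lambda>K. K * B) (prepare u))]"
  have "instrument 2 ?E"
    using A B gram_prepare[OF uv(1) B(1)] mult_carrier_mat[OF prep_carrier B(1)]
    by (simp add: instrument_def prepare_list sum_mats_def)
  moreover have "instrument 2 [(2, [1\<^sub>m 2])]"
    by (auto simp: instrument_def sum_mats_def gram_index less_2_cases_iff simp del: index_mult_mat(1) intro!: eq_matI)
  ultimately show ?thesis
    unfolding one_way_locc_def \<Lambda> using instrument_prepare[OF uv(2)]
    by (intro exI[of _ p] exI[of _ ?E] exI[of _ "[[1\<^sub>m 2], prepare v]"]) simp
qed

definition of_mat2 :: "complex mat \<Rightarrow> qq \<Rightarrow> complex" where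
  "of_mat2 A p = A $$ (bit (fst p), bit (snd p))"

lemma ix_bit: "ix (i, j) = bit i * 2 + bit j"
  by (simp add: ix_def bit_def)

lemma sum_2: "(\<Sum>i<2. f i) = (\<Sum>i\<in>UNIV. f (bit i))"
  for f :: "nat \<Rightarrow> 'a::comm_monoid_add"
  by (simp add: UNIV_bool numeral_2_eq_2 add.commute)

lemma kern_pullback_Bob:
  assumes "K \<in> carrier_mat 2 2" "Z \<in> carrier_mat 4 4"
  shows "kern (pullback (local_mat Bob 2 K) Z) (i, j) (k, l)
    = (\<Sum>j'\<in>UNIV. \<Sum>l'\<in>UNIV. cnj (K $$ (bit j', bit j)) * kern Z (i, j') (k, l') * K $$ (bit l', bit l))"
  using pullback_Bob_index[OF assms(1), of Z 2 "bit i" "bit j" "bit k" "bit l"] assms(2)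
  by (simp add: local_mat_def kern_def ix_bit sum_2)

lemma kern_pullback_Alice:
  assumes "K \<in> carrier_mat 2 2" "Z \<in> carrier_mat 4 4"
  shows "kern (pullback (local_mat Alice 2 K) Z) (i, j) (k, l)
    = (\<Sum>i'\<in>UNIV. \<Sum>k'\<in>UNIV. cnj (K $$ (bit i', bit i)) * kern Z (i', j) (k', l) * K $$ (bit k', bit k))"
  using pullback_Alice_index[OF assms(1), of Z 2 "bit i" "bit j" "bit k" "bit l"] assms(2)
  by (simp add: local_mat_def kern_def ix_bit sum_2)

lemma pullback_local_carrier:
  assumes "K \<in> carrier_mat 2 2" "Z \<in> carrier_mat 4 4"
  shows "pullback (local_mat p 2 K) Z \<in> carrier_mat 4 4"
  using pullback_carrier[OF local_mat_carrier[OF assms(1), of p 2]] assms(2) by simp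

lemma tr_pair_apply_local_2:
  assumes "\<And>K. K \<in> set Ks \<Longrightarrow> K \<in> carrier_mat 2 2" "M \<in> carrier_mat 4 4" "Z \<in> carrier_mat 4 4"
  shows "tr_pair 4 (apply_local p 2 (2, Ks) M) Z = (\<Sum>K\<leftarrow>Ks. tr_pair 4 M (pullback (local_mat p 2 K) Z))"
  using tr_pair_apply_local[of "(2, Ks)" 2 M 2 Z p] assms by simp

lemma singlet_max_entangled:
  obtains \<phi> where "max_entangled \<phi>" "vkern \<phi> = (\<lambda>p. singlet p / complex_of_real (sqrt 2))" "\<phi> \<in> carrier_vec 4"
proof -
  \<comment> \<open>This unitary sends 0 to 1 and 1 to -0, hence the Bell vector to the
    singlet.\<close>
  let ?V = "mat 2 2 (\<lambda>(i, j). if i = 1 \<and> j = 0 then 1 else if i = 0 \<and> j = 1 then - 1 else 0 :: complex)"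
  have V: "?V \<in> carrier_mat 2 2" by simp
  have "unitary_mat 2 (1\<^sub>m 2)" "unitary_mat 2 ?V"
    by (auto simp: unitary_mat_def gram_index less_2_cases_iff simp del: index_mult_mat(1) intro!: eq_matI)
  then have m: "max_entangled ((1\<^sub>m 2 \<otimes>\<^sub>m ?V) *\<^sub>v bell)" unfolding max_entangled_def by blast
  have "vkern ((1\<^sub>m 2 \<otimes>\<^sub>m ?V) *\<^sub>v bell) p = singlet p / complex_of_real (sqrt 2)" for p
    using tensor_bell_entry[OF one_carrier_mat V, of "fst p" "snd p"]
    by (cases p rule: qq_cases) (simp_all add: singlet_def single_def)
  then have "vkern ((1\<^sub>m 2 \<otimes>\<^sub>m ?V) *\<^sub>v bell) = (\<lambda>p. singlet p / complex_of_real (sqrt 2))" by (rule ext)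
  moreover have "(1\<^sub>m 2 \<otimes>\<^sub>m ?V) *\<^sub>v bell \<in> carrier_vec 4"
    using max_entangled_contraction[OF m] by blast
  ultimately show ?thesis using m that by blast
qed

lemma outer_div_sqrt2: "outer (\<lambda>p. y p / complex_of_real (sqrt 2)) p q = outer y p q / 2"
proof -
  have "complex_of_real (sqrt 2) * complex_of_real (sqrt 2) = 2"
    by (metis of_real_mult real_sqrt_mult_self abs_numeral of_real_numeral)
  then show ?thesis by (simp add: outer_def)
qed

text \<open>On success the singlet projector pulls back to \<open>A\<close>-conjugated antisymmetry, on failure
  the prepared state \<open>|01>\<close> has overlap \<open>1 / 2\<close> with the singlet; both parts add up to
  \<open>I / 2 - X\<^sup>\<Gamma>\<close> because \<open>A\<^sup>\<dagger> A + B\<^sup>\<dagger> B = I\<close>.\<close>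

lemma filter_protocol_value:
  assumes \<rho>: "\<rho> \<in> carrier_mat 4 4" and A: "A \<in> carrier_mat 2 2" and B: "B \<in> carrier_mat 2 2"
    and AB: "mat_adjoint A * A + mat_adjoint B * B = 1\<^sub>m 2"
    and \<Lambda>: "\<Lambda> = one_way_map Bob [(2, [A]), (2, map (\<lambda>K. K * B) (prepare (unit_vec 2 1)))]
        [[1\<^sub>m 2], prepare (unit_vec 2 0)]"
    and P: "P \<in> carrier_mat 4 4" "\<And>p q. kern P p q = outer singlet p q / 2"
  shows "tr_pair 4 (\<Lambda> \<rho>) P = tr2 (gap (pt (outer (\<lambda>p. of_mat2 A p / complex_of_real (sqrt 2))))) (kern \<rho>)"
proof -
  let ?L = "local_mat Alice 2" and ?R = "local_mat Bob 2"
  let ?u = "unit_vec 2 1 :: complex vec" and ?v = "unit_vec 2 0 :: complex vec"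
  define C where "C k = prep ?u k * B" for k
  let ?S = "pullback (?R A) (pullback (?L (1\<^sub>m 2)) P)"
  let ?T = "\<lambda>m n. pullback (?R (C m)) (pullback (?L (prep ?v n)) P)"
  let ?G = "gap (pt (outer (\<lambda>p. of_mat2 A p / complex_of_real (sqrt 2))))"
  let ?a = "\<lambda>i j. cnj (A $$ (0, i)) * A $$ (0, j) + cnj (A $$ (1, i)) * A $$ (1, j)"
  let ?b = "\<lambda>i j. cnj (B $$ (0, i)) * B $$ (0, j) + cnj (B $$ (1, i)) * B $$ (1, j)"
  let ?M1 = "apply_local Bob 2 (2, [A]) \<rho>" and ?M2 = "apply_local Bob 2 (2, [C 0, C 1]) \<rho>"
  let ?F = "\<lambda>p q. (kern (?T 0 0) p q + kern (?T 1 0) p q) + (kern (?T 0 1) p q + kern (?T 1 1) p q)"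
  have C: "C k \<in> carrier_mat 2 2" for k unfolding C_def by (rule mult_carrier_mat[OF prep_carrier B])
  have Ce: "C k $$ (i, j) = (if i = 1 then B $$ (k, j) else 0)" if "k < 2" "i < 2" "j < 2" for i j k
    using that B by (auto simp: C_def mult_index_2 prep_index less_2_cases_iff simp del: index_mult_mat(1))
  have pr: "prep ?v k $$ (i, j) = (if j = k \<and> i = 0 then 1 else 0)" if "i < 2" "j < 2" for i j k
    using that by (simp add: prep_index)
  have c1: "pullback (?L (1\<^sub>m 2)) P \<in> carrier_mat 4 4" and c2: "pullback (?L (prep ?v k)) P \<in> carrier_mat 4 4" for k
    using P(1) by (simp_all add: pullback_local_carrier)
  have sw: "tr_pair 4 \<rho> Z = tr2 (kern Z) (kern \<rho>)" for Z
    by (subst tr_pair_commute) (rule tr_pair_kern)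
  have "\<Lambda> \<rho> = sum_mats 4 4 [apply_local Alice 2 (2, [1\<^sub>m 2]) ?M1,
      apply_local Alice 2 (2, prepare ?v) ?M2]"
    by (simp add: \<Lambda> one_way_map_def upt_rec prepare_list C_def)
  then have "tr_pair 4 (\<Lambda> \<rho>) P = tr_pair 4 (apply_local Alice 2 (2, [1\<^sub>m 2]) ?M1) P
      + tr_pair 4 (apply_local Alice 2 (2, prepare ?v) ?M2) P"
    by (simp only:) (subst tr_pair_sum_mats, auto simp: other_apply_local_carrier)
  also have "tr_pair 4 (apply_local Alice 2 (2, [1\<^sub>m 2]) ?M1) P
      = tr_pair 4 ?M1 (pullback (?L (1\<^sub>m 2)) P)"
    by (subst tr_pair_apply_local_2) (simp_all add: other_apply_local_carrier P)
  also have "\<dots> = tr_pair 4 \<rho> ?S"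
    by (subst tr_pair_apply_local_2) (simp_all add: A \<rho> c1)
  also have "tr_pair 4 (apply_local Alice 2 (2, prepare ?v) ?M2) P
      = tr_pair 4 ?M2 (pullback (?L (prep ?v 0)) P)
        + tr_pair 4 ?M2 (pullback (?L (prep ?v 1)) P)"
    by (subst tr_pair_apply_local_2) (auto simp: other_apply_local_carrier P prepare_list)
  also have "tr_pair 4 ?M2 (pullback (?L (prep ?v 0)) P)
      = tr_pair 4 \<rho> (?T 0 0) + tr_pair 4 \<rho> (?T 1 0)"
    by (subst tr_pair_apply_local_2) (auto simp: C \<rho> c2)
  also have "tr_pair 4 ?M2 (pullback (?L (prep ?v 1)) P)
      = tr_pair 4 \<rho> (?T 0 1) + tr_pair 4 \<rho> (?T 1 1)"
    by (subst tr_pair_apply_local_2) (auto simp: C \<rho> c2)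
  finally have 1: "tr_pair 4 (\<Lambda> \<rho>) P = tr2 (\<lambda>p q. kern ?S p q + ?F p q) (kern \<rho>)"
    by (simp only: sw tr2_plus)
  have g: "?a i j + ?b i j = (if i = j then 1 else 0)"
    if "i < 2" "j < 2" for i j
  proof -
    have "(mat_adjoint A * A + mat_adjoint B * B) $$ (i, j) = (mat_adjoint A * A) $$ (i, j) + (mat_adjoint B * B) $$ (i, j)"
      using A B that by (intro index_add_mat(1)) auto
    then show ?thesis unfolding AB gram_index[OF A that] gram_index[OF B that] using that by simp
  qed
  have BB: "?b i j
      = (if i = j then 1 else 0) - ?a i j"
    if "i < 2" "j < 2" for i j
    using g[OF that] by (simp add: algebra_simps)
  have s1: "kern ?S (i, j) (k, l)
      = (if i then - cnj (A $$ (0, bit j)) else cnj (A $$ (1, bit j)))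
        * (if k then - A $$ (0, bit l) else A $$ (1, bit l)) / 2" for i j k l
    unfolding kern_pullback_Bob[OF A c1] kern_pullback_Alice[OF one_carrier_mat P(1)] P(2)
    by (cases i; cases k) (simp_all add: UNIV_bool outer_def singlet_def single_def)
  \<comment> \<open>Alice's preparation in branch \<open>n\<close> reads out her old basis state
    \<open>n\<close>, so summing over \<open>n\<close> leaves the identity on her side and half of
    \<open>B\<^sup>\<dagger> B\<close> on Bob's.\<close>
  have s2: "kern (?T m n) (i, j) (k, l)
      = (if bit i = n \<and> bit k = n then cnj (B $$ (m, bit j)) * B $$ (m, bit l) / 2 else 0)"
    if "m < 2" for i j k l m n
    unfolding kern_pullback_Bob[OF C c2] kern_pullback_Alice[OF prep_carrier P(1)] P(2)
    using that by (cases i; cases k; cases "n = 0") (simp_all add: UNIV_bool outer_def singlet_def single_def Ce pr)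
  have "kern ?S (i, j) (k, l) + ?F (i, j) (k, l) = ?G (i, j) (k, l)" for i j k l
  proof -
    have b: "(bit j = bit l) = (j = l)" by (simp add: bit_def)
    have gp: "?G (i, j) (k, l)
        = (if i = k \<and> j = l then 1 / 2 else 0) - A $$ (bit i, bit l) * cnj (A $$ (bit k, bit j)) / 2"
      unfolding gap_def pt_def outer_div_sqrt2 by (simp add: outer_def of_mat2_def)
    have "?F (i, j) (k, l)
       = (if i = k then ?b (bit j) (bit l) / 2 else 0)"
      by (cases i; cases k) (simp_all add: s2 add_divide_distrib)
    also have "\<dots> = (if i = k then ((if j = l then 1 else 0) - ?a (bit j) (bit l)) / 2 else 0)"
      by (simp only: BB[OF bit_simps(3) bit_simps(3)] b)
    finally have s3: "?F (i, j) (k, l)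
       = (if i = k then ((if j = l then 1 else 0) - ?a (bit j) (bit l)) / 2 else 0)" .
    \<comment> \<open>For \<open>i = k\<close> the success term cancels the row of \<open>A\<close>
      other than \<open>i\<close> in \<open>A\<^sup>\<dagger> A\<close>, leaving row
      \<open>i\<close>; for \<open>i \<noteq> k\<close> the sign of the singlet supplies the cross
      term.\<close>
    show ?thesis unfolding gp s1 s3
      by (cases i; cases k; cases "j = l") (simp_all add: field_simps)
  qed
  then have "(\<lambda>p q. kern ?S p q + ?F p q)
      = ?G"
    by (intro ext) (metis prod.collapse)
  then show ?thesis unfolding 1 by simp
qed

text \<open>\<open>G\<close> is the kernel of \<open>I - A\<^sup>\<dagger> A\<close>, positive
  because \<open>A\<close> is a contraction; its Cholesky factor serves as the failure
  operator.\<close>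

lemma contraction_complement:
  assumes A: "A \<in> carrier_mat 2 2" and c: "contraction (of_mat2 A)"
  obtains B where "B \<in> carrier_mat 2 2" "mat_adjoint A * A + mat_adjoint B * B = 1\<^sub>m 2"
proof -
  define G where "G j l = (if j = l then 1 else 0) - (\<Sum>m\<in>UNIV. outer (\<lambda>j. cnj (A $$ (bit m, bit j))) j l)" for j l
  have "pos G"
    unfolding pos_def
  proof
    fix x
    have "sesq G x x = complex_of_real (norm2 x - norm2 (\<lambda>i. \<Sum>j\<in>UNIV. of_mat2 A (i, j) * x j))"
    proof -
      have "sesq G x x = cdot x x - (\<Sum>m\<in>UNIV. sesq (outer (\<lambda>j. cnj (A $$ (bit m, bit j)))) x x)"
        by (simp add: sesq_def cdot_def G_def outer_def UNIV_bool algebra_simps)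
      also have "(\<Sum>m\<in>UNIV. sesq (outer (\<lambda>j. cnj (A $$ (bit m, bit j)))) x x)
          = complex_of_real (norm2 (\<lambda>i. \<Sum>j\<in>UNIV. of_mat2 A (i, j) * x j))"
        unfolding sesq_outer_self norm2_def of_real_sum
      proof (intro sum.cong refl)
        fix m :: bool
        have "cdot x (\<lambda>j. cnj (A $$ (bit m, bit j))) = cnj (\<Sum>j\<in>UNIV. of_mat2 A (m, j) * x j)"
          by (simp add: cdot_def of_mat2_def mult.commute)
        then show "complex_of_real ((cmod (cdot x (\<lambda>j. cnj (A $$ (bit m, bit j)))))\<^sup>2)
            = complex_of_real ((cmod (\<Sum>j\<in>UNIV. of_mat2 A (m, j) * x j))\<^sup>2)" by (simp only: complex_mod_cnj)
      qed
      finally show ?thesis by (simp add: cdot_self)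
    qed
    then show "0 \<le> sesq G x x" using contraction_row[OF c, of x] by (simp add: less_eq_complex_def)
  qed
  then obtain vs where vs: "length vs = CARD(bool)" "\<forall>p q. G p q = (\<Sum>v\<leftarrow>vs. outer v p q)"
    using pos_decomp[of G] by blast
  then obtain v0 v1 where v: "vs = [v0, v1]"
    by (auto simp: numeral_2_eq_2 length_Suc_conv)
  \<comment> \<open>The two Cholesky vectors, conjugated, become the rows, so that
    \<open>B\<^sup>\<dagger> B\<close> is the sum of their projectors.\<close>
  define B where "B = mat 2 2 (\<lambda>(m, j). cnj ((if m = 0 then v0 else v1) (j = 1)))"
  have B: "B \<in> carrier_mat 2 2" by (simp add: B_def)
  have bit1: "bit (i = 1) = i" if "i < 2" for i using that by (auto simp: bit_def less_2_cases_iff)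
  have "mat_adjoint A * A + mat_adjoint B * B = 1\<^sub>m 2"
  proof (rule eq_matI)
    fix i j
    assume "i < dim_row (1\<^sub>m 2 :: complex mat)" "j < dim_col (1\<^sub>m 2 :: complex mat)"
    then have ij: "i < 2" "j < 2" by auto
    have "(mat_adjoint A * A + mat_adjoint B * B) $$ (i, j) = (mat_adjoint A * A) $$ (i, j) + (mat_adjoint B * B) $$ (i, j)"
      using A B ij by (intro index_add_mat(1)) auto
    also have "(mat_adjoint B * B) $$ (i, j) = G (i = 1) (j = 1)"
      unfolding gram_index[OF B ij] using ij vs(2) by (simp add: v B_def outer_def)
    also have "\<dots> = (if i = j then 1 else 0) - (mat_adjoint A * A) $$ (i, j)"
      unfolding gram_index[OF A ij] G_def using ij bit1 by (auto simp: UNIV_bool outer_def less_2_cases_iff)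
    finally show "(mat_adjoint A * A + mat_adjoint B * B) $$ (i, j) = 1\<^sub>m 2 $$ (i, j)" using ij by simp
  qed (use A B in auto)
  then show ?thesis using B that by blast
qed

lemma add_diff_cancel_mat:
  "G \<in> carrier_mat n n \<Longrightarrow> H \<in> carrier_mat n n \<Longrightarrow> G + H - G = (H :: complex mat)"
  by (intro eq_matI) auto

lemma is_filter_of_complement:
  assumes A: "A \<in> carrier_mat 2 2" and B: "B \<in> carrier_mat 2 2" "mat_adjoint A * A + mat_adjoint B * B = 1\<^sub>m 2"
  shows "is_filter A"
proof -
  have g: "mat_adjoint A * A \<in> carrier_mat 2 2" "mat_adjoint B * B \<in> carrier_mat 2 2"
    using A B by (auto intro!: mult_carrier_mat[of _ 2 2] mat_adjoint_carrier)
  have "1\<^sub>m 2 - mat_adjoint A * A = mat_adjoint B * B"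
    unfolding B(2)[symmetric] by (rule add_diff_cancel_mat[OF g])
  moreover have "psd 2 (mat_adjoint B * B)"
    unfolding psd_iff_qf using g qf_mult_adjoint[OF B(1)] by (simp add: less_eq_complex_def nrm2_def sum_nonneg)
  ultimately show ?thesis using A by (simp add: is_filter_def loewner_le_def)
qed

lemma filter_protocol_exists:
  assumes \<rho>: "\<rho> \<in> carrier_mat 4 4" and A: "A \<in> carrier_mat 2 2" and c: "contraction (of_mat2 A)"
  obtains \<Lambda> \<phi> where "filter_protocol Bob A \<Lambda>" "max_entangled \<phi>" "\<Lambda> \<rho> \<in> carrier_mat 4 4"
    "(\<Lambda> \<rho> *\<^sub>v \<phi>) \<bullet>c \<phi> = tr2 (gap (pt (outer (\<lambda>p. of_mat2 A p / complex_of_real (sqrt 2))))) (kern \<rho>)"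
proof -
  obtain B where B: "B \<in> carrier_mat 2 2" "mat_adjoint A * A + mat_adjoint B * B = 1\<^sub>m 2"
    using contraction_complement[OF A c] by blast
  define \<Lambda> where "\<Lambda> = one_way_map Bob [(2, [A]), (2, map (\<lambda>K. K * B) (prepare (unit_vec 2 1)))] [[1\<^sub>m 2], prepare (unit_vec 2 0)]"
  have "unit_vector 2 (unit_vec 2 1)" "unit_vector 2 (unit_vec 2 0)"
    by (simp_all add: unit_vector_def scalar_prod_def numeral_2_eq_2)
  then have 1: "filter_protocol Bob A \<Lambda>"
    unfolding filter_protocol_def \<Lambda>_def using is_filter_of_complement[OF A B] B by blast
  obtain \<phi> where \<phi>: "max_entangled \<phi>" "vkern \<phi> = (\<lambda>p. singlet p / complex_of_real (sqrt 2))" "\<phi> \<in> carrier_vec 4"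
    using singlet_max_entangled by blast
  have \<Lambda>c: "\<Lambda> \<rho> \<in> carrier_mat 4 4" by (simp add: \<Lambda>_def one_way_map_def)
  let ?P = "of_kern (outer (vkern \<phi>))"
  have "(\<Lambda> \<rho> *\<^sub>v \<phi>) \<bullet>c \<phi> = tr2 (outer (vkern \<phi>)) (kern (\<Lambda> \<rho>))"
    by (simp add: expectation_kern[OF \<Lambda>c \<phi>(3)] tr2_outer)
  also have "\<dots> = tr_pair 4 (\<Lambda> \<rho>) ?P" by (subst tr_pair_commute) (simp add: tr_pair_kern)
  also have "\<dots> = tr2 (gap (pt (outer (\<lambda>p. of_mat2 A p / complex_of_real (sqrt 2))))) (kern \<rho>)"
    by (rule filter_protocol_value[OF \<rho> A B \<Lambda>_def]) (simp_all add: \<phi>(2) outer_div_sqrt2)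
  finally show ?thesis using that 1 \<phi>(1) \<Lambda>c by blast
qed

text \<open>The product is a pullback along the adjoint of \<open>A\<close> on the first qubit. The
  Bell projector has entries only between equal bits, which leaves the vectorization of
  \<open>A\<close> divided by \<open>sqrt 2\<close>.\<close>

lemma filter_of_solution_kern:
  assumes "A \<in> carrier_mat 2 2"
  shows "(A \<otimes>\<^sub>m 1\<^sub>m 2) * ket_bra bell * (mat_adjoint A \<otimes>\<^sub>m 1\<^sub>m 2)
    = of_kern (outer (\<lambda>p. of_mat2 A p / complex_of_real (sqrt 2)))"
proof -
  have A': "mat_adjoint A \<in> carrier_mat 2 2" by (rule mat_adjoint_carrier[OF assms])
  let ?L = "local_mat Alice 2 (mat_adjoint A)"
  have L: "?L \<in> carrier_mat 4 4" using local_mat_carrier[OF A', of Alice 2] by simp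
  have K: "ket_bra bell \<in> carrier_mat 4 4" by (simp add: ket_bra_def bell_def)
  have "mat_adjoint ?L = A \<otimes>\<^sub>m 1\<^sub>m 2"
    using assms L by (intro eq_matI) (auto simp: local_mat_def tensor_mat_def)
  then have e: "(A \<otimes>\<^sub>m 1\<^sub>m 2) * ket_bra bell * (mat_adjoint A \<otimes>\<^sub>m 1\<^sub>m 2) = pullback ?L (ket_bra bell)"
    by (simp add: pullback_def local_mat_def)
  have b: "kern (ket_bra bell) (i, j) (k, l) = (if i = j \<and> k = l then 1 / 2 else 0)" for i j k l
  proof -
    have "complex_of_real (sqrt 2) * complex_of_real (sqrt 2) = 2"
      by (metis of_real_mult real_sqrt_mult_self abs_numeral of_real_numeral)
    then show ?thesis
      by (cases i; cases j; cases k; cases l) (simp_all add: kern_def ket_bra_def bell_def)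
  qed
  have "kern (pullback ?L (ket_bra bell)) (i, j) (k, l) = outer (\<lambda>p. of_mat2 A p / complex_of_real (sqrt 2)) (i, j) (k, l)" for i j k l
    unfolding kern_pullback_Alice[OF A' K] b outer_div_sqrt2
    using assms by (cases j; cases l) (simp_all add: UNIV_bool outer_def of_mat2_def)
  then have "kern (pullback ?L (ket_bra bell)) = outer (\<lambda>p. of_mat2 A p / complex_of_real (sqrt 2))"
    by (intro ext) (metis prod.collapse)
  moreover have "pullback ?L (ket_bra bell) \<in> carrier_mat 4 4" by (rule pullback_carrier[OF L K])
  ultimately show ?thesis unfolding e by (metis of_kern_kern)
qed

definition mat2_of :: "(qq \<Rightarrow> complex) \<Rightarrow> complex mat" where
  "mat2_of y = mat 2 2 (\<lambda>(i, j). y (i = 1, j = 1))"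

lemma mat2_of_carrier [simp]: "mat2_of y \<in> carrier_mat 2 2"
  by (simp add: mat2_of_def)

lemma of_mat2_mat2_of [simp]: "of_mat2 (mat2_of y) = y"
proof
  fix p show "of_mat2 (mat2_of y) p = y p"
    by (cases p rule: qq_cases) (simp_all add: of_mat2_def mat2_of_def)
qed

section \<open>Separable states\<close>

lemma normalize_vector:
  fixes e :: "bool \<Rightarrow> complex"
  obtains u where "norm2 u = 1" "\<And>i j. outer e i j = complex_of_real (norm2 e) * outer u i j"
proof (cases "norm2 e = 0")
  case True
  then have "e i = 0" for i by (simp add: norm2_eq_0_iff)
  \<comment> \<open>A zero vector has weight 0, so any unit vector may stand in for it.\<close>
  then show ?thesis using True by (intro that[of "single False"]) (simp_all add: outer_def)
next
  case False
  then have p: "0 < norm2 e" by (simp add: order_less_le)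
  define u where "u i = 1 / complex_of_real (sqrt (norm2 e)) * e i" for i
  have "complex_of_real (sqrt (norm2 e)) * complex_of_real (sqrt (norm2 e)) = complex_of_real (norm2 e)"
    by (metis of_real_mult real_sqrt_mult_self abs_of_nonneg norm2_nonneg)
  then have "outer e i j = complex_of_real (norm2 e) * outer u i j" for i j
    using p by (simp add: outer_def u_def)
  moreover have "norm2 u = 1"
    unfolding u_def[abs_def] norm2_scale using p by (simp add: norm_divide power_divide)
  ultimately show ?thesis using that by blast
qed

definition proj2 :: "(bool \<Rightarrow> complex) \<Rightarrow> complex mat" where
  "proj2 u = mat 2 2 (\<lambda>(i, j). outer u (i = 1) (j = 1))"

lemma density_proj2:
  assumes "norm2 u = 1"
  shows "density 2 (proj2 u)"
proof -
  have "qf 2 (proj2 u) x = complex_of_real ((cmod (cdot (\<lambda>i. x (bit i)) u))\<^sup>2)" for x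
  proof -
    have "qf 2 (proj2 u) x = sesq (outer u) (\<lambda>i. x (bit i)) (\<lambda>i. x (bit i))"
      by (simp add: qf_def sesq_def sum_2 proj2_def UNIV_bool)
    then show ?thesis by (simp only: sesq_outer_self)
  qed
  then have "psd 2 (proj2 u)" by (simp add: psd_iff_qf less_eq_complex_def) (simp add: proj2_def)
  moreover have "mat_trace (proj2 u) = complex_of_real (norm2 u)"
  proof -
    have "dim_row (proj2 u) = 2" by (simp add: proj2_def)
    then have "mat_trace (proj2 u) = (\<Sum>i\<in>UNIV. outer u i i)"
      by (simp add: mat_trace_def sum_2 proj2_def UNIV_bool)
    then show ?thesis by (simp only: outer_def norm2_def of_real_sum complex_norm_square)
  qed
  ultimately show ?thesis using assms by (simp add: density_def)
qed

lemma kern_tensor_proj2: "kern (proj2 u \<otimes>\<^sub>m proj2 v) p q = outer (prodv u v) p q"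
proof -
  have c: "proj2 w \<in> carrier_mat 2 2" for w by (simp add: proj2_def)
  obtain i j k l where pq: "p = (i, j)" "q = (k, l)" by (cases p; cases q)
  show ?thesis
    unfolding pq kern_def ix_bit
    using tensor_index[OF c c, of "bit i" "bit j" "bit k" "bit l" u v]
    by (cases i; cases j; cases k; cases l) (simp_all add: proj2_def outer_def prodv_def)
qed

text \<open>The squared norms of the product vectors become the weights; they sum to the trace of
  \<open>\<rho>\<close>, which is 1.\<close>

lemma separable_of_sepc:
  assumes \<rho>: "two_qubit_state \<rho>" and sep: "sepc (kern \<rho>)"
  shows "separable \<rho>"
proof -
  have \<rho>c: "\<rho> \<in> carrier_mat 4 4" and tr: "mat_trace \<rho> = 1"
    using \<rho> by (auto simp: density_def psd_def)
  obtain efs where efs: "\<And>p q. kern \<rho> p q = (\<Sum>(e, f)\<leftarrow>efs. outer (prodv e f) p q)"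
    using sep unfolding sepc_def by blast
  define N where "N e = (SOME u. norm2 u = 1 \<and> (\<forall>i j. outer e i j = complex_of_real (norm2 e) * outer u i j))" for e :: "bool \<Rightarrow> complex"
  have N: "norm2 (N e) = 1 \<and> (\<forall>i j. outer e i j = complex_of_real (norm2 e) * outer (N e) i j)" for e
  proof -
    obtain u where "norm2 u = 1" "\<And>i j. outer e i j = complex_of_real (norm2 e) * outer u i j"
      using normalize_vector[of e] by blast
    then show ?thesis unfolding N_def by (intro someI_ex[of "\<lambda>u. norm2 u = 1 \<and> (\<forall>i j. outer e i j = complex_of_real (norm2 e) * outer u i j)"]) blast
  qed
  let ?e = "\<lambda>i. fst (efs ! i)" and ?f = "\<lambda>i. snd (efs ! i)"
  define p where "p i = norm2 (?e i) * norm2 (?f i)" for i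
  define M where "M i = complex_of_real (p i) \<cdot>\<^sub>m (proj2 (N (?e i)) \<otimes>\<^sub>m proj2 (N (?f i)))" for i
  have pc: "proj2 u \<otimes>\<^sub>m proj2 v \<in> carrier_mat 4 4" for u v
    using tensor_carrier[of "proj2 u" 2 2 "proj2 v" 2 2] by (simp add: proj2_def)
  then have Mc: "M i \<in> carrier_mat 4 4" for i by (simp add: M_def)
  have kM: "kern (M i) r s = outer (prodv (?e i) (?f i)) r s" for i r s
  proof -
    have "kern (M i) r s = complex_of_real (p i) * kern (proj2 (N (?e i)) \<otimes>\<^sub>m proj2 (N (?f i))) r s"
      using pc[of "N (?e i)" "N (?f i)"] by (simp add: M_def kern_def)
    also have "\<dots> = complex_of_real (p i) * outer (prodv (N (?e i)) (N (?f i))) r s"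
      by (simp only: kern_tensor_proj2)
    also have "\<dots> = outer (?e i) (fst r) (fst s) * outer (?f i) (snd r) (snd s)"
      unfolding N[THEN conjunct2, rule_format, of "?e i"] N[THEN conjunct2, rule_format, of "?f i"]
      by (simp add: p_def outer_def prodv_def)
    also have "\<dots> = outer (prodv (?e i) (?f i)) r s" by (simp add: outer_def prodv_def)
    finally show ?thesis .
  qed
  have list: "(\<Sum>x\<leftarrow>efs. h x) = (\<Sum>i<length efs. h (efs ! i))" for h :: "_ \<Rightarrow> complex"
    by (simp add: sum_list_sum_nth lessThan_atLeast0)
  have "\<rho> = sum_mats 4 4 (map M [0..<length efs])"
  proof (rule eq_matI)
    fix i j
    assume "i < dim_row (sum_mats 4 4 (map M [0..<length efs]))" "j < dim_col (sum_mats 4 4 (map M [0..<length efs]))"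
    then have ij: "i < 4" "j < 4" by simp_all
    have "sum_mats 4 4 (map M [0..<length efs]) $$ (i, j) = (\<Sum>W\<leftarrow>map M [0..<length efs]. W $$ (i, j))"
      using ij Mc by (intro sum_list_mats(2)) auto
    also have "\<dots> = (\<Sum>m<length efs. M m $$ (i, j))"
      by (simp add: sum_list_sum_nth lessThan_atLeast0)
    also have "\<dots> = (\<Sum>m<length efs. kern (M m) (qq_of i) (qq_of j))"
      using ij by (simp add: kern_def ix_qq_of)
    also have "\<dots> = kern \<rho> (qq_of i) (qq_of j)"
      unfolding efs kM list by (simp add: case_prod_unfold)
    also have "\<dots> = \<rho> $$ (i, j)" using ij by (simp add: kern_def ix_qq_of)
    finally show "\<rho> $$ (i, j) = sum_mats 4 4 (map M [0..<length efs]) $$ (i, j)" ..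
  qed (use \<rho>c in auto)
  moreover have "(\<Sum>i<length efs. p i) = 1"
  proof -
    have "complex_of_real (\<Sum>i<length efs. p i) = (\<Sum>i<length efs. \<Sum>r\<in>UNIV. outer (prodv (?e i) (?f i)) r r)"
      unfolding of_real_sum
    proof (intro sum.cong refl)
      fix i
      have "complex_of_real (p i) = complex_of_real (norm2 (prodv (?e i) (?f i)))" by (simp add: p_def norm2_prodv)
      then show "complex_of_real (p i) = (\<Sum>r\<in>UNIV. outer (prodv (?e i) (?f i)) r r)"
        by (simp only: norm2_def outer_def of_real_sum complex_norm_square)
    qed
    also have "\<dots> = (\<Sum>r\<in>UNIV. \<Sum>i<length efs. outer (prodv (?e i) (?f i)) r r)" by (rule sum.swap)
    also have "\<dots> = (\<Sum>r\<in>UNIV. kern \<rho> r r)" unfolding efs list by (simp add: case_prod_unfold)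
    also have "\<dots> = 1" using tr \<rho>c by (simp add: mat_trace_def sum_4 kern_def)
    finally show ?thesis by (simp only: of_real_eq_1_iff)
  qed
  moreover have "0 \<le> p i" for i by (simp add: p_def)
  ultimately show ?thesis
    unfolding separable_def using N density_proj2
    by (intro exI[of _ "length efs"] exI[of _ p] exI[of _ "\<lambda>i. proj2 (N (?e i))"] exI[of _ "\<lambda>i. proj2 (N (?f i))"])
      (simp add: M_def[abs_def])
qed

section \<open>Optimal value and optimal solutions\<close>

lemma tr2_gap_outer:
  assumes "two_qubit_state \<rho>"
  shows "tr2 (gap (pt (outer y))) (kern \<rho>) = 1 / 2 - sesq (pt (kern \<rho>)) y y"
proof -
  have "tr2 (gap (pt (outer y))) (kern \<rho>) = tr2 (\<lambda>p q. if p = q then 1 / 2 else 0) (pt (pt (kern \<rho>))) - tr2 (outer y) (pt (kern \<rho>))"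
    by (simp only: tr2_gap tr2_pt pt_pt)
  moreover have "tr2 (\<lambda>p q. if p = q then 1 / 2 else 0) (kern \<rho>) = 1 / 2"
  proof -
    have "tr2 (\<lambda>p q. if p = q then 1 / 2 else 0) (kern \<rho>) = tr2 (\<lambda>p q. if p = q then 1 / 2 else 0) (pt (kern \<rho>))"
      by (simp add: tr2_def pt_def sum_qq UNIV_bool)
    then show ?thesis using tr2_half[OF assms] by simp
  qed
  ultimately show ?thesis by (simp add: tr2_outer)
qed

lemma sesq_div_sqrt2:
  "Re (sesq K (\<lambda>p. y p / complex_of_real (sqrt 2)) (\<lambda>p. y p / complex_of_real (sqrt 2))) = Re (sesq K y y) / 2"
  using Re_sesq_scale[of K "1 / complex_of_real (sqrt 2)" y] by (simp add: norm_divide power_divide)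

text \<open>The partial transpose of a product projector is again a positive product kernel, so
  removing such terms only enlarges \<open>I / 2 - X\<^sup>\<Gamma>\<close>.\<close>

lemma feas_split:
  assumes "feas X"
  obtains y efs where "contraction y"
    "X = (\<lambda>p q. outer (\<lambda>p. y p / complex_of_real (sqrt 2)) p q + (\<Sum>(e, f)\<leftarrow>efs. outer (prodv e f) p q))"
proof -
  have X: "pos X" "pos (gap (pt X))" using assms by (auto simp: feas_def)
  obtain y efs where K: "X = (\<lambda>p q. outer y p q + (\<Sum>(e, f)\<leftarrow>efs. outer (prodv e f) p q))"
    using pos_split[OF X(1)] by blast
  define w where "w p = complex_of_real (sqrt 2) * y p" for p
  have w: "y = (\<lambda>p. w p / complex_of_real (sqrt 2))" by (simp add: w_def)
  have "gap (pt (outer y)) = (\<lambda>p q. gap (pt X) p q + (\<Sum>(e, f)\<leftarrow>efs. outer (prodv e (cnjv f)) p q))"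
    unfolding K by (intro ext) (simp add: gap_def pt_def outer_def prodv_def cnjv_def case_prod_unfold mult_ac)
  moreover have "pos (\<lambda>p q. \<Sum>(e, f)\<leftarrow>efs. outer (prodv e (cnjv f)) p q)"
    unfolding case_prod_unfold by (rule pos_sum_list) (rule pos_outer)
  ultimately have "feas (outer y)" using pos_add[OF X(2)] by (simp add: feas_def pos_outer)
  then have "contraction w" using feas_outer_iff[of w] by (simp flip: w)
  then show ?thesis using that K w by blast
qed

lemma tr2_split:
  "tr2 (\<lambda>p q. outer y p q + (\<Sum>(e, f)\<leftarrow>efs. outer (prodv e f) p q)) (pt K)
    = sesq (pt K) y y + (\<Sum>(e, f)\<leftarrow>efs. sesq K (prodv e (cnjv f)) (prodv e (cnjv f)))"
  by (simp add: tr2_plus tr2_outer tr2_sum_list case_prod_unfold sesq_pt_prodv)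

lemma Re_sum_list: "Re (\<Sum>x\<leftarrow>xs. f x) = (\<Sum>x\<leftarrow>xs. Re (f x))"
  by (induction xs) simp_all

lemma sum_list_nonneg_eq_0D:
  fixes f :: "'a \<Rightarrow> real"
  shows "\<forall>x\<in>set xs. 0 \<le> f x \<Longrightarrow> (\<Sum>x\<leftarrow>xs. f x) \<le> 0 \<Longrightarrow> x \<in> set xs \<Longrightarrow> f x = 0"
proof (induction xs)
  case (Cons a xs)
  have "0 \<le> (\<Sum>x\<leftarrow>xs. f x)" using Cons.prems(1) by (intro sum_list_nonneg) auto
  then have "f a = 0" "(\<Sum>x\<leftarrow>xs. f x) \<le> 0" using Cons.prems(1,2) by auto
  then show ?case using Cons by auto
qed simp

lemma sdp_value_le:
  assumes \<rho>: "two_qubit_state \<rho>" and q: "lower_bound (pt (kern \<rho>)) q" and X: "sdp_feasible X"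
  shows "sdp_value \<rho> X \<le> 1 / 2 - q / 2"
proof -
  have K: "pos (kern \<rho>)" using \<rho> by (simp add: density_def psd_kern)
  have X': "X \<in> carrier_mat 4 4" "feas (kern X)" using X by (auto simp: sdp_feasible_kern)
  obtain y efs where y: "contraction y"
    and s: "kern X = (\<lambda>p q. outer (\<lambda>p. y p / complex_of_real (sqrt 2)) p q + (\<Sum>(e, f)\<leftarrow>efs. outer (prodv e f) p q))"
    using feas_split[OF X'(2)] by blast
  have "0 \<le> (\<Sum>(e, f)\<leftarrow>efs. Re (sesq (kern \<rho>) (prodv e (cnjv f)) (prodv e (cnjv f))))"
    using posD_Re[OF K] by (intro sum_list_nonneg) auto
  moreover have "q / 2 \<le> Re (sesq (pt (kern \<rho>)) (\<lambda>p. y p / complex_of_real (sqrt 2)) (\<lambda>p. y p / complex_of_real (sqrt 2)))"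
    using q y by (simp add: sesq_div_sqrt2 lower_bound_def)
  ultimately show ?thesis
    unfolding sdp_value_kern[OF X'(1)] s tr2_split by (simp add: Re_sum_list case_prod_unfold)
qed

lemma optimal_is_rank_one:
  assumes \<rho>: "two_qubit_state \<rho>" and q: "lower_bound (pt (kern \<rho>)) q" "q < 0"
    and X: "sdp_feasible X" and opt: "sdp_value \<rho> X = 1 / 2 - q / 2"
  obtains y where "contraction y" "kern X = outer (\<lambda>p. y p / complex_of_real (sqrt 2))" "q = Re (sesq (pt (kern \<rho>)) y y)"
proof -
  have K: "pos (kern \<rho>)" using \<rho> by (simp add: density_def psd_kern)
  have X': "X \<in> carrier_mat 4 4" "feas (kern X)" using X by (auto simp: sdp_feasible_kern)
  obtain y efs where y: "contraction y"
    and s: "kern X = (\<lambda>p q. outer (\<lambda>p. y p / complex_of_real (sqrt 2)) p q + (\<Sum>(e, f)\<leftarrow>efs. outer (prodv e f) p q))"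
    using feas_split[OF X'(2)] by blast
  let ?y = "\<lambda>p. y p / complex_of_real (sqrt 2)"
  define Z where "Z ef = Re (sesq (kern \<rho>) (prodv (fst ef) (cnjv (snd ef))) (prodv (fst ef) (cnjv (snd ef))))" for ef
  have Z0: "\<forall>x\<in>set efs. 0 \<le> Z x" using posD_Re[OF K] by (simp add: Z_def)
  have qy: "q \<le> Re (sesq (pt (kern \<rho>)) y y)" using q(1) y by (simp add: lower_bound_def)
  have val: "q / 2 = Re (sesq (pt (kern \<rho>)) y y) / 2 + (\<Sum>x\<leftarrow>efs. Z x)"
    using opt unfolding sdp_value_kern[OF X'(1)] s tr2_split
    by (simp add: Re_sum_list case_prod_unfold sesq_div_sqrt2 Z_def)
  \<comment> \<open>The first summand alone is at least \<open>q / 2\<close>, so optimality leaves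
    nothing for the product terms: each conjugated product vector lies in the kernel of
    \<open>\<rho>\<close>.\<close>
  then have "(\<Sum>x\<leftarrow>efs. Z x) \<le> 0" using qy by simp
  then have Zz: "Z x = 0" if "x \<in> set efs" for x using sum_list_nonneg_eq_0D[OF Z0] that by blast
  have "0 \<le> (\<Sum>x\<leftarrow>efs. Z x)" using Z0 by (intro sum_list_nonneg) auto
  then have qe: "q = Re (sesq (pt (kern \<rho>)) y y)" using val qy by simp
  have zero: "prodv e f r = 0" if ef: "(e, f) \<in> set efs" for e f r
  proof -
    let ?c = "complex_of_real (sqrt 2)"
    \<comment> \<open>The matrix \<open>y\<close> enters \<open>X\<close> with the factor
      \<open>1 / sqrt 2\<close>; scaling the product term by \<open>sqrt 2\<close> turns the bound
      1/2 into the bound 1 of \<open>no_residue\<close>.\<close>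
    let ?g = "\<lambda>i. ?c * e i"
    have "prodv ?g f r = 0"
    proof (rule no_residue[OF K y q(1) qe q(2)])
      have sc: "prodv ?g (cnjv f) = (\<lambda>p. ?c * prodv e (cnjv f) p)" by (simp add: fun_eq_iff prodv_def)
      show "Re (sesq (kern \<rho>) (prodv ?g (cnjv f)) (prodv ?g (cnjv f))) = 0"
        unfolding sc Re_sesq_scale using Zz[OF ef] by (simp add: Z_def)
      fix z
      have "0 \<le> Re (sesq (gap (pt (kern X))) z z)" using X'(2) by (intro posD_Re) (simp add: feas_def)
      then have 1: "Re (sesq (pt (kern X)) z z) \<le> norm2 z / 2" by (simp add: sesq_gap)
      have "pt (kern X) = (\<lambda>p q. pt (outer ?y) p q + (\<Sum>(e, f)\<leftarrow>efs. outer (prodv e (cnjv f)) p q))"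
        unfolding s by (intro ext) (simp add: pt_def outer_def prodv_def cnjv_def case_prod_unfold mult_ac)
      then have 2: "Re (sesq (pt (kern X)) z z) = Re (sesq (pt (outer ?y)) z z)
          + (\<Sum>x\<leftarrow>efs. (cmod (cdot z (prodv (fst x) (cnjv (snd x)))))\<^sup>2)"
        by (simp add: sesq_plus case_prod_unfold sesq_sum_list sesq_outer_self Re_sum_list)
      have 3: "(cmod (cdot z (prodv e (cnjv f))))\<^sup>2 \<le> (\<Sum>x\<leftarrow>efs. (cmod (cdot z (prodv (fst x) (cnjv (snd x)))))\<^sup>2)"
        using member_le_sum_list[of "(cmod (cdot z (prodv e (cnjv f))))\<^sup>2" "map (\<lambda>x. (cmod (cdot z (prodv (fst x) (cnjv (snd x)))))\<^sup>2) efs"] ef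
        by force
      have "pt (outer ?y) = (\<lambda>p q. 1 / 2 * pt (outer y) p q)"
        by (intro ext) (simp only: pt_def outer_div_sqrt2, simp)
      then have 4: "Re (sesq (pt (outer ?y)) z z) = Re (sesq (pt (outer y)) z z) / 2"
        by (simp only: sesq_scale) simp
      have "cdot z (prodv ?g (cnjv f)) = ?c * cdot z (prodv e (cnjv f))"
        by (simp add: cdot_def prodv_def sum_distrib_left mult_ac)
      then have "(cmod (cdot z (prodv ?g (cnjv f))))\<^sup>2 = 2 * (cmod (cdot z (prodv e (cnjv f))))\<^sup>2"
        by (simp add: norm_mult power_mult_distrib)
      then show "Re (sesq (pt (outer y)) z z) + (cmod (cdot z (prodv ?g (cnjv f))))\<^sup>2 \<le> norm2 z"
        using 1 2 3 4 by simp
    qed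
    then show ?thesis by (simp add: prodv_def)
  qed
  have "(\<Sum>(e, f)\<leftarrow>efs. outer (prodv e f) p q) = 0" for p q
  proof -
    have "outer (prodv e f) p q = 0" if "(e, f) \<in> set efs" for e f
      by (simp add: outer_def zero[OF that])
    then have "(\<Sum>(e, f)\<leftarrow>efs. outer (prodv e f) p q) = (\<Sum>x\<leftarrow>efs. 0)"
      by (intro arg_cong[where f = sum_list] map_cong) auto
    then show ?thesis by simp
  qed
  then have "kern X = outer ?y" unfolding s by (simp add: fun_eq_iff)
  then show ?thesis using that y qe by blast
qed

text \<open>An entangled state has a partial transpose that is not positive; a negative direction is
  scaled into the unit ball by its Hilbert--Schmidt norm.\<close>

lemma NPT_lower_bound_negative:
  assumes \<rho>: "two_qubit_state \<rho>" "\<not> separable \<rho>" and q: "lower_bound (pt (kern \<rho>)) q"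
  shows "q < 0"
proof -
  have K: "pos (kern \<rho>)" using \<rho> by (simp add: density_def psd_kern)
  have "\<not> pos (pt (kern \<rho>))" using Peres_Horodecki[OF K] separable_of_sepc \<rho> by blast
  then obtain x where x: "\<not> 0 \<le> sesq (pt (kern \<rho>)) x x" unfolding pos_def by blast
  have "Im (sesq (pt (kern \<rho>)) x x) = 0"
    using pos_pt_hermitian[OF K, of x x] by (simp add: complex_eq_iff)
  then have neg: "Re (sesq (pt (kern \<rho>)) x x) < 0" using x by (simp add: less_eq_complex_def)
  have nz: "0 < norm2 x"
  proof (rule ccontr)
    assume "\<not> 0 < norm2 x"
    then have "norm2 x = 0" using norm2_nonneg[of x] by simp
    then have "x p = 0" for p unfolding norm2_eq_0_iff by blast
    then show False using neg by (simp add: sesq_def)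
  qed
  have "(cmod (amp x e f))\<^sup>2 \<le> norm2 x * (norm2 e * norm2 f)" for e f by (rule amp_Cauchy_Schwarz)
  then have "norm2 x * q \<le> Re (sesq (pt (kern \<rho>)) x x)" by (rule lower_boundD_scaled[OF q nz])
  then have "norm2 x * q < 0" using neg by simp
  then show ?thesis using nz by (simp add: mult_less_0_iff)
qed

theorem theorem2:
  fixes \<rho> :: "complex mat"
  assumes "two_qubit_state \<rho>"
  shows "(\<exists>p A \<Lambda>. filter_protocol p A \<Lambda> \<and> one_way_locc \<Lambda> \<and> optimal_locc \<rho> \<Lambda> \<and>
            fidelity (\<Lambda> \<rho>) = max_fidelity \<rho>) \<and>
         (\<exists>X. sdp_optimal \<rho> X) \<and>
         (\<forall>X. sdp_optimal \<rho> X \<longrightarrow>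
            complex_of_real (max_fidelity \<rho>) = 1 / 2 - mat_trace (X * partial_transpose \<rho>)) \<and>
         (entangled \<rho> \<longrightarrow>
            max_fidelity \<rho> > 1 / 2 \<and>
            (\<forall>X. sdp_optimal \<rho> X \<longrightarrow>
               vec_space.rank 4 X = 1 \<and>
               (\<exists>A. filter_of_solution X A) \<and>
               (\<forall>A. filter_of_solution X A \<longrightarrow>
                  (\<exists>\<Lambda>. filter_protocol Bob A \<Lambda> \<and> optimal_locc \<rho> \<Lambda> \<and>
                     fidelity (\<Lambda> \<rho>) = max_fidelity \<rho>))))"
proof -
  let ?s = "\<lambda>y p. y p / complex_of_real (sqrt 2)"
  have \<rho>c: "\<rho> \<in> carrier_mat 4 4" and K: "pos (kern \<rho>)"
    using assms by (simp_all add: density_def psd_kern)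
  obtain y where y: "contraction y" "lower_bound (pt (kern \<rho>)) (Re (sesq (pt (kern \<rho>)) y y))"
    using minimizer_exists by blast
  \<comment> \<open>The minimum over all contractions. It is halved in \<open>F\<close> because a
    contraction enters the program divided by \<open>sqrt 2\<close>.\<close>
  define q where "q = Re (sesq (pt (kern \<rho>)) y y)"
  define F where "F = 1 / 2 - q / 2"
  have lb: "lower_bound (pt (kern \<rho>)) q" using y(2) by (simp add: q_def)
  have expect_le: "Re ((\<Lambda> \<rho> *\<^sub>v \<phi>) \<bullet>c \<phi>) \<le> F" if "locc_two_qubits \<Lambda>" "max_entangled \<phi>" for \<Lambda> \<phi>
    using locc_expectation_bound[OF assms that] sdp_value_le[OF assms lb] unfolding F_def by metis
  have bdd: "bdd_above {Re ((\<Lambda> \<rho> *\<^sub>v \<phi>) \<bullet>c \<phi>) | \<phi>. max_entangled \<phi>}" if "locc_two_qubits \<Lambda>" for \<Lambda>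
    using expect_le[OF that] by (auto simp: bdd_above_def)
  have fid_le: "fidelity (\<Lambda> \<rho>) \<le> F" if "locc_two_qubits \<Lambda>" for \<Lambda>
    unfolding fidelity_def
  proof (rule cSup_least)
    show "{Re ((\<Lambda> \<rho> *\<^sub>v \<phi>) \<bullet>c \<phi>) | \<phi>. max_entangled \<phi>} \<noteq> {}" using singlet_max_entangled by blast
  qed (use expect_le[OF that] in auto)
  \<comment> \<open>Stated for every contraction reaching the minimum: it gives the optimal protocol
    for the minimizer and later for each filter read off from a solution.\<close>
  have protocol: "\<exists>\<Lambda>. filter_protocol Bob A \<Lambda> \<and> one_way_locc \<Lambda> \<and> locc_two_qubits \<Lambda> \<and> fidelity (\<Lambda> \<rho>) = F"
    if A: "A \<in> carrier_mat 2 2" "contraction (of_mat2 A)" "Re (sesq (pt (kern \<rho>)) (of_mat2 A) (of_mat2 A)) = q" for A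
  proof -
    obtain \<Lambda> \<phi> where \<Lambda>: "filter_protocol Bob A \<Lambda>" "max_entangled \<phi>"
      "(\<Lambda> \<rho> *\<^sub>v \<phi>) \<bullet>c \<phi> = tr2 (gap (pt (outer (?s (of_mat2 A))))) (kern \<rho>)"
      using filter_protocol_exists[OF \<rho>c A(1,2)] by blast
    have ow: "one_way_locc \<Lambda>" by (rule filter_protocol_one_way[OF \<Lambda>(1)])
    then have lo: "locc_two_qubits \<Lambda>" by (rule one_way_locc_is_locc)
    have "Re ((\<Lambda> \<rho> *\<^sub>v \<phi>) \<bullet>c \<phi>) = F"
      unfolding \<Lambda>(3) tr2_gap_outer[OF assms] F_def using A(3) by (simp add: sesq_div_sqrt2)
    then have "F \<le> fidelity (\<Lambda> \<rho>)"
      unfolding fidelity_def using \<Lambda>(2) by (intro cSup_upper bdd[OF lo]) auto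
    then show ?thesis using \<Lambda>(1) ow lo fid_le[OF lo] by force
  qed
  obtain \<Lambda>0 where \<Lambda>0: "filter_protocol Bob (mat2_of y) \<Lambda>0" "one_way_locc \<Lambda>0" "locc_two_qubits \<Lambda>0" "fidelity (\<Lambda>0 \<rho>) = F"
    using protocol[of "mat2_of y"] y(1) by (auto simp: q_def)
  have maxF: "max_fidelity \<rho> = F"
    unfolding max_fidelity_def
  proof (rule cSup_eq_maximum)
    show "F \<in> {fidelity (\<Lambda> \<rho>) | \<Lambda>. locc_two_qubits \<Lambda>}" using \<Lambda>0(3,4) by blast
  qed (use fid_le in auto)
  have optimal: "optimal_locc \<rho> \<Lambda>" if "locc_two_qubits \<Lambda>" "fidelity (\<Lambda> \<rho>) = F" for \<Lambda>
    using that fid_le by (simp add: optimal_locc_def)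
  let ?X = "of_kern (outer (?s y))"
  have Xf: "sdp_feasible ?X" by (simp add: sdp_feasible_kern feas_outer_iff y(1))
  have Xv: "sdp_value \<rho> ?X = F"
    by (simp add: sdp_value_kern tr2_outer sesq_div_sqrt2 F_def q_def)
  have Xo: "sdp_optimal \<rho> ?X"
    using Xf Xv sdp_value_le[OF assms lb] by (simp add: sdp_optimal_def F_def)
  have optv: "sdp_feasible X \<and> sdp_value \<rho> X = F" if "sdp_optimal \<rho> X" for X
    using that Xf Xv sdp_value_le[OF assms lb] unfolding sdp_optimal_def F_def by force
  have "complex_of_real F = 1 / 2 - mat_trace (X * partial_transpose \<rho>)" if X: "sdp_optimal \<rho> X" for X
  proof -
    have Xc: "X \<in> carrier_mat 4 4" "pos (kern X)" using optv[OF X] by (auto simp: sdp_feasible_kern feas_def)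
    have "pt (kern \<rho>) b a = cnj (pt (kern \<rho>) a b)" for a b
      unfolding pt_def by (rule pos_hermitian_entry[OF K])
    \<comment> \<open>The trace formula is an equation of complex numbers, so its imaginary part has
      to be shown to vanish.\<close>
    then have "Im (tr2 (kern X) (pt (kern \<rho>))) = 0" by (rule tr2_pos_real[OF Xc(2)])
    moreover have "mat_trace (X * partial_transpose \<rho>) = tr2 (kern X) (pt (kern \<rho>))"
      using Xc(1) by (simp add: mat_trace_mult tr_pair_kern kern_partial_transpose)
    moreover have "F = 1 / 2 - Re (tr2 (kern X) (pt (kern \<rho>)))"
      using optv[OF X] by (simp add: sdp_value_kern[OF Xc(1)])
    ultimately show ?thesis by (simp add: complex_eq_iff)
  qed
  moreover have "F > 1 / 2 \<and> (\<forall>X. sdp_optimal \<rho> X \<longrightarrow>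
      vec_space.rank 4 X = 1 \<and> (\<exists>A. filter_of_solution X A) \<and>
      (\<forall>A. filter_of_solution X A \<longrightarrow> (\<exists>\<Lambda>. filter_protocol Bob A \<Lambda> \<and> optimal_locc \<rho> \<Lambda> \<and> fidelity (\<Lambda> \<rho>) = F)))"
    if ent: "entangled \<rho>"
  proof (intro conjI allI impI)
    have q0: "q < 0" using NPT_lower_bound_negative[OF assms _ lb] ent by (simp add: entangled_def)
    then show "F > 1 / 2" by (simp add: F_def)
    fix X
    assume X: "sdp_optimal \<rho> X"
    then obtain w where w: "contraction w" "kern X = outer (?s w)" "q = Re (sesq (pt (kern \<rho>)) w w)"
      using optimal_is_rank_one[OF assms lb q0] optv unfolding F_def by metis
    have Xc: "X \<in> carrier_mat 4 4" using optv[OF X] by (simp add: sdp_feasible_kern)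
    have Xe: "X $$ (i, j) = ?s w (qq_of i) * cnj (?s w (qq_of j))" if "i < 4" "j < 4" for i j
      using w(2) that by (metis kern_def ix_qq_of outer_def)
    \<comment> \<open>The zero vector would give \<open>q = 0\<close>; so the rank is not 0.\<close>
    have "\<exists>p. w p \<noteq> 0"
    proof (rule ccontr)
      assume "\<not> ?thesis"
      then have "w p = 0" for p by blast
      then show False using w(3) q0 by (simp add: sesq_def)
    qed
    then obtain p where p: "w p \<noteq> 0" by blast
    have "X $$ (ix p, ix p) \<noteq> 0" using p by (simp add: Xe)
    then have "1 \<le> vec_space.rank 4 X" by (intro vec_space_rank_ge_1[OF Xc, of "ix p" "ix p"]) simp_all
    moreover have "vec_space.rank 4 X \<le> 1" by (rule vec_space_rank_le_1[OF Xc Xe])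
    ultimately show "vec_space.rank 4 X = 1" by simp
    have "X = of_kern (outer (?s (of_mat2 (mat2_of w))))"
      using of_kern_kern[OF Xc] w(2) by simp
    then have "filter_of_solution X (mat2_of w)"
      using filter_of_solution_kern[OF mat2_of_carrier, of w] by (simp add: filter_of_solution_def)
    then show "\<exists>A. filter_of_solution X A" by blast
    fix A
    assume A: "filter_of_solution X A"
    then have Ac: "A \<in> carrier_mat 2 2" and "X = of_kern (outer (?s (of_mat2 A)))"
      using filter_of_solution_kern by (auto simp: filter_of_solution_def)
    then have kA: "kern X = outer (?s (of_mat2 A))" by simp
    \<comment> \<open>Feasibility and value of \<open>X\<close> determine all that is needed of
      \<open>A\<close>, so every matrix representing \<open>X\<close> is an optimal filter.\<close>
    have "contraction (of_mat2 A)"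
      using optv[OF X] by (simp add: sdp_feasible_kern kA feas_outer_iff)
    moreover have "Re (sesq (pt (kern \<rho>)) (of_mat2 A) (of_mat2 A)) = q"
      using optv[OF X] by (simp add: sdp_value_kern[OF Xc] kA tr2_outer sesq_div_sqrt2 F_def)
    ultimately show "\<exists>\<Lambda>. filter_protocol Bob A \<Lambda> \<and> optimal_locc \<rho> \<Lambda> \<and> fidelity (\<Lambda> \<rho>) = F"
      using protocol[OF Ac] optimal by blast
  qed
  ultimately show ?thesis
    unfolding maxF using \<Lambda>0 optimal Xo by blast
qed

end
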